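(* Let $\alpha\in B_k$ and $\gamma\in B_p$ be braids whose closures $\hat\alpha$ and $\hat\gamma$ are knots. If $\operatorname{ar}(\hat\alpha)=k$ and $\operatorname{ar}(\hat\gamma)=p$, then $\operatorname{ar}(K(\alpha,\gamma))=kp$, where $K(\alpha,\gamma)$ is the braid satellite associated to $\alpha,\gamma$ and $\operatorname{ar}$ denotes augmentation rank.
   Context: Braids. $B_n$ is the braid group on $n$ strands with Artin generators $\sigma_1,\dots,\sigma_{n-1}$. Braids are oriented left to right, strands numbered $1,\dots,n$ from top to bottom; in $\sigma_i$ only strands $i,i+1$ interact and cross once, the strand starting at position $i$ passing over (a positive crossing). $\hat\beta$ is the braid closure of $\beta$. The writhe $w(\beta)$ is the exponent sum of $\beta$ in the Artin generators. Braid satellite. For $\alpha\in B_k$, let $\imath_p(\alpha)\in B_{kp}$ be obtained by replacing each strand of $\alpha$ by $p$ parallel copies in the blackboard framing; equivalently $\imath_p:B_k\to B_{kp}$ is the homomorphism with $\imath_p(\sigma_n)=\tau_{m+p-1}\tau_{m+p-2}\cdots\tau_{m}$, where $m=(n-1)p+1$ and $\tau_s=\sigma_s\sigma_{s+1}\cdots\sigma_{s+p-1}$. For $\gamma\in B_p$ let $\bar\gamma\in B_{kp}$ be its image under $\sigma_i\mapsto\sigma_i$, $1\le i\le p-1$. Set $\gamma(\alpha)=\imath_p(\alpha)\bar\gamma$ and $K(\alpha,\gamma)=\widehat{\gamma(\alpha)}$. This is a knot when $\hat\alpha,\hat\gamma$ are knots. Augmentation rank. $\mathcal A_n$ is the free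 noncommutative unital $\mathbb Z$-algebra on $a_{ij}$, $1\le i\neq j\le n$. Define the homomorphism $\phi:B_n\to\operatorname{Aut}\mathcal A_n$, $\beta\mapsto\phi_\beta$ (with $\phi_{\beta_1\beta_2}=\phi_{\beta_1}\circ\phi_{\beta_2}$) by: $\phi_{\sigma_k}$ sends $a_{ij}\mapsto a_{ij}$ for $i,j\ne k,k+1$; $a_{k,k+1}\mapsto -a_{k+1,k}$; $a_{k+1,k}\mapsto -a_{k,k+1}$; and for $i\neq k,k+1$: $a_{k+1,i}\mapsto a_{ki}$, $a_{i,k+1}\mapsto a_{ik}$, $a_{ki}\mapsto a_{k+1,i}-a_{k+1,k}a_{ki}$, $a_{ik}\mapsto a_{i,k+1}-a_{ik}a_{k,k+1}$. For $\beta\in B_n$ let $\phi_\beta^*\in\operatorname{Aut}\mathcal A_{n+1}$ be $\phi$ of the image of $\beta$ under $B_n\hookrightarrow B_{n+1}$, $\sigma_i\mapsto\sigma_i$. Define $n\times n$ matrices $\Phi_\beta^L,\Phi_\beta^R$ over $\mathcal A_n$ by $\phi^*_\beta(a_{i,n+1})=\sum_{j=1}^n(\Phi^L_\beta)_{ij}a_{j,n+1}$ and $\phi^*_\beta(a_{n+1,i})=\sum_{j=1}^n a_{n+1,j}(\Phi^R_\beta)_{ji}$. Let $R_0=\mathbb Z[\lambda^{\pm1},\mu^{\pm1}]$, let $\mathbf A$ be the $n\times n$ matrix with $\mathbf A_{ij}=a_{ij}$ for $i<j$, $\mathbf A_{ij}=-\mu a_{ij}$ for $i>j$, $\mathbf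 A_{ii}=1-\mu$, and let $\mathbf\Lambda=\operatorname{diag}[\lambda\mu^{w(\beta)},1,\dots,1]$. If a knot $K$ is the closure of $\beta\in B_n$, let $\mathcal I\subset\mathcal A_n\otimes R_0$ be the two-sided ideal generated by the entries of $\mathbf A-\mathbf\Lambda\Phi^L_\beta\mathbf A$ and $\mathbf A-\mathbf A\Phi^R_\beta\mathbf\Lambda^{-1}$. An augmentation of $K$ is a (unital ring) homomorphism $\epsilon:\mathcal A_n\otimes R_0\to\mathbb C$ vanishing on $\mathcal I$. If $\epsilon(\mu)\ne1$, its rank is the rank of the complex matrix $\epsilon(\mathbf A)$. The augmentation rank $\operatorname{ar}(K)$ is the maximum rank among augmentations of $K$ with $\epsilon(\mu)\neq 1$; it is finite and does not depend on the braid $\beta$ representing $K$. *)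

theory Defs
  imports
    "HOL-Algebra.Ideal"
    "HOL-Algebra.Bij"
    "HOL-Algebra.Elementary_Groups"
    "HOL-Algebra.Sym_Groups"
    "HOL-Combinatorics.Orbits"
    "HOL-Library.Poly_Mapping"
    "HOL-Library.Product_Plus"
    "Jordan_Normal_Form.DL_Rank"
begin

section \<open>Braid groups\<close>

text \<open>A letter \<open>(i, True)\<close> stands for the Artin generator \<open>\<sigma>\<^sub>i\<close> and \<open>(i, False)\<close> for its inverse.
  The braid group is given by Artin's presentation: words modulo the congruence generated by
  free cancellation and the braid relations. Braids are composed left to right.\<close>

type_synonym braid_word = "(nat \<times> bool) list"
type_synonym braid = "braid_word set"

definition braid_words :: "nat \<Rightarrow> braid_word set" where
  "braid_words n = lists ({1..<n} \<times> UNIV)"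

inductive braid_eq :: "nat \<Rightarrow> braid_word \<Rightarrow> braid_word \<Rightarrow> bool" for n :: nat where
  refl: "u \<in> braid_words n \<Longrightarrow> braid_eq n u u"
| sym: "braid_eq n u v \<Longrightarrow> braid_eq n v u"
| trans: "braid_eq n u v \<Longrightarrow> braid_eq n v w \<Longrightarrow> braid_eq n u w"
| cancel: "u \<in> braid_words n \<Longrightarrow> v \<in> braid_words n \<Longrightarrow> i \<in> {1..<n} \<Longrightarrow>
    braid_eq n (u @ [(i, b), (i, \<not> b)] @ v) (u @ v)"
| far: "u \<in> braid_words n \<Longrightarrow> v \<in> braid_words n \<Longrightarrow> i \<in> {1..<n} \<Longrightarrow> j \<in> {1..<n} \<Longrightarrow> i + 2 \<le> j \<Longrightarrow>
    braid_eq n (u @ [(i, True), (j, True)] @ v) (u @ [(j, True), (i, True)] @ v)"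
| braid: "u \<in> braid_words n \<Longrightarrow> v \<in> braid_words n \<Longrightarrow> i \<in> {1..<n} \<Longrightarrow> Suc i \<in> {1..<n} \<Longrightarrow>
    braid_eq n (u @ [(i, True), (Suc i, True), (i, True)] @ v)
               (u @ [(Suc i, True), (i, True), (Suc i, True)] @ v)"

definition braid_class :: "nat \<Rightarrow> braid_word \<Rightarrow> braid" where
  "braid_class n u = {v. braid_eq n u v}"

definition braid_group :: "nat \<Rightarrow> braid monoid" where
  "braid_group n =
    \<lparr>carrier = braid_class n ` braid_words n,
     monoid.mult = (\<lambda>X Y. \<Union>u\<in>X. \<Union>v\<in>Y. braid_class n (u @ v)),
     one = braid_class n []\<rparr>"

definition braid_gen :: "nat \<Rightarrow> nat \<Rightarrow> braid" where
  "braid_gen n i = braid_class n [(i, True)]"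

text \<open>The homomorphism \<open>B\<^sub>n \<rightarrow> G\<close> determined by \<open>\<sigma>\<^sub>i \<mapsto> s i\<close>, for a group \<open>G\<close> and elements
  \<open>s 1, \<dots>, s (n - 1)\<close> satisfying the braid relations.\<close>

definition braid_hom :: "nat \<Rightarrow> ('b, 'c) monoid_scheme \<Rightarrow> (nat \<Rightarrow> 'b) \<Rightarrow> braid \<Rightarrow> 'b" where
  "braid_hom n G s =
    (THE f. f \<in> hom (braid_group n) G \<inter> extensional (carrier (braid_group n)) \<and>
            (\<forall>i\<in>{1..<n}. f (braid_gen n i) = s i))"

definition writhe :: "nat \<Rightarrow> braid \<Rightarrow> int" where
  "writhe n = braid_hom n integer_group (\<lambda>i. 1)"

definition braid_incl :: "nat \<Rightarrow> nat \<Rightarrow> braid \<Rightarrow> braid" where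
  "braid_incl m n = braid_hom m (braid_group n) (braid_gen n)"


section \<open>Closures\<close>

text \<open>As products in \<^const>\<open>sym_group\<close> are compositions, \<open>braid_perm n \<beta>\<close> maps the right end
  position of a strand of \<open>\<beta>\<close> to its left end position.\<close>

definition braid_perm :: "nat \<Rightarrow> braid \<Rightarrow> nat \<Rightarrow> nat" where
  "braid_perm n = braid_hom n (sym_group n) (\<lambda>i. Transposition.transpose i (Suc i))"

text \<open>The closure glues right end \<open>i\<close> to left end \<open>i\<close>; a component of it is identified with the set
  of positions of the strands of \<open>\<beta>\<close> it runs through. A knot is a link with one component.\<close>

definition closure_components :: "nat \<Rightarrow> braid \<Rightarrow> nat set set" where
  "closure_components n \<beta> = orbit (braid_perm n \<beta>) ` {1..n}"

definition closure_is_knot :: "nat \<Rightarrow> braid \<Rightarrow> bool" where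
  "closure_is_knot n \<beta> \<longleftrightarrow> card (closure_components n \<beta>) = 1"


section \<open>Braid satellites\<close>

definition braid_prod :: "nat \<Rightarrow> braid list \<Rightarrow> braid" where
  "braid_prod n xs = foldr (\<otimes>\<^bsub>braid_group n\<^esub>) xs \<one>\<^bsub>braid_group n\<^esub>"

definition cable_tau :: "nat \<Rightarrow> nat \<Rightarrow> nat \<Rightarrow> braid" where
  "cable_tau N p s = braid_prod N (map (braid_gen N) [s..<s + p])"

text \<open>The homomorphism \<open>\<iota>\<^sub>p : B\<^sub>k \<rightarrow> B\<^sub>k\<^sub>p\<close> with
  \<open>\<sigma>\<^sub>i \<mapsto> \<tau>\<^bsub>m+p-1\<^esub> \<dots> \<tau>\<^bsub>m+1\<^esub> \<tau>\<^sub>m\<close>, where \<open>m = (i - 1) p + 1\<close>.\<close>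

definition braid_cable :: "nat \<Rightarrow> nat \<Rightarrow> braid \<Rightarrow> braid" where
  "braid_cable k p = braid_hom k (braid_group (k * p))
    (\<lambda>i. let m = (i - 1) * p + 1
         in braid_prod (k * p) (map (cable_tau (k * p) p) (rev [m..<m + p])))"

definition braid_satellite :: "nat \<Rightarrow> nat \<Rightarrow> braid \<Rightarrow> braid \<Rightarrow> braid" where
  "braid_satellite k p \<alpha> \<gamma> =
    braid_cable k p \<alpha> \<otimes>\<^bsub>braid_group (k * p)\<^esub> braid_incl p (k * p) \<gamma>"


section \<open>Free noncommutative algebras\<close>

datatype 'g fmon = Fmon (letters: "'g list")

instantiation fmon :: (type) monoid_add
begin

definition zero_fmon :: "'a fmon" where
  "zero_fmon = Fmon []"

definition plus_fmon :: "'a fmon \<Rightarrow> 'a fmon \<Rightarrow> 'a fmon" where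
  "plus_fmon v w = Fmon (letters v @ letters w)"

instance
  by standard (simp_all add: zero_fmon_def plus_fmon_def)

end

text \<open>Noncommutative polynomials over \<open>'r\<close> in letters \<open>(i, j)\<close>: the monoid ring of the free monoid.
  The scalars commute with the letters.\<close>

type_synonym 'r falg = "(nat \<times> nat) fmon \<Rightarrow>\<^sub>0 'r"

definition agen :: "nat \<Rightarrow> nat \<Rightarrow> 'r::ring_1 falg" where
  "agen i j = Poly_Mapping.single (Fmon [(i, j)]) 1"

text \<open>The free algebra over \<open>'r\<close> on \<open>a\<^sub>i\<^sub>j\<close>, \<open>1 \<le> i \<noteq> j \<le> n\<close>. It is \<open>\<A>\<^sub>n\<close> for \<open>'r = int\<close>, and
  \<open>\<A>\<^sub>n \<otimes> R\<^sub>0\<close> when \<open>'r\<close> is the Laurent polynomial ring \<open>R\<^sub>0\<close> below.\<close>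

definition free_alg :: "nat \<Rightarrow> 'r::ring_1 falg ring" where
  "free_alg n =
    \<lparr>carrier = {x. \<forall>w\<in>Poly_Mapping.keys x. \<forall>(i, j)\<in>set (letters w).
                  i \<in> {1..n} \<and> j \<in> {1..n} \<and> i \<noteq> j},
     monoid.mult = (*), one = 1, zero = 0, add = (+)\<rparr>"

text \<open>The ring homomorphism sending the letter \<open>(i, j)\<close> to \<open>g (i, j)\<close>.\<close>

definition falg_eval :: "(nat \<times> nat \<Rightarrow> 'b::ring_1) \<Rightarrow> int falg \<Rightarrow> 'b" where
  "falg_eval g x =
    (\<Sum>w\<in>Poly_Mapping.keys x. of_int (Poly_Mapping.lookup x w) * prod_list (map g (letters w)))"

definition ring_auto :: "('a, 'b) ring_scheme \<Rightarrow> ('a \<Rightarrow> 'a) set" where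
  "ring_auto R = Ring.ring_hom R R \<inter> Bij (carrier R)"

definition RingAutGroup :: "('a, 'b) ring_scheme \<Rightarrow> ('a \<Rightarrow> 'a) monoid" where
  "RingAutGroup R = BijGroup (carrier R) \<lparr>carrier := ring_auto R\<rparr>"


section \<open>The action of the braid group\<close>

fun phi_letter :: "nat \<Rightarrow> nat \<times> nat \<Rightarrow> int falg" where
  "phi_letter k (i, j) =
    (if i = k \<and> j = k + 1 then - agen (k + 1) k
     else if i = k + 1 \<and> j = k then - agen k (k + 1)
     else if i = k + 1 then agen k j
     else if j = k + 1 then agen i k
     else if i = k then agen (k + 1) j - agen (k + 1) k * agen k j
     else if j = k then agen i (k + 1) - agen i k * agen k (k + 1)
     else agen i j)"

definition phi :: "nat \<Rightarrow> braid \<Rightarrow> int falg \<Rightarrow> int falg" where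
  "phi n = braid_hom n (RingAutGroup (free_alg n))
    (\<lambda>k. restrict (falg_eval (phi_letter k)) (carrier (free_alg n)))"

definition phi_star :: "nat \<Rightarrow> braid \<Rightarrow> int falg \<Rightarrow> int falg" where
  "phi_star n \<beta> = phi (n + 1) (braid_incl n (n + 1) \<beta>)"

text \<open>Matrix indices start at \<open>0\<close>, so the entry in row \<open>i + 1\<close> and column \<open>j + 1\<close> is
  \<open>M $$ (i, j)\<close>.\<close>

definition PhiL :: "nat \<Rightarrow> braid \<Rightarrow> int falg mat" where
  "PhiL n \<beta> =
    (THE M. M \<in> carrier_mat n n \<and> elements_mat M \<subseteq> carrier (free_alg n) \<and>
      (\<forall>i<n. phi_star n \<beta> (agen (i + 1) (n + 1)) = (\<Sum>j<n. M $$ (i, j) * agen (j + 1) (n + 1))))"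

definition PhiR :: "nat \<Rightarrow> braid \<Rightarrow> int falg mat" where
  "PhiR n \<beta> =
    (THE M. M \<in> carrier_mat n n \<and> elements_mat M \<subseteq> carrier (free_alg n) \<and>
      (\<forall>i<n. phi_star n \<beta> (agen (n + 1) (i + 1)) = (\<Sum>j<n. agen (n + 1) (j + 1) * M $$ (j, i))))"


section \<open>Augmentation rank\<close>

text \<open>\<open>R\<^sub>0 = \<int>[\<lambda>\<^sup>\<plusminus>\<^sup>1, \<mu>\<^sup>\<plusminus>\<^sup>1]\<close> as the group ring of \<open>\<int>\<^sup>2\<close>: \<open>(d, e)\<close> is the exponent of \<open>\<lambda>\<^sup>d \<mu>\<^sup>e\<close>.\<close>

type_synonym laurent = "(int \<times> int) \<Rightarrow>\<^sub>0 int"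

definition lambda_mu :: "int \<Rightarrow> int \<Rightarrow> laurent falg" where
  "lambda_mu d e = Poly_Mapping.single 0 (Poly_Mapping.single (d, e) 1)"

abbreviation mu :: "laurent falg" where
  "mu \<equiv> lambda_mu 0 1"

text \<open>The canonical map \<open>\<A>\<^sub>n \<rightarrow> \<A>\<^sub>n \<otimes> R\<^sub>0\<close>.\<close>

definition base_change :: "int falg \<Rightarrow> laurent falg" where
  "base_change = Poly_Mapping.map of_int"

definition A_mat :: "nat \<Rightarrow> laurent falg mat" where
  "A_mat n = mat n n (\<lambda>(i, j).
    if i < j then agen (i + 1) (j + 1)
    else if i > j then - mu * agen (i + 1) (j + 1)
    else 1 - mu)"

definition Lambda_mat :: "nat \<Rightarrow> braid \<Rightarrow> laurent falg mat" where
  "Lambda_mat n \<beta> = mat_diag n (\<lambda>i. if i = 0 then lambda_mu 1 (writhe n \<beta>) else 1)"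

definition Lambda_inv_mat :: "nat \<Rightarrow> braid \<Rightarrow> laurent falg mat" where
  "Lambda_inv_mat n \<beta> = mat_diag n (\<lambda>i. if i = 0 then lambda_mu (- 1) (- writhe n \<beta>) else 1)"

definition aug_ideal :: "nat \<Rightarrow> braid \<Rightarrow> laurent falg set" where
  "aug_ideal n \<beta> = Idl\<^bsub>free_alg n\<^esub>
    (elements_mat (A_mat n - Lambda_mat n \<beta> * map_mat base_change (PhiL n \<beta>) * A_mat n) \<union>
     elements_mat (A_mat n - A_mat n * map_mat base_change (PhiR n \<beta>) * Lambda_inv_mat n \<beta>))"

definition augmentations :: "nat \<Rightarrow> braid \<Rightarrow> (laurent falg \<Rightarrow> complex) set" where
  "augmentations n \<beta> = {\<epsilon> \<in> Ring.ring_hom (free_alg n) class_ring. \<forall>x\<in>aug_ideal n \<beta>. \<epsilon> x = 0}"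

text \<open>The augmentation rank of the knot that is the closure of \<open>\<beta> \<in> B\<^sub>n\<close>. The set of ranks is
  finite, being bounded by \<open>n\<close>, so the supremum is the maximum. Values of \<open>\<epsilon>\<close> outside the carrier
  do not affect the rank.\<close>

definition aug_rank :: "nat \<Rightarrow> braid \<Rightarrow> nat" where
  "aug_rank n \<beta> =
    Sup {vec_space.rank n (map_mat \<epsilon> (A_mat n)) |\<epsilon>. \<epsilon> \<in> augmentations n \<beta> \<and> \<epsilon> mu \<noteq> 1}"

end

theory Submission
  imports Defs
begin

text \<open>For a knot that is the closure of \<open>\<beta> \<in> B\<^sub>n\<close>, the augmentations of rank \<open>n\<close> correspond to the ring
  homomorphisms \<open>\<epsilon> : \<A>\<^sub>n \<rightarrow> \<complex>\<close> with \<open>\<epsilon>(\<Phi>\<^sup>L) = diag(c, 1, \<dots>, 1)\<close> and \<open>\<epsilon>(\<Phi>\<^sup>R) = diag(1/c, 1, \<dots>, 1)\<close> for some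
  \<open>c \<noteq> 0\<close>: an invertible matrix \<open>\<^bold>A\<close> can be cancelled from the relations, and conversely
  \<open>det \<epsilon>(\<^bold>A)\<close> is a polynomial in \<open>\<mu>\<close> with value \<open>1\<close> at \<open>\<mu> = 0\<close>, so that it is nonzero for a generic \<open>\<mu>\<close>.

  Write such an \<open>\<epsilon>\<close> for \<open>\<gamma>\<close> as a pair \<open>(U, L)\<close> of an upper and a lower unitriangular matrix. A
  homomorphism \<open>\<A>\<^sub>k\<^sub>p \<rightarrow> \<complex>\<close> is obtained from \<open>\<epsilon>\<close> for \<open>\<alpha>\<close> and \<open>(U, L)\<close> by placing \<open>(U, L)\<close> in the diagonal
  \<open>p \<times> p\<close> blocks, \<open>a\<^sub>i\<^sub>j U\<close> in the blocks above and \<open>a\<^sub>i\<^sub>j L\<close> in the blocks below the diagonal. On these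
  homomorphisms the cable of \<open>\<sigma>\<^sub>i\<close> acts blockwise as \<open>\<sigma>\<^sub>i\<close> does on \<open>\<A>\<^sub>k\<close>. Hence \<open>\<Phi>\<^sup>L\<close> of the satellite is
  evaluated to the identity except in the first block, where it is \<open>c\<close> times the value of \<open>\<Phi>\<^sup>L\<close> for
  \<open>\<gamma>\<close>. As the permutation of \<open>\<gamma>\<close> is a \<open>p\<close>-cycle, a diagonal change of basis brings the latter into the
  form \<open>diag(s, 1/c, \<dots>, 1/c)\<close>.\<close>

section \<open>Braid groups and their homomorphisms\<close>

text \<open>For a product of braids the matrices obey a twisted chain rule: the factor of the second
  braid is evaluated at the point moved by the first. Hence both matrices are computed only at
  points, letter by letter, and the point is carried along. The satellite needs a point whose
  diagonal blocks survive the cable of \<alpha>, so that \<gamma> still meets its own augmentation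
  in the first block. With diagonal entries normalised to 2, the diagonal block is U + L, its two
  unit diagonals adding up to 2. This forces U above and L below the diagonal: for a scalar x the
  crossing turns the block x L into x L - x (U + L) = - x U, which is the sign rule for
  \<open>a_{k,k+1}\<close> with the triangle exchanged. The constant c is the inverse of
  \<lambda>\<mu>^w. As \<lambda> is a free parameter, every nonzero c occurs, whatever the writhe of
  the satellite is; so the value c s in the corner may be anything nonzero. The factor 1/c demanded
  of the pattern undoes the c by which the cable multiplies the first p rows.\<close>

lemma braid_words_simps [simp]:
  "[] \<in> braid_words n"
  "l # u \<in> braid_words n \<longleftrightarrow> fst l \<in> {1..<n} \<and> u \<in> braid_words n"
  "u @ v \<in> braid_words n \<longleftrightarrow> u \<in> braid_words n \<and> v \<in> braid_words n"
  by (auto simp: braid_words_def mem_Times_iff)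

lemma braid_words_mono: "m \<le> n \<Longrightarrow> braid_words m \<subseteq> braid_words n"
  by (auto simp: braid_words_def intro!: lists_mono)

lemma braid_eq_words: "braid_eq n u v \<Longrightarrow> u \<in> braid_words n \<and> v \<in> braid_words n"
  by (induction rule: braid_eq.induct) auto

lemma braid_eq_context:
  assumes "braid_eq n u v" "x \<in> braid_words n" "y \<in> braid_words n"
  shows "braid_eq n (x @ u @ y) (x @ v @ y)"
  using assms
proof (induction rule: braid_eq.induct)
  case (refl u) then show ?case by (intro braid_eq.refl) auto
next
  case (sym u v) then show ?case by (blast intro: braid_eq.sym)
next
  case (trans u v w) then show ?case by (blast intro: braid_eq.trans)
next
  case (cancel u v i b) then show ?case
    using braid_eq.cancel[of "x @ u" n "v @ y" i b] by simp
next
  case (far u v i j) then show ?case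
    using braid_eq.far[of "x @ u" n "v @ y" i j] by simp
next
  case (braid u v i) then show ?case
    using braid_eq.braid[of "x @ u" n "v @ y" i] by simp
qed

lemma braid_eq_append:
  assumes "braid_eq n u u'" "braid_eq n v v'"
  shows "braid_eq n (u @ v) (u' @ v')"
proof (rule braid_eq.trans)
  show "braid_eq n (u @ v) (u' @ v)"
    using braid_eq_context[OF assms(1), of "[]" v] braid_eq_words[OF assms(2)] by simp
  show "braid_eq n (u' @ v) (u' @ v')"
    using braid_eq_context[OF assms(2), of u' "[]"] braid_eq_words[OF assms(1)] by simp
qed

lemma braid_class_eq_iff:
  assumes "u \<in> braid_words n"
  shows "braid_class n u = braid_class n v \<longleftrightarrow> braid_eq n u v"
proof
  assume "braid_class n u = braid_class n v"
  moreover have "u \<in> braid_class n u"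
    using assms by (simp add: braid_class_def braid_eq.refl)
  ultimately have "braid_eq n v u" by (simp add: braid_class_def)
  then show "braid_eq n u v" by (rule braid_eq.sym)
next
  assume "braid_eq n u v"
  then have "braid_eq n u w \<longleftrightarrow> braid_eq n v w" for w
    by (meson braid_eq.sym braid_eq.trans)
  then show "braid_class n u = braid_class n v" by (simp add: braid_class_def)
qed

lemma braid_group_simps:
  "carrier (braid_group n) = braid_class n ` braid_words n"
  "\<one>\<^bsub>braid_group n\<^esub> = braid_class n []"
  by (simp_all add: braid_group_def)

text \<open>Congruent factors have congruent concatenations, so the union that defines the product
  runs over copies of one class.\<close>

lemma braid_class_mult:
  assumes "u \<in> braid_words n" "v \<in> braid_words n"
  shows "braid_class n u \<otimes>\<^bsub>braid_group n\<^esub> braid_class n v = braid_class n (u @ v)"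
proof -
  have "braid_class n (u' @ v') = braid_class n (u @ v)"
    if "u' \<in> braid_class n u" "v' \<in> braid_class n v" for u' v'
  proof -
    have "braid_eq n (u @ v) (u' @ v')"
      using that by (simp add: braid_class_def braid_eq_append)
    then show ?thesis using assms by (subst eq_commute) (simp add: braid_class_eq_iff)
  qed
  then have "(\<Union>u'\<in>braid_class n u. \<Union>v'\<in>braid_class n v. braid_class n (u' @ v')) =
      (\<Union>u'\<in>braid_class n u. \<Union>v'\<in>braid_class n v. braid_class n (u @ v))"
    by (intro SUP_cong HOL.refl)
  moreover have "u \<in> braid_class n u" "v \<in> braid_class n v"
    using assms by (simp_all add: braid_class_def braid_eq.refl)
  then have "braid_class n u \<noteq> {}" "braid_class n v \<noteq> {}" by blast+
  ultimately show ?thesis by (simp add: braid_group_def)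
qed

definition inv_word :: "braid_word \<Rightarrow> braid_word" where
  "inv_word u = rev (map (\<lambda>(i, b). (i, \<not> b)) u)"

lemma inv_word_Nil [simp]: "inv_word [] = []"
  by (simp add: inv_word_def)

lemma inv_word_Cons: "inv_word ((i, b) # u) = inv_word u @ [(i, \<not> b)]"
  by (simp add: inv_word_def)

lemma inv_word_words [simp]: "inv_word u \<in> braid_words n \<longleftrightarrow> u \<in> braid_words n"
  by (induction u) (auto simp: inv_word_Cons)

lemma braid_eq_inv_word: "u \<in> braid_words n \<Longrightarrow> braid_eq n (inv_word u @ u) []"
proof (induction u)
  case Nil then show ?case by (simp add: braid_eq.refl)
next
  case (Cons l u)
  obtain i b where l: "l = (i, b)" by (cases l)
  have "braid_eq n (inv_word u @ [(i, \<not> b), (i, \<not> \<not> b)] @ u) (inv_word u @ u)"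
    using Cons.prems l by (intro braid_eq.cancel) auto
  moreover have "braid_eq n (inv_word u @ u) []" using Cons by simp
  ultimately have "braid_eq n (inv_word u @ [(i, \<not> b), (i, \<not> \<not> b)] @ u) []"
    by (rule braid_eq.trans)
  then show ?case by (simp add: l inv_word_Cons)
qed

lemma group_braid_group: "group (braid_group n)"
proof (rule groupI)
  fix x y z assume "x \<in> carrier (braid_group n)" "y \<in> carrier (braid_group n)"
    "z \<in> carrier (braid_group n)"
  then show "x \<otimes>\<^bsub>braid_group n\<^esub> y \<otimes>\<^bsub>braid_group n\<^esub> z = x \<otimes>\<^bsub>braid_group n\<^esub> (y \<otimes>\<^bsub>braid_group n\<^esub> z)"
    by (auto simp: braid_group_simps braid_class_mult)
next
  fix x assume "x \<in> carrier (braid_group n)"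
  then obtain u where u: "u \<in> braid_words n" "x = braid_class n u" by (auto simp: braid_group_simps)
  have "braid_class n (inv_word u) \<otimes>\<^bsub>braid_group n\<^esub> x = \<one>\<^bsub>braid_group n\<^esub>"
    using u braid_eq_inv_word[of u n]
    by (simp add: braid_class_mult braid_group_simps braid_class_eq_iff)
  then show "\<exists>y\<in>carrier (braid_group n). y \<otimes>\<^bsub>braid_group n\<^esub> x = \<one>\<^bsub>braid_group n\<^esub>"
    using u by (auto simp: braid_group_simps)
qed (auto simp: braid_group_simps braid_class_mult)

lemma braid_class_inv:
  assumes "u \<in> braid_words n"
  shows "inv\<^bsub>braid_group n\<^esub> (braid_class n u) = braid_class n (inv_word u)"
proof (rule group.inv_equality[OF group_braid_group])
  show "braid_class n (inv_word u) \<otimes>\<^bsub>braid_group n\<^esub> braid_class n u = \<one>\<^bsub>braid_group n\<^esub>"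
    using assms braid_eq_inv_word[OF assms]
    by (simp add: braid_class_mult braid_group_simps braid_class_eq_iff)
qed (use assms in \<open>auto simp: braid_group_simps\<close>)

section \<open>Homomorphisms out of the braid group\<close>

definition word_val :: "('b, 'c) monoid_scheme \<Rightarrow> (nat \<Rightarrow> 'b) \<Rightarrow> braid_word \<Rightarrow> 'b" where
  "word_val G s u =
    foldr (\<lambda>(i, b) x. (if b then s i else inv\<^bsub>G\<^esub> (s i)) \<otimes>\<^bsub>G\<^esub> x) u \<one>\<^bsub>G\<^esub>"

lemma word_val_simps [simp]:
  "word_val G s [] = \<one>\<^bsub>G\<^esub>"
  "word_val G s ((i, b) # u) = (if b then s i else inv\<^bsub>G\<^esub> (s i)) \<otimes>\<^bsub>G\<^esub> word_val G s u"
  by (simp_all add: word_val_def)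

text \<open>\<open>G\<close> will be a larger braid group (inclusions and cables), the group of ring
  automorphisms (\<open>phi\<close>) and the symmetric group (\<open>braid_perm\<close>). The braid
  relation is nested to the right because \<open>word_val\<close> folds from the right.\<close>

locale braid_rep = group G for G (structure) +
  fixes n :: nat and s :: "nat \<Rightarrow> 'a"
  assumes gen_closed: "i \<in> {1..<n} \<Longrightarrow> s i \<in> carrier G"
    and gen_far: "i \<in> {1..<n} \<Longrightarrow> j \<in> {1..<n} \<Longrightarrow> i + 2 \<le> j \<Longrightarrow> s i \<otimes> s j = s j \<otimes> s i"
    and gen_braid: "i \<in> {1..<n} \<Longrightarrow> Suc i \<in> {1..<n} \<Longrightarrow>
      s i \<otimes> (s (Suc i) \<otimes> s i) = s (Suc i) \<otimes> (s i \<otimes> s (Suc i))"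
begin

lemma word_val_closed [simp]: "u \<in> braid_words n \<Longrightarrow> word_val G s u \<in> carrier G"
  by (induction u) (auto simp: gen_closed)

lemma word_val_append:
  "u \<in> braid_words n \<Longrightarrow> v \<in> braid_words n \<Longrightarrow>
    word_val G s (u @ v) = word_val G s u \<otimes> word_val G s v"
  by (induction u) (auto simp: gen_closed m_assoc)

lemma word_val_respects: "braid_eq n u v \<Longrightarrow> word_val G s u = word_val G s v"
proof (induction rule: braid_eq.induct)
  case (cancel u v i b)
  then have "s i \<in> carrier G" by (simp add: gen_closed)
  with cancel show ?case by (cases b) (simp_all add: word_val_append m_assoc[symmetric])
next
  case (far u v i j)
  then have "s i \<in> carrier G" "s j \<in> carrier G" by (simp_all add: gen_closed)
  moreover have "s i \<otimes> s j = s j \<otimes> s i" using far by (intro gen_far) auto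
  ultimately have "s i \<otimes> (s j \<otimes> word_val G s v) = s j \<otimes> (s i \<otimes> word_val G s v)"
    using far by (simp add: m_assoc[symmetric])
  then show ?case using far by (simp add: word_val_append)
next
  case (braid u v i)
  then have c: "s i \<in> carrier G" "s (Suc i) \<in> carrier G" by (simp_all add: gen_closed)
  have "s i \<otimes> (s (Suc i) \<otimes> (s i \<otimes> word_val G s v)) = (s i \<otimes> (s (Suc i) \<otimes> s i)) \<otimes> word_val G s v"
    using braid c by (simp add: m_assoc)
  also have "\<dots> = s (Suc i) \<otimes> (s i \<otimes> (s (Suc i) \<otimes> word_val G s v))"
    using braid c by (subst gen_braid) (simp_all add: m_assoc)
  finally show ?case using braid by (simp add: word_val_append)
qed auto

lemma braid_hom_class:
  assumes "u \<in> braid_words n"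
  shows "braid_hom n G s (braid_class n u) = word_val G s u"
proof -
  \<comment> \<open>The choice of representative is harmless because \<open>word_val\<close>
    respects the braid relations. Uniqueness follows since a homomorphism is determined on words by
    the generators.\<close>
  define f where "f = (\<lambda>X\<in>carrier (braid_group n). word_val G s (SOME u. u \<in> X))"
  have f_class: "f (braid_class n v) = word_val G s v" if "v \<in> braid_words n" for v
  proof -
    have "v \<in> braid_class n v" using that by (simp add: braid_class_def braid_eq.refl)
    then have "(SOME u. u \<in> braid_class n v) \<in> braid_class n v" by (rule someI)
    then show ?thesis
      using that word_val_respects by (auto simp: f_def braid_group_simps braid_class_def)
  qed
  have "braid_hom n G s = f"
    unfolding braid_hom_def
  proof (rule the_equality)
    have "f \<in> hom (braid_group n) G"
      by (auto simp: hom_def f_class braid_group_simps braid_class_mult word_val_append)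
    moreover have "f (braid_gen n i) = s i" if "i \<in> {1..<n}" for i
      using that by (simp add: braid_gen_def f_class gen_closed)
    ultimately show "f \<in> hom (braid_group n) G \<inter> extensional (carrier (braid_group n)) \<and>
        (\<forall>i\<in>{1..<n}. f (braid_gen n i) = s i)"
      by (auto simp: f_def)
  next
    fix g assume g: "g \<in> hom (braid_group n) G \<inter> extensional (carrier (braid_group n)) \<and>
        (\<forall>i\<in>{1..<n}. g (braid_gen n i) = s i)"
    interpret gh: group_hom "braid_group n" G g
      using g by (intro group_hom.intro group_braid_group) (auto simp: group_hom_axioms_def is_group)
    have "g (braid_class n v) = word_val G s v" if "v \<in> braid_words n" for v
      using that
    proof (induction v)
      case Nil then show ?case using gh.hom_one by (simp add: braid_group_simps)
    next
      case (Cons l v)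
      obtain i b where l: "l = (i, b)" by (cases l)
      have i: "i \<in> {1..<n}" using Cons.prems l by simp
      have gi: "braid_gen n i \<in> carrier (braid_group n)"
        using i by (auto simp: braid_gen_def braid_group_simps)
      have "g (braid_class n [(i, b)]) = (if b then s i else inv (s i))"
      proof (cases b)
        case True then show ?thesis using g i by (simp add: braid_gen_def)
      next
        case False
        then have "braid_class n [(i, b)] = inv\<^bsub>braid_group n\<^esub> (braid_gen n i)"
          using i by (simp add: braid_gen_def braid_class_inv inv_word_Cons)
        then show ?thesis using False g i gi by simp
      qed
      moreover have "braid_class n (l # v) = braid_class n [(i, b)] \<otimes>\<^bsub>braid_group n\<^esub> braid_class n v"
        using Cons.prems l by (simp add: braid_class_mult)
      moreover have "braid_class n [(i, b)] \<in> carrier (braid_group n)"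
        "braid_class n v \<in> carrier (braid_group n)"
        using Cons.prems l by (auto simp: braid_group_simps)
      ultimately show ?case using Cons l by simp
    qed
    then have eq: "g x = f x" if "x \<in> carrier (braid_group n)" for x
      using that by (auto simp: braid_group_simps f_class)
    have "f \<in> extensional (carrier (braid_group n))" by (simp add: f_def)
    then show "g = f" using g eq by (blast intro: extensionalityI)
  qed
  then show ?thesis using f_class[OF assms] by simp
qed

end

lemma braid_gen_far:
  assumes "i \<in> {1..<n}" "j \<in> {1..<n}" "i + 2 \<le> j"
  shows "braid_gen n i \<otimes>\<^bsub>braid_group n\<^esub> braid_gen n j = braid_gen n j \<otimes>\<^bsub>braid_group n\<^esub> braid_gen n i"
  using assms braid_eq.far[of "[]" n "[]" i j]
  by (simp add: braid_gen_def braid_class_mult braid_class_eq_iff)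

lemma braid_rep_incl:
  assumes "m \<le> n"
  shows "braid_rep (braid_group n) m (braid_gen n)"
proof -
  interpret group "braid_group n" by (rule group_braid_group)
  show ?thesis
  proof
    fix i assume "i \<in> {1..<m}" then show "braid_gen n i \<in> carrier (braid_group n)"
      using assms by (auto simp: braid_gen_def braid_group_simps)
  next
    fix i j assume "i \<in> {1..<m}" "j \<in> {1..<m}" "i + 2 \<le> j"
    then show "braid_gen n i \<otimes>\<^bsub>braid_group n\<^esub> braid_gen n j =
        braid_gen n j \<otimes>\<^bsub>braid_group n\<^esub> braid_gen n i"
      using assms by (intro braid_gen_far) auto
  next
    fix i assume "i \<in> {1..<m}" "Suc i \<in> {1..<m}"
    then show "braid_gen n i \<otimes>\<^bsub>braid_group n\<^esub> (braid_gen n (Suc i) \<otimes>\<^bsub>braid_group n\<^esub> braid_gen n i) =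
      braid_gen n (Suc i) \<otimes>\<^bsub>braid_group n\<^esub> (braid_gen n i \<otimes>\<^bsub>braid_group n\<^esub> braid_gen n (Suc i))"
      using assms braid_eq.braid[of "[]" n "[]" i]
      by (simp add: braid_gen_def braid_class_mult braid_class_eq_iff)
  qed
qed

lemma word_val_braid_gen:
  assumes "u \<in> braid_words n"
  shows "word_val (braid_group n) (braid_gen n) u = braid_class n u"
  using assms
proof (induction u)
  case Nil then show ?case by (simp add: braid_group_simps)
next
  case (Cons l u)
  then show ?case
    by (cases l) (auto simp: braid_gen_def braid_class_inv inv_word_Cons braid_class_mult)
qed

lemma braid_incl_class:
  assumes "m \<le> n" "u \<in> braid_words m"
  shows "braid_incl m n (braid_class m u) = braid_class n u"
  using braid_rep.braid_hom_class[OF braid_rep_incl[OF assms(1)] assms(2)]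
    word_val_braid_gen[of u n] braid_words_mono[OF assms(1)] assms(2)
  by (auto simp: braid_incl_def)

section \<open>Cabling\<close>

definition pos_word :: "nat list \<Rightarrow> braid_word" where
  "pos_word xs = map (\<lambda>i. (i, True)) xs"

lemma pos_word_simps [simp]:
  "pos_word [] = []"
  "pos_word (x # xs) = (x, True) # pos_word xs"
  "pos_word (xs @ ys) = pos_word xs @ pos_word ys"
  by (simp_all add: pos_word_def)

lemma pos_word_words [simp]: "pos_word xs \<in> braid_words n \<longleftrightarrow> set xs \<subseteq> {1..<n}"
  by (induction xs) auto

definition pos_eq :: "nat \<Rightarrow> nat list \<Rightarrow> nat list \<Rightarrow> bool" where
  "pos_eq n xs ys = braid_eq n (pos_word xs) (pos_word ys)"

lemma pos_eq_refl: "set xs \<subseteq> {1..<n} \<Longrightarrow> pos_eq n xs xs"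
  by (simp add: pos_eq_def braid_eq.refl)

lemma pos_eq_sym: "pos_eq n xs ys \<Longrightarrow> pos_eq n ys xs"
  unfolding pos_eq_def by (rule braid_eq.sym)

lemma pos_eq_trans [trans]: "pos_eq n xs ys \<Longrightarrow> pos_eq n ys zs \<Longrightarrow> pos_eq n xs zs"
  unfolding pos_eq_def by (rule braid_eq.trans)

lemma pos_eq_append:
  "pos_eq n xs xs' \<Longrightarrow> pos_eq n ys ys' \<Longrightarrow> pos_eq n (xs @ ys) (xs' @ ys')"
  by (simp add: pos_eq_def braid_eq_append)

lemma pos_eq_context:
  "pos_eq n ys ys' \<Longrightarrow> set xs \<subseteq> {1..<n} \<Longrightarrow> set zs \<subseteq> {1..<n} \<Longrightarrow>
    pos_eq n (xs @ ys @ zs) (xs @ ys' @ zs)"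
  by (simp add: pos_eq_append pos_eq_refl)

lemma pos_eq_swap:
  assumes "i \<in> {1..<n}" "j \<in> {1..<n}" "i + 2 \<le> j \<or> j + 2 \<le> i"
  shows "pos_eq n [i, j] [j, i]"
  using assms(3)
proof
  assume "i + 2 \<le> j" then show ?thesis
    using assms braid_eq.far[of "[]" n "[]" i j] by (simp add: pos_eq_def)
next
  assume "j + 2 \<le> i" then show ?thesis
    using assms braid_eq.far[of "[]" n "[]" j i] by (simp add: pos_eq_def braid_eq.sym)
qed

lemma pos_eq_braid:
  assumes "i \<in> {1..<n}" "Suc i \<in> {1..<n}"
  shows "pos_eq n [i, Suc i, i] [Suc i, i, Suc i]"
  using assms braid_eq.braid[of "[]" n "[]" i] by (simp add: pos_eq_def)

lemma pos_eq_commute1: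
  assumes "i \<in> {1..<n}" "set ys \<subseteq> {1..<n}" "\<And>y. y \<in> set ys \<Longrightarrow> i + 2 \<le> y \<or> y + 2 \<le> i"
  shows "pos_eq n ([i] @ ys) (ys @ [i])"
  using assms(2,3)
proof (induction ys)
  case Nil then show ?case using assms(1) by (simp add: pos_eq_refl)
next
  case (Cons y ys)
  have "pos_eq n ([] @ [i, y] @ ys) ([] @ [y, i] @ ys)"
    using Cons.prems assms(1) by (intro pos_eq_context pos_eq_swap) auto
  also have "pos_eq n ([] @ [y, i] @ ys) ([y] @ (ys @ [i]))"
    using pos_eq_context[of n "[i] @ ys" "ys @ [i]" "[y]" "[]"] Cons by simp
  finally show ?case by simp
qed

lemma pos_eq_commute:
  assumes "set xs \<subseteq> {1..<n}" "set ys \<subseteq> {1..<n}"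
    and "\<And>x y. x \<in> set xs \<Longrightarrow> y \<in> set ys \<Longrightarrow> x + 2 \<le> y \<or> y + 2 \<le> x"
  shows "pos_eq n (xs @ ys) (ys @ xs)"
  using assms(1,3)
proof (induction xs)
  case Nil then show ?case using assms(2) by (simp add: pos_eq_refl)
next
  case (Cons x xs)
  have "pos_eq n ([x] @ (xs @ ys) @ []) ([x] @ (ys @ xs) @ [])"
    using Cons assms(2) by (intro pos_eq_context) auto
  also have "pos_eq n ([x] @ (ys @ xs) @ []) (ys @ [x] @ xs)"
    using pos_eq_context[OF pos_eq_commute1[of x n ys], of "[]" xs] Cons.prems assms(2) by simp
  finally show ?case by simp
qed

text \<open>The word is one strand passing over \<open>b\<close> others. A crossing of two of the
  latter slides beneath it and, before the passage, sits one position further down. A single braid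
  relation at \<open>i\<close>, \<open>i + 1\<close> does this; all other letters commute.\<close>

lemma upt_shift:
  assumes "1 \<le> s" "s + b \<le> n" "s \<le> i" "i + 1 < s + b"
  shows "pos_eq n ([s..<s + b] @ [i]) ([i + 1] @ [s..<s + b])"
proof -
  define A where "A = [s..<i]"
  define B where "B = [i + 2..<s + b]"
  have split: "[s..<s + b] = A @ [i, i + 1] @ B"
  proof -
    have "[s..<s + b] = A @ [i..<s + b]"
      using upt_add_eq_append[of s i "s + b - i"] assms by (simp add: A_def)
    also have "[i..<s + b] = [i, i + 1] @ B"
      using assms by (simp add: B_def upt_conv_Cons)
    finally show ?thesis .
  qed
  have sets: "set A \<subseteq> {1..<n}" "set B \<subseteq> {1..<n}" using assms by (auto simp: A_def B_def)
  have "pos_eq n ((A @ [i, i + 1]) @ (B @ [i]) @ []) ((A @ [i, i + 1]) @ ([i] @ B) @ [])"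
    using assms sets by (intro pos_eq_context pos_eq_commute1[THEN pos_eq_sym]) (auto simp: B_def)
  also have "pos_eq n ((A @ [i, i + 1]) @ ([i] @ B) @ []) (A @ [i + 1, i, i + 1] @ B)"
    using pos_eq_context[OF pos_eq_braid[of i n], of A B] assms sets by simp
  also have "pos_eq n (A @ [i + 1, i, i + 1] @ B) ([i + 1] @ A @ [i, i + 1] @ B)"
    using pos_eq_context[OF pos_eq_sym[OF pos_eq_commute1[of "i + 1" n A]], of "[]" "[i, i + 1] @ B"]
      assms sets by (auto simp: A_def)
  finally show ?thesis by (simp add: split)
qed

text \<open>\<open>crossing_word a b m\<close> is the braid in which the \<open>a\<close> strands starting at position \<open>m\<close> pass
  over the next \<open>b\<close> strands.\<close>

definition crossing_word :: "nat \<Rightarrow> nat \<Rightarrow> nat \<Rightarrow> nat list" where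
  "crossing_word a b m = concat (map (\<lambda>s. [s..<s + b]) (rev [m..<m + a]))"

lemma crossing_word_0 [simp]: "crossing_word 0 b m = []" "crossing_word a 0 m = []"
  by (simp_all add: crossing_word_def)

lemma crossing_word_Suc: "crossing_word (Suc a) b m = [m + a..<m + a + b] @ crossing_word a b m"
  by (simp add: crossing_word_def)

lemma set_crossing_word: "set (crossing_word a b m) \<subseteq> {m..<m + a + b - 1}"
  by (auto simp: crossing_word_def)

lemma set_crossing_word':
  "1 \<le> m \<Longrightarrow> m + a + b \<le> n + 1 \<Longrightarrow> set (crossing_word a b m) \<subseteq> {1..<n}"
  using set_crossing_word[of a b m] by fastforce

lemma crossing_word_shift:
  assumes "1 \<le> m" "m + a + b \<le> n + 1" "m \<le> i" "i + 1 < m + b"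
  shows "pos_eq n (crossing_word a b m @ [i]) ([i + a] @ crossing_word a b m)"
  using assms(2)
proof (induction a)
  case 0 then show ?case using assms by (simp add: pos_eq_refl)
next
  case (Suc a)
  let ?T = "[m + a..<m + a + b]"
  have T: "set ?T \<subseteq> {1..<n}" using Suc.prems assms by auto
  have "pos_eq n (?T @ (crossing_word a b m @ [i]) @ []) (?T @ ([i + a] @ crossing_word a b m) @ [])"
    using Suc T by (intro pos_eq_context) auto
  also have "pos_eq n (?T @ ([i + a] @ crossing_word a b m) @ [])
      (([i + a + 1] @ ?T) @ crossing_word a b m)"
    using pos_eq_context[OF upt_shift[of "m + a" b n "i + a"], of "[]" "crossing_word a b m"]
      set_crossing_word'[of m a b n] Suc.prems assms by simp
  finally show ?case by (simp add: crossing_word_Suc)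
qed

lemma crossing_word_shift_word:
  assumes "1 \<le> m" "m + a + b \<le> n + 1" "set xs \<subseteq> {m..<m + b - 1}"
  shows "pos_eq n (crossing_word a b m @ xs) (map (\<lambda>i. i + a) xs @ crossing_word a b m)"
  using assms(3)
proof (induction xs)
  case Nil then show ?case using set_crossing_word'[of m a b n] assms by (simp add: pos_eq_refl)
next
  case (Cons x xs)
  let ?C = "crossing_word a b m"
  have sets: "set xs \<subseteq> {1..<n}" using Cons.prems assms by fastforce
  have "pos_eq n ([] @ (?C @ [x]) @ xs) ([] @ ([x + a] @ ?C) @ xs)"
    using Cons.prems assms sets by (intro pos_eq_context crossing_word_shift) auto
  also have "pos_eq n ([] @ ([x + a] @ ?C) @ xs) ([x + a] @ (map (\<lambda>i. i + a) xs @ ?C) @ [])"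
    using pos_eq_context[of n "?C @ xs" "map (\<lambda>i. i + a) xs @ ?C" "[x + a]" "[]"] Cons assms by auto
  finally show ?case by simp
qed

text \<open>The additional under strand lies last, so it may pass beneath the \<open>a\<close> over
  strands after all other crossings; the decreasing word is its way up.\<close>

lemma crossing_word_Suc_right:
  assumes "1 \<le> m" "m + a + Suc b \<le> n + 1"
  shows "pos_eq n (crossing_word a (Suc b) m) (crossing_word a b m @ rev [m + b..<m + b + a])"
  using assms(2)
proof (induction a)
  case 0 then show ?case by (simp add: pos_eq_refl)
next
  case (Suc a)
  let ?T = "[m + a..<m + a + b]" and ?R = "rev [m + b..<m + b + a]"
  have sets: "set ?T \<subseteq> {1..<n}" "set ?R \<subseteq> {1..<n}" "set (crossing_word a b m) \<subseteq> {1..<n}"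
    using Suc.prems assms set_crossing_word'[of m a b n] by auto
  have "pos_eq n ((?T @ [m + a + b]) @ crossing_word a (Suc b) m @ [])
      ((?T @ [m + a + b]) @ (crossing_word a b m @ ?R) @ [])"
    using Suc assms sets by (intro pos_eq_context) auto
  also have "pos_eq n ((?T @ [m + a + b]) @ (crossing_word a b m @ ?R) @ [])
      (?T @ (crossing_word a b m @ [m + a + b]) @ ?R)"
    using pos_eq_context[OF pos_eq_commute1[of "m + a + b" n "crossing_word a b m"], of ?T ?R]
      set_crossing_word[of a b m] Suc.prems assms sets by fastforce
  finally show ?case by (simp add: crossing_word_Suc add.commute add.left_commute)
qed

lemma crossing_word_merge:
  assumes "1 \<le> m" "m + a + b + c \<le> n + 1"
  shows "pos_eq n (crossing_word a b m @ crossing_word a c (m + b)) (crossing_word a (b + c) m)"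
  using assms(2)
proof (induction c)
  case 0 then show ?case using assms set_crossing_word'[of m a b n] by (simp add: pos_eq_refl)
next
  case (Suc c)
  let ?R = "rev [m + b + c..<m + b + c + a]"
  have sets: "set ?R \<subseteq> {1..<n}" "set (crossing_word a b m) \<subseteq> {1..<n}"
    using Suc.prems assms set_crossing_word'[of m a b n] by auto
  have "pos_eq n (crossing_word a b m @ crossing_word a (Suc c) (m + b) @ [])
      (crossing_word a b m @ (crossing_word a c (m + b) @ ?R) @ [])"
    using Suc.prems assms sets by (intro pos_eq_context crossing_word_Suc_right) auto
  also have "pos_eq n (crossing_word a b m @ (crossing_word a c (m + b) @ ?R) @ [])
      (crossing_word a (b + c) m @ ?R)"
    using pos_eq_context[of n "crossing_word a b m @ crossing_word a c (m + b)"
        "crossing_word a (b + c) m" "[]" ?R] Suc sets by simp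
  also have "pos_eq n (crossing_word a (b + c) m @ ?R) (crossing_word a (b + Suc c) m)"
    using crossing_word_Suc_right[of m a "b + c" n] Suc.prems assms
    by (subst pos_eq_sym) (simp_all add: add.assoc)
  finally show ?case by simp
qed

lemma map_add_crossing_word: "map (\<lambda>i. i + d) (crossing_word a b m) = crossing_word a b (m + d)"
proof (induction a)
  case (Suc a)
  have "map (\<lambda>i. i + d) [x..<x + b] = [x + d..<x + d + b]" for x
    by (induction b) auto
  from this[of "m + a"] show ?case using Suc by (simp add: crossing_word_Suc ac_simps)
qed simp

text \<open>A consequence of sliding alone. The first two block crossings merge into
  \<open>p\<close> strands passing over \<open>2 * p\<close> strands; the third involves only those
  under strands, so it slides through and is shifted by \<open>p\<close>.\<close>

lemma crossing_word_braid:
  assumes "1 \<le> m" "m + 3 * p \<le> n + 1"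
  shows "pos_eq n (crossing_word p p m @ crossing_word p p (m + p) @ crossing_word p p m)
    (crossing_word p p (m + p) @ crossing_word p p m @ crossing_word p p (m + p))"
proof -
  let ?C = "crossing_word p p m" and ?D = "crossing_word p p (m + p)" and ?W = "crossing_word p (p + p) m"
  have sets: "set ?C \<subseteq> {1..<n}" "set ?D \<subseteq> {1..<n}"
    using assms by (intro set_crossing_word'; simp)+
  have W: "pos_eq n (?C @ ?D) ?W" using assms by (intro crossing_word_merge) auto
  have "pos_eq n ((?C @ ?D) @ ?C) (?W @ ?C)"
    using W sets by (intro pos_eq_append pos_eq_refl)
  also have "pos_eq n (?W @ ?C) (?D @ ?W)"
    using crossing_word_shift_word[of m p "p + p" n ?C] set_crossing_word[of p p m] assms
    by (simp add: map_add_crossing_word add.assoc)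
  also have "pos_eq n (?D @ ?W) (?D @ ?C @ ?D)"
    using pos_eq_append[OF pos_eq_refl pos_eq_sym[OF W]] sets by simp
  finally show ?thesis by simp
qed

section \<open>The cabling homomorphism on words\<close>

definition cable_gen :: "nat \<Rightarrow> nat \<Rightarrow> nat list" where
  "cable_gen p i = crossing_word p p ((i - 1) * p + 1)"

lemma set_cable_gen:
  assumes "i \<in> {1..<k}"
  shows "set (cable_gen p i) \<subseteq> {1..<k * p}"
proof -
  obtain j where j: "i = Suc j" using assms by (cases i) auto
  have "Suc (Suc j) * p \<le> k * p" using assms j by (intro mult_le_mono1) auto
  then show ?thesis unfolding cable_gen_def j by (intro set_crossing_word') auto
qed

lemma braid_prod_classes:
  assumes "\<And>u. u \<in> set us \<Longrightarrow> u \<in> braid_words n"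
  shows "braid_prod n (map (braid_class n) us) = braid_class n (concat us)"
proof -
  have "concat us \<in> braid_words n" if "set us \<subseteq> braid_words n" for us
    using that by (induction us) auto
  then show ?thesis
    using assms unfolding braid_prod_def
    by (induction us) (auto simp: braid_group_simps(2) braid_class_mult subset_eq)
qed

lemma cable_tau_class:
  assumes "1 \<le> s" "s + p \<le> n"
  shows "cable_tau n p s = braid_class n (pos_word [s..<s + p])"
proof -
  have "cable_tau n p s = braid_prod n (map (braid_class n) (map (\<lambda>i. [(i, True)]) [s..<s + p]))"
    by (simp add: cable_tau_def braid_gen_def[abs_def] comp_def)
  also have "\<dots> = braid_class n (concat (map (\<lambda>i. [(i, True)]) [s..<s + p]))"
    using assms by (intro braid_prod_classes) auto
  finally show ?thesis by (simp add: pos_word_def)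
qed

lemma pos_word_concat: "pos_word (concat xss) = concat (map pos_word xss)"
  by (simp add: pos_word_def[abs_def] map_concat)

lemma cable_gen_class:
  assumes "i \<in> {1..<k}"
  shows "(let m = (i - 1) * p + 1 in braid_prod (k * p) (map (cable_tau (k * p) p) (rev [m..<m + p])))
    = braid_class (k * p) (pos_word (cable_gen p i))"
proof -
  define m where "m = (i - 1) * p + 1"
  obtain j where j: "i = Suc j" using assms by (cases i) auto
  have "Suc (Suc j) * p \<le> k * p" using assms j by (intro mult_le_mono1) auto
  then have m: "1 \<le> m" "m + 2 * p \<le> k * p + 1" by (auto simp: m_def j)
  have "map (cable_tau (k * p) p) (rev [m..<m + p]) =
      map (braid_class (k * p)) (map (\<lambda>s. pos_word [s..<s + p]) (rev [m..<m + p]))"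
    using m by (auto simp: cable_tau_class)
  also have "braid_prod (k * p) \<dots> = braid_class (k * p) (concat (map (\<lambda>s. pos_word [s..<s + p]) (rev [m..<m + p])))"
    using m by (intro braid_prod_classes) auto
  finally show ?thesis
    by (simp only: Let_def m_def[symmetric] cable_gen_def crossing_word_def pos_word_concat map_map comp_def)
qed

definition cable_letter :: "nat \<Rightarrow> nat \<times> bool \<Rightarrow> braid_word" where
  "cable_letter p = (\<lambda>(i, b). if b then pos_word (cable_gen p i) else inv_word (pos_word (cable_gen p i)))"

definition cable_word :: "nat \<Rightarrow> braid_word \<Rightarrow> braid_word" where
  "cable_word p u = concat (map (cable_letter p) u)"

lemma cable_word_simps [simp]:
  "cable_word p [] = []"
  "cable_word p (l # u) = cable_letter p l @ cable_word p u"
  by (simp_all add: cable_word_def)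

lemma cable_word_words: "u \<in> braid_words k \<Longrightarrow> cable_word p u \<in> braid_words (k * p)"
proof (induction u)
  case (Cons l u)
  obtain i b where l: "l = (i, b)" by (cases l)
  show ?case using Cons set_cable_gen[of i k p] by (auto simp: l cable_letter_def)
qed simp

lemma braid_cable_class:
  assumes "u \<in> braid_words k"
  shows "braid_cable k p (braid_class k u) = braid_class (k * p) (cable_word p u)"
proof -
  define s where "s = (\<lambda>i. let m = (i - 1) * p + 1
    in braid_prod (k * p) (map (cable_tau (k * p) p) (rev [m..<m + p])))"
  have s: "s i = braid_class (k * p) (pos_word (cable_gen p i))" if "i \<in> {1..<k}" for i
    using cable_gen_class[OF that] by (simp add: s_def)
  have sets: "set (cable_gen p i) \<subseteq> {1..<k * p}" if "i \<in> {1..<k}" for i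
    using set_cable_gen that .
  interpret group "braid_group (k * p)" by (rule group_braid_group)
  interpret braid_rep "braid_group (k * p)" k s
  proof
    fix i assume i: "i \<in> {1..<k}"
    then show "s i \<in> carrier (braid_group (k * p))"
      using sets[OF i] by (auto simp: s braid_group_simps)
  next
    fix i j assume ij: "i \<in> {1..<k}" "j \<in> {1..<k}" "i + 2 \<le> j"
    then obtain d where d: "j = i + 2 + d" by (auto simp: le_iff_add)
    obtain i' where i': "i = Suc i'" using ij by (cases i) auto
    have "pos_eq (k * p) (cable_gen p i @ cable_gen p j) (cable_gen p j @ cable_gen p i)"
    proof (rule pos_eq_commute)
      fix x y assume "x \<in> set (cable_gen p i)" "y \<in> set (cable_gen p j)"
      \<comment> \<open>The letters of the first cable end at \<open>(i' + 2) * p - 1\<close> and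
        those of the second start at \<open>(i' + 2) * p + 1\<close> or later, so the gap is at
        least 2 even for \<open>j = i + 2\<close>.\<close>
      then have "x < i' * p + 1 + p + p - 1" "(i' + 2 + d) * p + 1 \<le> y"
        using set_crossing_word[of p p "i' * p + 1"] set_crossing_word[of p p "(i' + 2 + d) * p + 1"]
        by (auto simp: cable_gen_def d i')
      then show "x + 2 \<le> y \<or> y + 2 \<le> x" by (auto simp: algebra_simps)
    qed (use sets ij in auto)
    then show "s i \<otimes>\<^bsub>braid_group (k * p)\<^esub> s j = s j \<otimes>\<^bsub>braid_group (k * p)\<^esub> s i"
      using sets[of i] sets[of j] ij
      by (simp add: s braid_class_mult braid_class_eq_iff pos_eq_def)
  next
    fix i assume i: "i \<in> {1..<k}" "Suc i \<in> {1..<k}"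
    obtain i' where i': "i = Suc i'" using i by (cases i) auto
    have "(i' + 3) * p \<le> k * p" using i i' by (intro mult_le_mono1) auto
    then have "pos_eq (k * p) (cable_gen p i @ cable_gen p (Suc i) @ cable_gen p i)
        (cable_gen p (Suc i) @ cable_gen p i @ cable_gen p (Suc i))"
      using crossing_word_braid[of "i' * p + 1" p "k * p"]
      by (simp add: cable_gen_def i' algebra_simps)
    then show "s i \<otimes>\<^bsub>braid_group (k * p)\<^esub> (s (Suc i) \<otimes>\<^bsub>braid_group (k * p)\<^esub> s i) =
        s (Suc i) \<otimes>\<^bsub>braid_group (k * p)\<^esub> (s i \<otimes>\<^bsub>braid_group (k * p)\<^esub> s (Suc i))"
      using sets[of i] sets[of "Suc i"] i
      by (simp add: s braid_class_mult braid_class_eq_iff pos_eq_def)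
  qed
  have "word_val (braid_group (k * p)) s u = braid_class (k * p) (cable_word p u)"
    using assms
  proof (induction u)
    case Nil then show ?case by (simp add: braid_group_simps)
  next
    case (Cons l u)
    obtain i b where l: "l = (i, b)" by (cases l)
    have i: "i \<in> {1..<k}" using Cons.prems l by simp
    show ?case
      using Cons sets[OF i] i l cable_word_words[of u k p]
      by (auto simp: s cable_letter_def braid_class_mult braid_class_inv)
  qed
  then show ?thesis
    using braid_hom_class[OF assms] by (simp only: braid_cable_def s_def[symmetric])
qed

section \<open>Evaluation of noncommutative polynomials\<close>

definition pm_eval :: "('r \<Rightarrow> 'b) \<Rightarrow> ('m \<Rightarrow> 'b) \<Rightarrow> ('m \<Rightarrow>\<^sub>0 'r::zero) \<Rightarrow> 'b::semiring_0" where
  "pm_eval h \<chi> x = (\<Sum>w\<in>Poly_Mapping.keys x. h (Poly_Mapping.lookup x w) * \<chi> w)"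

lemma poly_mapping_add_induct [case_names zero add]:
  assumes "P 0" and "\<And>w r x. P x \<Longrightarrow> P (Poly_Mapping.single w r + x)"
  shows "P (x :: 'm \<Rightarrow>\<^sub>0 'r::comm_monoid_add)"
proof (induction x rule: Poly_Mapping.update_induct)
  case const then show ?case using assms(1) by simp
next
  case (update f k v)
  have "Poly_Mapping.update k v f = Poly_Mapping.single k v + f"
    using update(1) by (intro poly_mapping_eqI)
      (auto simp: lookup_update lookup_add lookup_single when_def not_in_keys_iff_lookup_eq_zero)
  then show ?case using assms(2) update by simp
qed

text \<open>Evaluation on a monoid ring, with coefficients sent through \<open>h\<close> and
  monomials through \<open>\<chi>\<close>. It serves both Laurent polynomials and noncommutative
  polynomials; centrality of the coefficients is what makes it multiplicative.\<close>

locale pm_evaluation =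
  fixes h :: "'r::ring_1 \<Rightarrow> 'b::ring_1" and \<chi> :: "'m::monoid_add \<Rightarrow> 'b"
  assumes h_add: "h (r + s) = h r + h s" and h_mult: "h (r * s) = h r * h s" and h_one: "h 1 = 1"
    and chi_zero: "\<chi> 0 = 1" and chi_add: "\<chi> (v + w) = \<chi> v * \<chi> w"
    and central: "h r * \<chi> w = \<chi> w * h r"
begin

lemma h_zero: "h 0 = 0"
  using h_add[of 0 0] by simp

lemma eval_superset:
  "finite A \<Longrightarrow> Poly_Mapping.keys x \<subseteq> A \<Longrightarrow>
    pm_eval h \<chi> x = (\<Sum>w\<in>A. h (Poly_Mapping.lookup x w) * \<chi> w)"
  unfolding pm_eval_def
  by (rule sum.mono_neutral_left) (auto simp: in_keys_iff h_zero)

lemma eval_zero [simp]: "pm_eval h \<chi> 0 = 0"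
  by (simp add: pm_eval_def)

lemma eval_add: "pm_eval h \<chi> (x + y) = pm_eval h \<chi> x + pm_eval h \<chi> y"
proof -
  let ?A = "Poly_Mapping.keys x \<union> Poly_Mapping.keys y"
  have "pm_eval h \<chi> (x + y) = (\<Sum>w\<in>?A. h (Poly_Mapping.lookup (x + y) w) * \<chi> w)"
    using Poly_Mapping.keys_add[of x y] by (intro eval_superset) auto
  also have "\<dots> = pm_eval h \<chi> x + pm_eval h \<chi> y"
    by (simp add: eval_superset[of ?A x] eval_superset[of ?A y] lookup_add h_add
        distrib_right sum.distrib)
  finally show ?thesis .
qed

lemma eval_single: "pm_eval h \<chi> (Poly_Mapping.single w r) = h r * \<chi> w"
  by (simp add: pm_eval_def h_zero)

lemma eval_one: "pm_eval h \<chi> 1 = 1"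
  using eval_single[of 0 1] by (simp add: h_one chi_zero)

lemma eval_uminus: "pm_eval h \<chi> (- x) = - pm_eval h \<chi> x"
  using eval_add[of x "- x"] by (simp add: eq_neg_iff_add_eq_0 add.commute)

lemma eval_diff: "pm_eval h \<chi> (x - y) = pm_eval h \<chi> x - pm_eval h \<chi> y"
  using eval_add[of x "- y"] by (simp add: eval_uminus)

lemma eval_single_mult:
  "pm_eval h \<chi> (Poly_Mapping.single v r * x) = h r * \<chi> v * pm_eval h \<chi> x"
proof (induction x rule: poly_mapping_add_induct)
  case (add w s x)
  have "h r * h s * (\<chi> v * \<chi> w) = h r * \<chi> v * (h s * \<chi> w)"
    by (metis central mult.assoc)
  then show ?case
    by (simp add: distrib_left eval_add add mult_single eval_single h_mult chi_add)
qed simp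

lemma eval_mult: "pm_eval h \<chi> (x * y) = pm_eval h \<chi> x * pm_eval h \<chi> y"
  by (induction x rule: poly_mapping_add_induct)
    (simp_all add: distrib_right eval_add eval_single eval_single_mult)

lemma eval_sum: "pm_eval h \<chi> (sum f A) = (\<Sum>i\<in>A. pm_eval h \<chi> (f i))"
  by (induction A rule: infinite_finite_induct) (simp_all add: eval_add)

end

definition word_chi :: "(nat \<times> nat \<Rightarrow> 'b) \<Rightarrow> (nat \<times> nat) fmon \<Rightarrow> 'b::monoid_mult" where
  "word_chi g w = prod_list (map g (letters w))"

lemma word_chi_simps:
  "word_chi g 0 = 1" "word_chi g (v + w) = word_chi g v * word_chi g w"
  "word_chi g (Fmon [l]) = g l"
  by (simp_all add: word_chi_def zero_fmon_def plus_fmon_def)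

lemma falg_eval_pm_eval: "falg_eval g = pm_eval of_int (word_chi g)"
  by (simp add: falg_eval_def pm_eval_def word_chi_def fun_eq_iff)

interpretation fe: pm_evaluation of_int "word_chi g" for g :: "nat \<times> nat \<Rightarrow> 'b::ring_1"
proof
  show "of_int r * word_chi g w = word_chi g w * of_int r" for r w
    by (rule mult_of_int_commute)
qed (simp_all add: word_chi_simps)

lemmas falg_eval_simps [simp] =
  fe.eval_add[folded falg_eval_pm_eval] fe.eval_zero[folded falg_eval_pm_eval]
  fe.eval_uminus[folded falg_eval_pm_eval] fe.eval_diff[folded falg_eval_pm_eval]
  fe.eval_mult[folded falg_eval_pm_eval] fe.eval_one[folded falg_eval_pm_eval]

lemmas falg_eval_sum = fe.eval_sum[folded falg_eval_pm_eval]

lemma falg_eval_agen [simp]: "falg_eval g (agen i j) = g (i, j)"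
  by (simp add: falg_eval_pm_eval agen_def fe.eval_single word_chi_simps)

subsection \<open>The subalgebras \<open>\<A>\<^sub>n\<close>\<close>

lemma free_alg_simps [simp]:
  "monoid.mult (free_alg n) = (*)" "one (free_alg n) = 1"
  "zero (free_alg n) = 0" "add (free_alg n) = (+)"
  by (simp_all add: free_alg_def)

definition gens :: "nat \<Rightarrow> (nat \<times> nat) set" where
  "gens n = {(i, j). i \<in> {1..n} \<and> j \<in> {1..n} \<and> i \<noteq> j}"

lemma gens_iff [simp]: "(i, j) \<in> gens n \<longleftrightarrow> i \<in> {1..n} \<and> j \<in> {1..n} \<and> i \<noteq> j"
  by (simp add: gens_def)

lemma free_alg_carrier:
  "x \<in> carrier (free_alg n) \<longleftrightarrow> (\<forall>w\<in>Poly_Mapping.keys x. set (letters w) \<subseteq> gens n)"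
  by (auto simp: free_alg_def gens_def)

lemma free_alg_zero [simp]: "0 \<in> carrier (free_alg n)"
  by (simp add: free_alg_carrier)

lemma free_alg_one [simp]: "1 \<in> carrier (free_alg n)"
  by (simp add: free_alg_carrier zero_fmon_def)

lemma free_alg_add:
  "x \<in> carrier (free_alg n) \<Longrightarrow> y \<in> carrier (free_alg n) \<Longrightarrow> x + y \<in> carrier (free_alg n)"
  using Poly_Mapping.keys_add[of x y] by (auto simp: free_alg_carrier)

lemma free_alg_uminus: "x \<in> carrier (free_alg n) \<Longrightarrow> - x \<in> carrier (free_alg n)"
  by (auto simp: free_alg_carrier in_keys_iff)

lemma free_alg_diff:
  "x \<in> carrier (free_alg n) \<Longrightarrow> y \<in> carrier (free_alg n) \<Longrightarrow> x - y \<in> carrier (free_alg n)"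
  using free_alg_add[of x n "- y"] free_alg_uminus[of y n] by simp

lemma free_alg_mult:
  assumes "x \<in> carrier (free_alg n)" "y \<in> carrier (free_alg n)"
  shows "x * y \<in> carrier (free_alg n)"
  unfolding free_alg_carrier
proof
  fix w assume "w \<in> Poly_Mapping.keys (x * y)"
  then obtain u v where "u \<in> Poly_Mapping.keys x" "v \<in> Poly_Mapping.keys y" "w = u + v"
    using Poly_Mapping.keys_mult[of x y] by auto
  then show "set (letters w) \<subseteq> gens n"
    using assms by (auto simp: free_alg_carrier plus_fmon_def)
qed

lemma free_alg_sum:
  "(\<And>i. i \<in> A \<Longrightarrow> f i \<in> carrier (free_alg n)) \<Longrightarrow> sum f A \<in> carrier (free_alg n)"
  by (induction A rule: infinite_finite_induct) (auto intro: free_alg_add)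

lemma free_alg_agen [simp]: "(i, j) \<in> gens n \<Longrightarrow> agen i j \<in> carrier (free_alg n)"
  by (simp add: free_alg_carrier agen_def)

lemma free_alg_prod_list:
  "(\<And>x. x \<in> set xs \<Longrightarrow> x \<in> carrier (free_alg n)) \<Longrightarrow> prod_list xs \<in> carrier (free_alg n)"
  by (induction xs) (auto intro: free_alg_mult)

lemma of_int_free_alg: "of_int r \<in> carrier (free_alg n)"
proof -
  have nat: "of_nat k \<in> carrier (free_alg n)" for k
    by (induction k) (auto intro: free_alg_add)
  show ?thesis by (cases r) (auto simp: nat simp del: of_nat_Suc intro!: free_alg_uminus)
qed

lemma ring_free_alg: "ring (free_alg n)"
proof (rule ringI)
  show "abelian_group (free_alg n)"
  proof (rule abelian_groupI)
    fix x assume "x \<in> carrier (free_alg n)"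
    then show "\<exists>y\<in>carrier (free_alg n). y \<oplus>\<^bsub>free_alg n\<^esub> x = \<zero>\<^bsub>free_alg n\<^esub>"
      by (intro bexI[of _ "- x"]) (simp_all add: free_alg_uminus)
  qed (simp_all add: free_alg_add add_ac)
  show "monoid (free_alg n)"
    by (rule monoidI) (simp_all add: free_alg_mult mult.assoc)
qed (simp_all add: distrib_left distrib_right)

lemma falg_eval_cong:
  assumes "x \<in> carrier (free_alg n)" "\<And>l. l \<in> gens n \<Longrightarrow> g l = g' l"
  shows "falg_eval g x = falg_eval g' x"
  unfolding falg_eval_def
  using assms by (intro sum.cong refl arg_cong2[where f = "(*)"] arg_cong[where f = prod_list])
    (auto simp: free_alg_carrier)

lemma falg_eval_closed:
  assumes "x \<in> carrier (free_alg n)" "\<And>l. l \<in> gens n \<Longrightarrow> g l \<in> carrier (free_alg m)"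
  shows "falg_eval g x \<in> carrier (free_alg m)"
  unfolding falg_eval_def
proof (intro free_alg_sum free_alg_mult of_int_free_alg free_alg_prod_list)
  fix w y assume "w \<in> Poly_Mapping.keys x" "y \<in> set (map g (letters w))"
  then obtain l where "y = g l" "l \<in> gens n" using assms(1) by (auto simp: free_alg_carrier)
  then show "y \<in> carrier (free_alg m)" using assms(2) by simp
qed

lemma single_Fmon:
  "Poly_Mapping.single w (of_int r) =
    (of_int r * prod_list (map (\<lambda>(i, j). agen i j) (letters w)) :: 'r::ring_1 falg)"
proof -
  have "prod_list (map (\<lambda>(i, j). agen i j) ls) = Poly_Mapping.single (Fmon ls) (1 :: 'r)" for ls
    by (induction ls) (auto simp: agen_def mult_single plus_fmon_def zero_fmon_def[symmetric])
  then have "prod_list (map (\<lambda>(i, j). agen i j) (letters w)) = Poly_Mapping.single w (1 :: 'r)"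
    by simp
  moreover have "Poly_Mapping.single w (of_int r) =
      Poly_Mapping.single 0 (of_int r) * Poly_Mapping.single w (1 :: 'r)"
    by (simp only: mult_single add_0_left mult_1_right)
  ultimately show ?thesis by (simp only: single_of_int)
qed

text \<open>Identities between compositions of substitutions reduce to the letters by this lemma.
  Additivity and multiplicativity are asked on the carrier only, because augmentations are
  constrained nowhere else.\<close>

lemma falg_ext:
  fixes f f' :: "int falg \<Rightarrow> 'b::ring_1" and n :: nat
  defines "A \<equiv> carrier (free_alg n)"
  assumes zero: "f 0 = f' 0" and one: "f 1 = f' 1"
    and f: "\<And>x y. x \<in> A \<Longrightarrow> y \<in> A \<Longrightarrow> f (x + y) = f x + f y"
      "\<And>x y. x \<in> A \<Longrightarrow> y \<in> A \<Longrightarrow> f (x * y) = f x * f y"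
    and f': "\<And>x y. x \<in> A \<Longrightarrow> y \<in> A \<Longrightarrow> f' (x + y) = f' x + f' y"
      "\<And>x y. x \<in> A \<Longrightarrow> y \<in> A \<Longrightarrow> f' (x * y) = f' x * f' y"
    and gens: "\<And>i j. (i, j) \<in> gens n \<Longrightarrow> f (agen i j) = f' (agen i j)"
    and x: "x \<in> A"
  shows "f x = f' x"
proof -
  have A: "0 \<in> A" "1 \<in> A" "of_int r \<in> A" for r
    by (simp_all add: A_def of_int_free_alg)
  have A_nat: "of_nat k \<in> A" for k using A(3)[of "int k"] by simp
  have nat: "f (of_nat k) = f' (of_nat k)" for k
    by (induction k) (simp_all add: zero one A A_nat f f')
  have f0: "f 0 = 0" "f' 0 = 0" using f(1)[of 0 0] f'(1)[of 0 0] A by auto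
  have neg: "f (- y) = - f y" "f' (- y) = - f' y" if "y \<in> A" for y
    using f(1)[of y "- y"] f'(1)[of y "- y"] f0 that
    by (simp_all add: A_def free_alg_uminus eq_neg_iff_add_eq_0 add.commute)
  have int: "f (of_int r) = f' (of_int r)" for r
    using nat neg[OF A_nat] by (cases r) (simp_all del: of_nat_Suc)
  have ls: "prod_list (map (\<lambda>(i, j). agen i j) ls) \<in> A \<and>
      f (prod_list (map (\<lambda>(i, j). agen i j) ls)) = f' (prod_list (map (\<lambda>(i, j). agen i j) ls))"
    if "set ls \<subseteq> gens n" for ls
    using that
  proof (induction ls)
    case Nil then show ?case by (simp add: one A)
  next
    case (Cons l ls)
    obtain i j where l: "l = (i, j)" by (cases l)
    have "agen i j \<in> A" using Cons.prems unfolding A_def l by (intro free_alg_agen) simp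
    then show ?case using Cons f f' gens[of i j] by (auto simp: l A_def free_alg_mult)
  qed
  have mono: "Poly_Mapping.single w r \<in> A \<and> f (Poly_Mapping.single w r) = f' (Poly_Mapping.single w r)"
    if "set (letters w) \<subseteq> gens n" for w r
    using ls[OF that] int A(3)[of r] single_Fmon[of w r, where 'r = int]
    by (simp add: f f' A_def free_alg_mult)
  have fsum: "sum g W \<in> A \<and> f (sum g W) = f' (sum g W)"
    if "\<And>w. w \<in> W \<Longrightarrow> g w \<in> A \<and> f (g w) = f' (g w)" for g and W :: "(nat \<times> nat) fmon set"
    using that by (induction W rule: infinite_finite_induct) (auto simp: f0 f f' A A_def free_alg_add)
  have "x = (\<Sum>w\<in>Poly_Mapping.keys x. Poly_Mapping.single w (Poly_Mapping.lookup x w))"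
    by (intro poly_mapping_eqI) (auto simp: lookup_sum lookup_single when_def in_keys_iff)
  moreover have "set (letters w) \<subseteq> gens n" if "w \<in> Poly_Mapping.keys x" for w
    using x that by (auto simp: A_def free_alg_carrier)
  ultimately show ?thesis
    using fsum[of "Poly_Mapping.keys x" "\<lambda>w. Poly_Mapping.single w (Poly_Mapping.lookup x w)"] mono
    by simp
qed

section \<open>The action of the braid group on \<open>\<A>\<^sub>n\<close>\<close>

lemma ring_auto_subgroup:
  assumes "ring R"
  shows "subgroup (ring_auto R) (BijGroup (carrier R))"
proof -
  interpret ring R by fact
  show ?thesis
  proof
    show "ring_auto R \<subseteq> carrier (BijGroup (carrier R))"
      by (auto simp: ring_auto_def BijGroup_def)
  next
    fix f g assume fg: "f \<in> ring_auto R" "g \<in> ring_auto R"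
    then have "f \<in> Bij (carrier R)" "g \<in> Bij (carrier R)" by (auto simp: ring_auto_def)
    moreover have "compose (carrier R) f g \<in> Ring.ring_hom R R"
      using fg by (auto simp: ring_auto_def Ring.ring_hom_def compose_def Pi_iff)
    ultimately show "f \<otimes>\<^bsub>BijGroup (carrier R)\<^esub> g \<in> ring_auto R"
      by (simp add: BijGroup_def ring_auto_def compose_Bij)
  next
    show "\<one>\<^bsub>BijGroup (carrier R)\<^esub> \<in> ring_auto R"
      by (auto simp: BijGroup_def ring_auto_def id_Bij Ring.ring_hom_def)
  next
    fix f assume f: "f \<in> ring_auto R"
    then have bij: "f \<in> Bij (carrier R)" and hom: "f \<in> Ring.ring_hom R R"
      by (auto simp: ring_auto_def)
    have one: "inv_into (carrier R) f \<one>\<^bsub>R\<^esub> = \<one>\<^bsub>R\<^esub>"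
      using bij hom by (intro inv_into_f_eq) (auto simp: Bij_def bij_betw_def Ring.ring_hom_def)
    have "(\<lambda>x\<in>carrier R. inv_into (carrier R) f x) \<in> Ring.ring_hom R R"
      using bij hom
      by (auto simp: Ring.ring_hom_def Bij_inv_into_mem one
          intro!: Bij_inv_into_lemma[of _ f "(\<otimes>\<^bsub>R\<^esub>)"] Bij_inv_into_lemma[of _ f "(\<oplus>\<^bsub>R\<^esub>)"])
    then show "inv\<^bsub>BijGroup (carrier R)\<^esub> f \<in> ring_auto R"
      using bij by (simp add: inv_BijGroup ring_auto_def restrict_inv_into_Bij)
  qed
qed

lemma group_RingAutGroup: "ring R \<Longrightarrow> group (RingAutGroup R)"
  unfolding RingAutGroup_def
  by (intro subgroup.subgroup_is_group ring_auto_subgroup group_BijGroup)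

lemma RingAutGroup_simps:
  "carrier (RingAutGroup R) = ring_auto R"
  "\<one>\<^bsub>RingAutGroup R\<^esub> = (\<lambda>x\<in>carrier R. x)"
  "f \<in> ring_auto R \<Longrightarrow> g \<in> ring_auto R \<Longrightarrow> f \<otimes>\<^bsub>RingAutGroup R\<^esub> g = compose (carrier R) f g"
  by (simp_all add: RingAutGroup_def BijGroup_def ring_auto_def)

text \<open>The inverse of the automorphism for \<open>\<sigma>_k\<close>: the formulas of
  \<open>phi_letter\<close> with \<open>k\<close> and \<open>k + 1\<close> exchanged.\<close>

fun phi_inv_letter :: "nat \<Rightarrow> nat \<times> nat \<Rightarrow> int falg" where
  "phi_inv_letter k (i, j) =
    (if i = k \<and> j = k + 1 then - agen (k + 1) k
     else if i = k + 1 \<and> j = k then - agen k (k + 1)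
     else if i = k then agen (k + 1) j
     else if j = k then agen i (k + 1)
     else if i = k + 1 then agen k j - agen k (k + 1) * agen (k + 1) j
     else if j = k + 1 then agen i k - agen i (k + 1) * agen (k + 1) k
     else agen i j)"

definition phi_gen :: "nat \<times> bool \<Rightarrow> int falg \<Rightarrow> int falg" where
  "phi_gen = (\<lambda>(k, b). falg_eval (if b then phi_letter k else phi_inv_letter k))"

lemma phi_gen_hom [simp]:
  "phi_gen l 0 = 0" "phi_gen l 1 = 1" "phi_gen l (x + y) = phi_gen l x + phi_gen l y"
  "phi_gen l (x - y) = phi_gen l x - phi_gen l y" "phi_gen l (- x) = - phi_gen l x"
  "phi_gen l (x * y) = phi_gen l x * phi_gen l y"
  by (simp_all add: phi_gen_def split: prod.splits)

lemma phi_gen_sum: "phi_gen l (sum f A) = (\<Sum>i\<in>A. phi_gen l (f i))"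
  by (simp add: phi_gen_def falg_eval_sum split: prod.splits)

lemma phi_gen_agen:
  "phi_gen (k, True) (agen i j) = phi_letter k (i, j)"
  "phi_gen (k, False) (agen i j) = phi_inv_letter k (i, j)"
  by (simp_all add: phi_gen_def)

lemma phi_gen_closed:
  assumes "fst l \<in> {1..<n}" "x \<in> carrier (free_alg n)"
  shows "phi_gen l x \<in> carrier (free_alg n)"
proof -
  obtain k b where l: "l = (k, b)" by (cases l)
  have "(if b then phi_letter k else phi_inv_letter k) (i, j) \<in> carrier (free_alg n)"
    if "(i, j) \<in> gens n" for i j
    using that assms(1) l
    by (auto intro!: free_alg_uminus free_alg_diff free_alg_mult free_alg_agen)
  then show ?thesis
    unfolding phi_gen_def l by (auto intro!: falg_eval_closed[OF assms(2)])
qed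

lemma phi_gen_cancel:
  assumes "x \<in> carrier (free_alg n)"
  shows "phi_gen (k, b) (phi_gen (k, \<not> b) x) = x"
proof -
  have cancel: "phi_gen (k, True) (phi_gen (k, False) (agen i j)) = agen i j \<and>
      phi_gen (k, False) (phi_gen (k, True) (agen i j)) = agen i j" if "(i, j) \<in> gens n" for i j
  proof -
    have "i = k \<or> i = Suc k \<or> (i \<noteq> k \<and> i \<noteq> Suc k)" "j = k \<or> j = Suc k \<or> (j \<noteq> k \<and> j \<noteq> Suc k)"
      by auto
    then show ?thesis
      using that by (elim disjE conjE) (simp_all add: phi_gen_agen)
  qed
  have "phi_gen (k, b) (phi_gen (k, \<not> b) (agen i j)) = agen i j" if "(i, j) \<in> gens n" for i j
    using cancel[OF that] by (cases b) simp_all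
  then show ?thesis
    by (intro falg_ext[of "\<lambda>x. phi_gen (k, b) (phi_gen (k, \<not> b) x)" "\<lambda>x. x", OF _ _ _ _ _ _ _ assms]) auto
qed

lemma phi_gen_far:
  assumes "x \<in> carrier (free_alg n)" "k + 2 \<le> l"
  shows "phi_gen (k, True) (phi_gen (l, True) x) = phi_gen (l, True) (phi_gen (k, True) x)"
proof -
  have "phi_gen (k, True) (phi_gen (l, True) (agen i j)) = phi_gen (l, True) (phi_gen (k, True) (agen i j))"
    if "(i, j) \<in> gens n" for i j
  proof -
    obtain d where l: "l = Suc (Suc (k + d))" using assms(2) by (auto simp: le_iff_add)
    have "i = k \<or> i = Suc k \<or> i = l \<or> i = Suc l \<or> (i \<noteq> k \<and> i \<noteq> Suc k \<and> i \<noteq> l \<and> i \<noteq> Suc l)"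
      "j = k \<or> j = Suc k \<or> j = l \<or> j = Suc l \<or> (j \<noteq> k \<and> j \<noteq> Suc k \<and> j \<noteq> l \<and> j \<noteq> Suc l)"
      by auto
    then show ?thesis
      using that unfolding l by (elim disjE conjE) (simp_all add: phi_gen_agen algebra_simps)
  qed
  then show ?thesis
    by (intro falg_ext[of "\<lambda>x. phi_gen (k, True) (phi_gen (l, True) x)"
          "\<lambda>x. phi_gen (l, True) (phi_gen (k, True) x)", OF _ _ _ _ _ _ _ assms(1)]) auto
qed

lemma phi_gen_braid:
  assumes "x \<in> carrier (free_alg n)"
  shows "phi_gen (k, True) (phi_gen (Suc k, True) (phi_gen (k, True) x)) =
    phi_gen (Suc k, True) (phi_gen (k, True) (phi_gen (Suc k, True) x))"
proof -
  have "phi_gen (k, True) (phi_gen (Suc k, True) (phi_gen (k, True) (agen i j))) =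
    phi_gen (Suc k, True) (phi_gen (k, True) (phi_gen (Suc k, True) (agen i j)))"
    if "(i, j) \<in> gens n" for i j
  proof -
    have "i = k \<or> i = Suc k \<or> i = Suc (Suc k) \<or> (i \<noteq> k \<and> i \<noteq> Suc k \<and> i \<noteq> Suc (Suc k))"
      "j = k \<or> j = Suc k \<or> j = Suc (Suc k) \<or> (j \<noteq> k \<and> j \<noteq> Suc k \<and> j \<noteq> Suc (Suc k))"
      by auto
    then show ?thesis
      using that by (elim disjE conjE) (simp_all add: phi_gen_agen algebra_simps)
  qed
  then show ?thesis
    by (intro falg_ext[of "\<lambda>x. phi_gen (k, True) (phi_gen (Suc k, True) (phi_gen (k, True) x))"
          "\<lambda>x. phi_gen (Suc k, True) (phi_gen (k, True) (phi_gen (Suc k, True) x))",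
          OF _ _ _ _ _ _ _ assms]) auto
qed

lemma phi_gen_ring_auto:
  assumes "fst l \<in> {1..<n}"
  shows "restrict (phi_gen l) (carrier (free_alg n)) \<in> ring_auto (free_alg n)"
proof -
  obtain k b where l: "l = (k, b)" by (cases l)
  have "bij_betw (phi_gen l) (carrier (free_alg n)) (carrier (free_alg n))"
    by (rule bij_betwI[where g = "phi_gen (k, \<not> b)"])
      (use assms l phi_gen_closed[of _ n] phi_gen_cancel[of _ n k b] phi_gen_cancel[of _ n k "\<not> b"] in auto)
  then show ?thesis
    using assms
    by (auto simp: ring_auto_def Bij_def Ring.ring_hom_def phi_gen_closed free_alg_mult free_alg_add
        cong: bij_betw_cong)
qed

fun phi_word :: "braid_word \<Rightarrow> int falg \<Rightarrow> int falg" where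
  "phi_word [] x = x"
| "phi_word (l # u) x = phi_gen l (phi_word u x)"

lemma phi_word_closed:
  "u \<in> braid_words n \<Longrightarrow> x \<in> carrier (free_alg n) \<Longrightarrow> phi_word u x \<in> carrier (free_alg n)"
  by (induction u) (auto intro!: phi_gen_closed)

text \<open>Replaces the definite description behind \<open>phi\<close> by a recursion on words.
  Products of automorphisms are compositions, so the first letter of the word is applied
  last.\<close>

lemma phi_class:
  assumes "u \<in> braid_words n" "x \<in> carrier (free_alg n)"
  shows "phi n (braid_class n u) x = phi_word u x"
proof -
  define A :: "int falg set" where "A = carrier (free_alg n)"
  define G where "G = RingAutGroup (free_alg n :: int falg ring)"
  define s where "s = (\<lambda>k. restrict (falg_eval (phi_letter k)) (carrier (free_alg n)))"
  interpret group G unfolding G_def by (intro group_RingAutGroup ring_free_alg)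
  have s_eq: "s k = restrict (phi_gen (k, True)) A" for k
    by (simp add: s_def phi_gen_def A_def)
  have auto: "restrict (phi_gen (k, b)) A \<in> carrier G" if "k \<in> {1..<n}" for k b
    using phi_gen_ring_auto[of "(k, b)" n] that by (simp add: G_def RingAutGroup_simps A_def)
  have mult: "f \<otimes>\<^bsub>G\<^esub> g = compose A f g" if "f \<in> carrier G" "g \<in> carrier G" for f g
    using that by (simp add: G_def RingAutGroup_simps A_def)
  have comp: "restrict f A \<otimes>\<^bsub>G\<^esub> restrict g A = restrict (\<lambda>x. f (g x)) A"
    if "restrict f A \<in> carrier G" "restrict g A \<in> carrier G" "\<And>x. x \<in> A \<Longrightarrow> g x \<in> A" for f g
    using that by (auto simp: mult compose_def)
  have closed: "phi_gen (k, b) y \<in> A" if "k \<in> {1..<n}" "y \<in> A" for k b y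
    using phi_gen_closed[of "(k, b)" n y] that by (simp add: A_def)
  have s_inv: "inv\<^bsub>G\<^esub> (s k) = restrict (phi_gen (k, False)) A" if "k \<in> {1..<n}" for k
  proof (rule inv_equality)
    show "restrict (phi_gen (k, False)) A \<otimes>\<^bsub>G\<^esub> s k = \<one>\<^bsub>G\<^esub>"
    proof -
      have "restrict (phi_gen (k, False)) A \<otimes>\<^bsub>G\<^esub> s k =
          restrict (\<lambda>x. phi_gen (k, False) (phi_gen (k, True) x)) A"
        unfolding s_eq using that auto closed by (intro comp) auto
      also have "\<dots> = restrict (\<lambda>x. x) A"
        using phi_gen_cancel[of _ n k False] by (intro restrict_ext) (simp add: A_def)
      finally show ?thesis by (simp add: G_def RingAutGroup_simps A_def)
    qed
  qed (use that auto s_eq in auto)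
  interpret braid_rep G n s
  proof
    fix i assume "i \<in> {1..<n}" then show "s i \<in> carrier G" using auto by (simp add: s_eq)
  next
    fix i j assume "i \<in> {1..<n}" "j \<in> {1..<n}" "i + 2 \<le> j"
    then show "s i \<otimes>\<^bsub>G\<^esub> s j = s j \<otimes>\<^bsub>G\<^esub> s i"
      using auto closed phi_gen_far[of _ n i j, folded A_def] by (auto simp: s_eq comp)
  next
    fix i assume i: "i \<in> {1..<n}" "Suc i \<in> {1..<n}"
    have cl: "restrict (\<lambda>x. phi_gen (k, True) (phi_gen (l, True) x)) A \<in> carrier G"
      if "k \<in> {1..<n}" "l \<in> {1..<n}" for k l
      using comp[OF auto[of k True] auto[of l True]] that closed
        m_closed[OF auto[of k True] auto[of l True]] by simp
    show "s i \<otimes>\<^bsub>G\<^esub> (s (Suc i) \<otimes>\<^bsub>G\<^esub> s i) = s (Suc i) \<otimes>\<^bsub>G\<^esub> (s i \<otimes>\<^bsub>G\<^esub> s (Suc i))"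
      using i auto closed cl phi_gen_braid[of _ n i, folded A_def] by (auto simp: s_eq comp)
  qed
  have "word_val G s u = restrict (phi_word u) A"
    using assms(1)
  proof (induction u)
    case Nil then show ?case by (simp add: G_def RingAutGroup_simps A_def)
  next
    case (Cons l u)
    obtain k b where l: "l = (k, b)" by (cases l)
    have k: "k \<in> {1..<n}" and u: "u \<in> braid_words n" using Cons.prems l by auto
    have "word_val G s (l # u) = restrict (phi_gen (k, b)) A \<otimes>\<^bsub>G\<^esub> restrict (phi_word u) A"
    proof -
      have "(if b then s k else inv\<^bsub>G\<^esub> (s k)) = restrict (phi_gen (k, b)) A"
        by (cases b, simp_all only: if_True if_False s_inv[OF k] simp_thms) (rule s_eq)
      then show ?thesis by (simp only: l word_val_simps Cons.IH[OF u])
    qed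
    also have "\<dots> = restrict (\<lambda>x. phi_gen (k, b) (phi_word u x)) A"
    proof (intro comp)
      show "restrict (phi_gen (k, b)) A \<in> carrier G" using k by (rule auto)
      show "restrict (phi_word u) A \<in> carrier G"
        using word_val_closed[OF u] by (simp only: Cons.IH[OF u])
      show "phi_word u x \<in> A" if "x \<in> A" for x
        using that phi_word_closed[OF u] by (simp add: A_def)
    qed
    finally show ?case by (simp add: l)
  qed
  moreover have "phi n (braid_class n u) = word_val G s u"
    using braid_hom_class[OF assms(1)] by (simp add: phi_def G_def s_def)
  ultimately show ?thesis using assms(2) by (simp add: A_def)
qed

section \<open>The matrices \<open>\<Phi>\<^sup>L\<close> and \<open>\<Phi>\<^sup>R\<close>\<close>

lemma lookup_mult_single_right:
  assumes "\<And>u. u + v = w + v \<longleftrightarrow> u = w"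
  shows "Poly_Mapping.lookup (x * Poly_Mapping.single v (1::'r::ring_1)) (w + v) = Poly_Mapping.lookup x w"
  by (induction x rule: poly_mapping_add_induct)
    (simp_all add: distrib_right lookup_add mult_single lookup_single when_def assms)

lemma lookup_mult_single_right_0:
  assumes "\<And>u. u + v \<noteq> w"
  shows "Poly_Mapping.lookup (x * Poly_Mapping.single v (1::'r::ring_1)) w = 0"
  by (induction x rule: poly_mapping_add_induct)
    (simp_all add: distrib_right lookup_add mult_single lookup_single when_def assms)

lemma lookup_mult_single_left:
  assumes "\<And>u. v + u = v + w \<longleftrightarrow> u = w"
  shows "Poly_Mapping.lookup (Poly_Mapping.single v (1::'r::ring_1) * x) (v + w) = Poly_Mapping.lookup x w"
  by (induction x rule: poly_mapping_add_induct)
    (simp_all add: distrib_left lookup_add mult_single lookup_single when_def assms)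

lemma lookup_mult_single_left_0:
  assumes "\<And>u. v + u \<noteq> w"
  shows "Poly_Mapping.lookup (Poly_Mapping.single v (1::'r::ring_1) * x) w = 0"
  by (induction x rule: poly_mapping_add_induct)
    (simp_all add: distrib_left lookup_add mult_single lookup_single when_def assms)

text \<open>Words with different last letters are different and the free monoid is cancellative, so
  the factor in front of each letter can be read off. This makes the matrix \<open>PhiL\<close>
  unique.\<close>

lemma lookup_sum_agen_right:
  fixes M :: "nat \<Rightarrow> 'r::ring_1 falg"
  assumes "j < n"
  shows "Poly_Mapping.lookup (\<Sum>j<n. M j * agen (j + 1) (n + 1)) (w + Fmon [(j + 1, n + 1)]) =
    Poly_Mapping.lookup (M j) w"
proof -
  let ?l = "\<lambda>i. Poly_Mapping.lookup (M i * agen (i + 1) (n + 1)) (w + Fmon [(j + 1, n + 1)])"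
  have "?l j = Poly_Mapping.lookup (M j) w"
    unfolding agen_def by (rule lookup_mult_single_right) (metis append_same_eq fmon.expand fmon.sel plus_fmon_def)
  moreover have "?l i = 0" if "i \<noteq> j" for i
    unfolding agen_def using that by (intro lookup_mult_single_right_0) (simp add: plus_fmon_def)
  then have "(\<Sum>i\<in>{..<n} - {j}. ?l i) = 0" by (intro sum.neutral) auto
  moreover have "(\<Sum>i<n. ?l i) = ?l j + (\<Sum>i\<in>{..<n} - {j}. ?l i)"
    using assms by (intro sum.remove) auto
  ultimately show ?thesis by (simp add: lookup_sum)
qed

lemma lookup_sum_agen_left:
  fixes M :: "nat \<Rightarrow> 'r::ring_1 falg"
  assumes "j < n"
  shows "Poly_Mapping.lookup (\<Sum>j<n. agen (n + 1) (j + 1) * M j) (Fmon [(n + 1, j + 1)] + w) =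
    Poly_Mapping.lookup (M j) w"
proof -
  let ?l = "\<lambda>i. Poly_Mapping.lookup (agen (n + 1) (i + 1) * M i) (Fmon [(n + 1, j + 1)] + w)"
  have "?l j = Poly_Mapping.lookup (M j) w"
    unfolding agen_def by (rule lookup_mult_single_left) (metis append_same_eq same_append_eq fmon.expand fmon.sel plus_fmon_def)
  moreover have "?l i = 0" if "i \<noteq> j" for i
    unfolding agen_def using that by (intro lookup_mult_single_left_0) (simp add: plus_fmon_def)
  then have "(\<Sum>i\<in>{..<n} - {j}. ?l i) = 0" by (intro sum.neutral) auto
  moreover have "(\<Sum>i<n. ?l i) = ?l j + (\<Sum>i\<in>{..<n} - {j}. ?l i)"
    using assms by (intro sum.remove) auto
  ultimately show ?thesis by (simp add: lookup_sum)
qed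

lemma sum_delta_nat:
  fixes f :: "nat \<Rightarrow> 'a::ring_1"
  shows "i < n \<Longrightarrow> (\<Sum>j<n. (if j = i then 1 else 0) * f j) = f i"
    and "i < n \<Longrightarrow> (\<Sum>j<n. f j * (if j = i then 1 else 0)) = f i"
  by (simp_all add: if_distrib[of "\<lambda>x. x * _"] if_distrib[of "\<lambda>x. _ * x"] cong: if_cong)

lemma phi_gen_linear_left:
  assumes "fst l \<in> {1..<n}"
  obtains N where "\<And>i j. N i j \<in> carrier (free_alg n)"
    and "\<And>i. i < n \<Longrightarrow> phi_gen l (agen (i + 1) (n + 1)) = (\<Sum>j<n. N i j * agen (j + 1) (n + 1))"
proof -
  obtain k b where l: "l = (k, b)" by (cases l)
  \<comment> \<open>Matrix indices start at 0, so rows \<open>d\<close> and \<open>d + 1\<close>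
    belong to strands \<open>k\<close> and \<open>k + 1\<close>.\<close>
  define d where "d = k - 1"
  have k: "k = Suc d" "Suc d < n" using assms l by (auto simp: d_def)
  define \<delta> :: "nat \<Rightarrow> nat \<Rightarrow> int falg" where "\<delta> = (\<lambda>i j. if j = i then 1 else 0)"
  define N where "N = (\<lambda>i j.
    if b then (if i = d then \<delta> (Suc d) j - agen (k + 1) k * \<delta> d j else if i = Suc d then \<delta> d j else \<delta> i j)
    else (if i = d then \<delta> (Suc d) j else if i = Suc d then \<delta> d j - agen k (k + 1) * \<delta> (Suc d) j else \<delta> i j))"
  have \<delta>: "(\<Sum>j<n. \<delta> i j * f j) = f i" "(\<Sum>j<n. x * \<delta> i j * f j) = x * f i" if "i < n" for i f x
    using that sum_delta_nat(1)[of i n f] by (simp_all add: \<delta>_def mult.assoc flip: sum_distrib_left)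
  show ?thesis
  proof
    show "N i j \<in> carrier (free_alg n)" for i j
      using k by (auto simp: N_def \<delta>_def intro!: free_alg_diff free_alg_mult free_alg_agen free_alg_uminus)
    show "phi_gen l (agen (i + 1) (n + 1)) = (\<Sum>j<n. N i j * agen (j + 1) (n + 1))" if i: "i < n" for i
      using i k unfolding l N_def
      by (cases b; cases "i = d"; cases "i = Suc d")
        (simp_all add: phi_gen_agen left_diff_distrib sum_subtractf \<delta>)
  qed
qed

lemma phi_gen_linear_right:
  assumes "fst l \<in> {1..<n}"
  obtains N where "\<And>i j. N i j \<in> carrier (free_alg n)"
    and "\<And>i. i < n \<Longrightarrow> phi_gen l (agen (n + 1) (i + 1)) = (\<Sum>j<n. agen (n + 1) (j + 1) * N j i)"
proof -
  obtain k b where l: "l = (k, b)" by (cases l)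
  define d where "d = k - 1"
  have k: "k = Suc d" "Suc d < n" using assms l by (auto simp: d_def)
  define \<delta> :: "nat \<Rightarrow> nat \<Rightarrow> int falg" where "\<delta> = (\<lambda>i j. if j = i then 1 else 0)"
  define N where "N = (\<lambda>j i.
    if b then (if i = d then \<delta> (Suc d) j - \<delta> d j * agen k (k + 1) else if i = Suc d then \<delta> d j else \<delta> i j)
    else (if i = d then \<delta> (Suc d) j else if i = Suc d then \<delta> d j - \<delta> (Suc d) j * agen (k + 1) k else \<delta> i j))"
  have \<delta>: "(\<Sum>j<n. f j * \<delta> i j) = f i" "(\<Sum>j<n. f j * (\<delta> i j * x)) = f i * x" if "i < n" for i f x
    using that sum_delta_nat(2)[of i n f] by (simp_all add: \<delta>_def flip: mult.assoc sum_distrib_right)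
  show ?thesis
  proof
    show "N i j \<in> carrier (free_alg n)" for i j
      using k by (auto simp: N_def \<delta>_def intro!: free_alg_diff free_alg_mult free_alg_agen free_alg_uminus)
    show "phi_gen l (agen (n + 1) (i + 1)) = (\<Sum>j<n. agen (n + 1) (j + 1) * N j i)" if i: "i < n" for i
      using i k unfolding l N_def
      by (cases b; cases "i = d"; cases "i = Suc d")
        (simp_all add: phi_gen_agen right_diff_distrib sum_subtractf \<delta>)
  qed
qed

lemma phi_word_linear_left:
  assumes "u \<in> braid_words n"
  shows "\<exists>M. (\<forall>i j. M i j \<in> carrier (free_alg n)) \<and>
    (\<forall>i<n. phi_word u (agen (i + 1) (n + 1)) = (\<Sum>j<n. M i j * agen (j + 1) (n + 1)))"
  using assms
proof (induction u)
  case Nil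
  have "agen (i + 1) (n + 1) = (\<Sum>j<n. (if j = i then 1 else 0) * agen (j + 1) (n + 1))" if "i < n" for i
    by (rule sum_delta_nat(1)[OF that, of "\<lambda>j. agen (j + 1) (n + 1)", symmetric])
  moreover have "(if j = i then 1 else 0) \<in> carrier (free_alg n)" for i j :: nat by simp
  ultimately show ?case
    unfolding phi_word.simps by (intro exI[of _ "\<lambda>i j. if j = i then 1 else 0"]) blast
next
  case (Cons l u)
  then obtain M where M: "\<And>i j. M i j \<in> carrier (free_alg n)"
    "\<And>i. i < n \<Longrightarrow> phi_word u (agen (i + 1) (n + 1)) = (\<Sum>j<n. M i j * agen (j + 1) (n + 1))"
    by auto
  have l: "fst l \<in> {1..<n}" using Cons.prems by simp
  obtain N where N: "\<And>i j. N i j \<in> carrier (free_alg n)"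
    "\<And>i. i < n \<Longrightarrow> phi_gen l (agen (i + 1) (n + 1)) = (\<Sum>j<n. N i j * agen (j + 1) (n + 1))"
    by (rule phi_gen_linear_left[OF l]) (rule that; assumption)
  \<comment> \<open>The chain rule is twisted: the entries for the rest of the word are themselves
    transformed by the first letter.\<close>
  define L where "L = (\<lambda>i m. \<Sum>j<n. phi_gen l (M i j) * N j m)"
  have "phi_word (l # u) (agen (i + 1) (n + 1)) = (\<Sum>m<n. L i m * agen (m + 1) (n + 1))" if "i < n" for i
  proof -
    have "phi_word (l # u) (agen (i + 1) (n + 1)) =
        (\<Sum>j<n. \<Sum>m<n. phi_gen l (M i j) * N j m * agen (m + 1) (n + 1))"
      using M(2)[OF that] N(2) by (simp add: phi_gen_sum sum_distrib_left mult.assoc)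
    also have "\<dots> = (\<Sum>m<n. L i m * agen (m + 1) (n + 1))"
      by (subst sum.swap) (simp add: L_def sum_distrib_right)
    finally show ?thesis .
  qed
  moreover have "L i m \<in> carrier (free_alg n)" for i m
    unfolding L_def using M(1) N(1) l by (intro free_alg_sum free_alg_mult phi_gen_closed)
  ultimately show ?case by blast
qed

lemma phi_word_linear_right:
  assumes "u \<in> braid_words n"
  shows "\<exists>M. (\<forall>i j. M i j \<in> carrier (free_alg n)) \<and>
    (\<forall>i<n. phi_word u (agen (n + 1) (i + 1)) = (\<Sum>j<n. agen (n + 1) (j + 1) * M j i))"
  using assms
proof (induction u)
  case Nil
  have "agen (n + 1) (i + 1) = (\<Sum>j<n. agen (n + 1) (j + 1) * (if j = i then 1 else 0))" if "i < n" for i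
    by (rule sum_delta_nat(2)[OF that, of "\<lambda>j. agen (n + 1) (j + 1)", symmetric])
  moreover have "(if j = i then 1 else 0) \<in> carrier (free_alg n)" for i j :: nat by simp
  ultimately show ?case
    unfolding phi_word.simps by (intro exI[of _ "\<lambda>j i. if j = i then 1 else 0"]) blast
next
  case (Cons l u)
  then obtain M where M: "\<And>i j. M i j \<in> carrier (free_alg n)"
    "\<And>i. i < n \<Longrightarrow> phi_word u (agen (n + 1) (i + 1)) = (\<Sum>j<n. agen (n + 1) (j + 1) * M j i)"
    by auto
  have l: "fst l \<in> {1..<n}" using Cons.prems by simp
  obtain N where N: "\<And>i j. N i j \<in> carrier (free_alg n)"
    "\<And>i. i < n \<Longrightarrow> phi_gen l (agen (n + 1) (i + 1)) = (\<Sum>j<n. agen (n + 1) (j + 1) * N j i)"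
    by (rule phi_gen_linear_right[OF l]) (rule that; assumption)
  define L where "L = (\<lambda>m i. \<Sum>j<n. N m j * phi_gen l (M j i))"
  have "phi_word (l # u) (agen (n + 1) (i + 1)) = (\<Sum>m<n. agen (n + 1) (m + 1) * L m i)" if "i < n" for i
  proof -
    have "phi_word (l # u) (agen (n + 1) (i + 1)) =
        (\<Sum>j<n. \<Sum>m<n. agen (n + 1) (m + 1) * N m j * phi_gen l (M j i))"
      using M(2)[OF that] N(2) by (simp add: phi_gen_sum sum_distrib_right)
    also have "\<dots> = (\<Sum>m<n. agen (n + 1) (m + 1) * L m i)"
      by (subst sum.swap) (simp add: L_def sum_distrib_left mult.assoc)
    finally show ?thesis .
  qed
  moreover have "L m i \<in> carrier (free_alg n)" for i m
    unfolding L_def using M(1) N(1) l by (intro free_alg_sum free_alg_mult phi_gen_closed)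
  ultimately show ?case by blast
qed

lemma phi_star_class:
  assumes "u \<in> braid_words n" "x \<in> carrier (free_alg (n + 1))"
  shows "phi_star n (braid_class n u) x = phi_word u x"
  using assms braid_words_mono[of n "n + 1"]
  by (auto simp: phi_star_def braid_incl_class phi_class)

lemma PhiL_class:
  assumes "u \<in> braid_words n"
  defines "M \<equiv> PhiL n (braid_class n u)"
  shows "M \<in> carrier_mat n n" "elements_mat M \<subseteq> carrier (free_alg n)"
    "i < n \<Longrightarrow> phi_word u (agen (i + 1) (n + 1)) = (\<Sum>j<n. M $$ (i, j) * agen (j + 1) (n + 1))"
proof -
  let ?P = "\<lambda>M. M \<in> carrier_mat n n \<and> elements_mat M \<subseteq> carrier (free_alg n) \<and>
      (\<forall>i<n. phi_star n (braid_class n u) (agen (i + 1) (n + 1)) = (\<Sum>j<n. M $$ (i, j) * agen (j + 1) (n + 1)))"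
  have star: "phi_star n (braid_class n u) (agen (i + 1) (n + 1)) = phi_word u (agen (i + 1) (n + 1))"
    if "i < n" for i
    using that by (intro phi_star_class assms(1) free_alg_agen) auto
  obtain N where N: "\<And>i j. N i j \<in> carrier (free_alg n)"
    "\<And>i. i < n \<Longrightarrow> phi_word u (agen (i + 1) (n + 1)) = (\<Sum>j<n. N i j * agen (j + 1) (n + 1))"
    using phi_word_linear_left[OF assms(1)] by auto
  have ex: "?P (mat n n (\<lambda>(i, j). N i j))"
    using N star by (auto simp: elements_mat_def)
  have uniq: "M1 = M2" if "?P M1" "?P M2" for M1 M2
  proof (rule eq_matI)
    fix i j assume "i < dim_row M2" "j < dim_col M2"
    then have ij: "i < n" "j < n" using that by auto
    have "(\<Sum>j<n. M1 $$ (i, j) * agen (j + 1) (n + 1)) = (\<Sum>j<n. M2 $$ (i, j) * agen (j + 1) (n + 1))"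
      using conjunct2[OF conjunct2[OF that(1)]] conjunct2[OF conjunct2[OF that(2)]] ij by simp
    then have "Poly_Mapping.lookup (M1 $$ (i, j)) w = Poly_Mapping.lookup (M2 $$ (i, j)) w" for w
      using lookup_sum_agen_right[OF ij(2), of "\<lambda>j. M1 $$ (i, j)" w]
        lookup_sum_agen_right[OF ij(2), of "\<lambda>j. M2 $$ (i, j)" w] by simp
    then show "M1 $$ (i, j) = M2 $$ (i, j)" by (rule poly_mapping_eqI)
  qed (use that in auto)
  have "?P M" unfolding M_def PhiL_def by (rule theI[of ?P, OF ex]) (rule uniq[OF _ ex])
  then show "M \<in> carrier_mat n n" "elements_mat M \<subseteq> carrier (free_alg n)"
    "i < n \<Longrightarrow> phi_word u (agen (i + 1) (n + 1)) = (\<Sum>j<n. M $$ (i, j) * agen (j + 1) (n + 1))"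
    using star by auto
qed

lemma PhiR_class:
  assumes "u \<in> braid_words n"
  defines "M \<equiv> PhiR n (braid_class n u)"
  shows "M \<in> carrier_mat n n" "elements_mat M \<subseteq> carrier (free_alg n)"
    "i < n \<Longrightarrow> phi_word u (agen (n + 1) (i + 1)) = (\<Sum>j<n. agen (n + 1) (j + 1) * M $$ (j, i))"
proof -
  let ?P = "\<lambda>M. M \<in> carrier_mat n n \<and> elements_mat M \<subseteq> carrier (free_alg n) \<and>
      (\<forall>i<n. phi_star n (braid_class n u) (agen (n + 1) (i + 1)) = (\<Sum>j<n. agen (n + 1) (j + 1) * M $$ (j, i)))"
  have star: "phi_star n (braid_class n u) (agen (n + 1) (i + 1)) = phi_word u (agen (n + 1) (i + 1))"
    if "i < n" for i
    using that by (intro phi_star_class assms(1) free_alg_agen) auto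
  obtain N where N: "\<And>i j. N i j \<in> carrier (free_alg n)"
    "\<And>i. i < n \<Longrightarrow> phi_word u (agen (n + 1) (i + 1)) = (\<Sum>j<n. agen (n + 1) (j + 1) * N j i)"
    using phi_word_linear_right[OF assms(1)] by auto
  have ex: "?P (mat n n (\<lambda>(i, j). N i j))"
    using N star by (auto simp: elements_mat_def)
  have uniq: "M1 = M2" if "?P M1" "?P M2" for M1 M2
  proof (rule eq_matI)
    fix j i assume "j < dim_row M2" "i < dim_col M2"
    then have ij: "i < n" "j < n" using that by auto
    have "(\<Sum>j<n. agen (n + 1) (j + 1) * M1 $$ (j, i)) = (\<Sum>j<n. agen (n + 1) (j + 1) * M2 $$ (j, i))"
      using conjunct2[OF conjunct2[OF that(1)]] conjunct2[OF conjunct2[OF that(2)]] ij by simp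
    then have "Poly_Mapping.lookup (M1 $$ (j, i)) w = Poly_Mapping.lookup (M2 $$ (j, i)) w" for w
      using lookup_sum_agen_left[OF ij(2), of "\<lambda>j. M1 $$ (j, i)" w]
        lookup_sum_agen_left[OF ij(2), of "\<lambda>j. M2 $$ (j, i)" w] by simp
    then show "M1 $$ (j, i) = M2 $$ (j, i)" by (rule poly_mapping_eqI)
  qed (use that in auto)
  have "?P M" unfolding M_def PhiR_def by (rule theI[of ?P, OF ex]) (rule uniq[OF _ ex])
  then show "M \<in> carrier_mat n n" "elements_mat M \<subseteq> carrier (free_alg n)"
    "i < n \<Longrightarrow> phi_word u (agen (n + 1) (i + 1)) = (\<Sum>j<n. agen (n + 1) (j + 1) * M $$ (j, i))"
    using star by auto
qed

section \<open>Points of \<open>\<A>\<^sub>n\<close> as Gram matrices\<close>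

text \<open>A ring homomorphism from \<open>\<A>\<^sub>n\<close> to a commutative ring is recorded as a matrix of pairings
  \<open>a i j\<close> with diagonal entries \<open>2\<close>. With this choice of the diagonal, \<open>\<phi>\<close> of a generator
  becomes a simultaneous change of basis of rows and columns, without exceptional cases.\<close>

definition row_gen :: "nat \<times> bool \<Rightarrow> (nat \<Rightarrow> nat \<Rightarrow> 'a::comm_ring_1) \<Rightarrow> (nat \<Rightarrow> 'a) \<Rightarrow> nat \<Rightarrow> 'a" where
  "row_gen = (\<lambda>(k, b) a v.
    if b then v(k := v (Suc k) - a (Suc k) k * v k, Suc k := v k)
    else v(k := v (Suc k), Suc k := v k - a k (Suc k) * v (Suc k)))"

text \<open>Points take values in a commutative ring, so \<open>\<Phi>\<^sup>R\<close> at a point is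
  governed by the same row operations at the transposed point.\<close>

definition transposed :: "(nat \<Rightarrow> nat \<Rightarrow> 'a) \<Rightarrow> nat \<Rightarrow> nat \<Rightarrow> 'a" where
  "transposed a = (\<lambda>i j. a j i)"

definition point_gen :: "nat \<times> bool \<Rightarrow> (nat \<Rightarrow> nat \<Rightarrow> 'a::comm_ring_1) \<Rightarrow> nat \<Rightarrow> nat \<Rightarrow> 'a" where
  "point_gen l a = (\<lambda>i j. row_gen l a (\<lambda>i'. row_gen l (transposed a) (a i') j) i)"

definition gram :: "(nat \<Rightarrow> nat \<Rightarrow> 'a::comm_ring_1) \<Rightarrow> bool" where
  "gram a \<longleftrightarrow> (\<forall>i. a i i = 2)"

fun point_word :: "braid_word \<Rightarrow> (nat \<Rightarrow> nat \<Rightarrow> 'a::comm_ring_1) \<Rightarrow> nat \<Rightarrow> nat \<Rightarrow> 'a" where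
  "point_word [] a = a"
| "point_word (l # u) a = point_word u (point_gen l a)"

text \<open>The value of \<open>\<Phi>\<^sup>L\<close> at the point \<open>a\<close>, applied to the
  vector \<open>v\<close>. The point moves along with the vector, as the chain rule
  requires.\<close>

fun row_word :: "braid_word \<Rightarrow> (nat \<Rightarrow> nat \<Rightarrow> 'a::comm_ring_1) \<Rightarrow> (nat \<Rightarrow> 'a) \<Rightarrow> nat \<Rightarrow> 'a" where
  "row_word [] a v = v"
| "row_word (l # u) a v = row_word u (point_gen l a) (row_gen l a v)"

lemma row_gen_apply:
  "row_gen (k, True) a v i = (if i = k then v (Suc k) - a (Suc k) k * v k else if i = Suc k then v k else v i)"
  "row_gen (k, False) a v i = (if i = k then v (Suc k) else if i = Suc k then v k - a k (Suc k) * v (Suc k) else v i)"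
  by (simp_all add: row_gen_def)

lemma transposed_apply [simp]: "transposed a i j = a j i"
  by (simp add: transposed_def)

lemma point_gen_transposed: "point_gen l (transposed a) = transposed (point_gen l a)"
proof -
  obtain k b where l: "l = (k, b)" by (cases l)
  show ?thesis
    unfolding l point_gen_def transposed_def fun_eq_iff
    by (cases b) (auto simp: row_gen_apply algebra_simps)
qed

lemma point_word_transposed: "point_word u (transposed a) = transposed (point_word u a)"
  by (induction u arbitrary: a) (simp_all add: point_gen_transposed)

lemma gram_transposed [simp]: "gram (transposed a) \<longleftrightarrow> gram a"
  by (simp add: gram_def transposed_def)

text \<open>With diagonal value d and x, y the two entries between \<open>k\<close> and
  \<open>k + 1\<close>, the new diagonal entry is d - 2xy + dxy, and an entry x becomes x - dx. For
  d = 2 these are d and - x, the latter being the sign in the action on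
  \<open>a_{k,k+1}\<close>.\<close>

lemma gram_point_gen: "gram a \<Longrightarrow> gram (point_gen l a)"
  by (cases l; cases "snd l") (auto simp: gram_def point_gen_def row_gen_apply algebra_simps)

lemma point_gen_cancel:
  assumes "gram a"
  shows "point_gen (k, \<not> b) (point_gen (k, b) a) = a"
proof (intro ext)
  fix i j
  have d: "a x x = 2" for x using assms by (simp add: gram_def)
  have "i = k \<or> i = Suc k \<or> (i \<noteq> k \<and> i \<noteq> Suc k)" "j = k \<or> j = Suc k \<or> (j \<noteq> k \<and> j \<noteq> Suc k)"
    by auto
  then show "point_gen (k, \<not> b) (point_gen (k, b) a) i j = a i j"
    by (cases b; elim disjE conjE) (simp_all add: point_gen_def row_gen_apply d algebra_simps)
qed

lemma row_gen_cancel: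
  assumes "gram a"
  shows "row_gen (k, \<not> b) (point_gen (k, b) a) (row_gen (k, b) a v) = v"
proof (intro ext)
  fix i
  have d: "a x x = 2" for x using assms by (simp add: gram_def)
  show "row_gen (k, \<not> b) (point_gen (k, b) a) (row_gen (k, b) a v) i = v i"
    by (cases b) (auto simp: point_gen_def row_gen_apply d algebra_simps)
qed

lemma point_word_append: "point_word (u @ w) a = point_word w (point_word u a)"
  by (induction u arbitrary: a) simp_all

lemma row_word_append: "row_word (u @ w) a v = row_word w (point_word u a) (row_word u a v)"
  by (induction u arbitrary: a v) simp_all

lemma word_inv_word:
  assumes "gram a"
  shows "point_word (u @ inv_word u) a = a" "row_word (u @ inv_word u) a v = v"
proof -
  have "point_word (u @ inv_word u) a = a \<and> row_word (u @ inv_word u) a v = v"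
    using assms
  proof (induction u arbitrary: a v)
    case (Cons l u)
    obtain k b where l: "l = (k, b)" by (cases l)
    have "gram (point_gen l a)" using Cons.prems by (rule gram_point_gen)
    note IH = Cons.IH[OF this]
    show ?case
      using IH Cons.prems
      by (simp add: l inv_word_Cons point_word_append row_word_append point_gen_cancel row_gen_cancel)
  qed simp
  then show "point_word (u @ inv_word u) a = a" "row_word (u @ inv_word u) a v = v" by auto
qed

text \<open>The label \<open>e\<close> takes part in no crossing, so its column undergoes row
  operations only. For \<open>e = n + 1\<close> this is the extra strand that defines
  \<open>\<Phi>\<^sup>L\<close>.\<close>

lemma row_word_column:
  assumes "u \<in> braid_words n" "e \<notin> {1..n}"
  shows "point_word u a i e = row_word u a (\<lambda>j. a j e) i"
  using assms(1)
proof (induction u arbitrary: a)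
  case (Cons l u)
  obtain k b where l: "l = (k, b)" by (cases l)
  have "e \<noteq> k" "e \<noteq> Suc k" using Cons.prems assms(2) l by auto
  then have "(\<lambda>j. point_gen l a j e) = row_gen l a (\<lambda>j. a j e)"
    by (cases b) (auto simp: l point_gen_def row_gen_apply)
  then show ?case using Cons by simp
qed simp

lemma row_word_outside:
  "u \<in> braid_words n \<Longrightarrow> i \<notin> {1..n} \<Longrightarrow> row_word u a v i = v i"
proof (induction u arbitrary: a v)
  case (Cons l u)
  obtain k b where l: "l = (k, b)" by (cases l)
  show ?case using Cons by (cases b) (auto simp: l row_gen_apply)
qed simp

text \<open>Locality: crossings among the first \<open>n\<close> strands read nothing beyond them.
  It allows an extra column to be filled at will, and the satellite point to be replaced by its
  first block.\<close>

lemma row_word_cong: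
  assumes "u \<in> braid_words n"
    and "\<And>i j. i \<in> {1..n} \<Longrightarrow> j \<in> {1..n} \<Longrightarrow> a i j = a' i j"
    and "\<And>i. i \<in> {1..n} \<Longrightarrow> v i = v' i" and "i \<in> {1..n}"
  shows "row_word u a v i = row_word u a' v' i"
  using assms
proof (induction u arbitrary: a a' v v')
  case (Cons l u)
  obtain k b where l: "l = (k, b)" by (cases l)
  have k: "k \<in> {1..n}" "Suc k \<in> {1..n}" "u \<in> braid_words n" using Cons.prems(1) l by auto
  have "row_gen l a v i = row_gen l a' v' i" if "i \<in> {1..n}" for i
    using that k Cons.prems(2,3) by (cases b) (auto simp: l row_gen_apply)
  moreover have "point_gen l a i j = point_gen l a' i j" if "i \<in> {1..n}" "j \<in> {1..n}" for i j
    using that k Cons.prems(2) by (cases b) (auto simp: l point_gen_def row_gen_apply)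
  ultimately show ?case using Cons.IH[OF k(3), of "point_gen l a" "point_gen l a'"] Cons.prems(4) by simp
qed simp

text \<open>The bridge from the algebra to points: substituting after an automorphism is
  substituting at the moved point. Only letters with distinct indices have to be compared, and there
  the diagonal value 2 yields the required signs.\<close>

lemma falg_eval_phi_gen:
  assumes "gram a" "x \<in> carrier (free_alg n)"
  shows "falg_eval (\<lambda>(i, j). a i j) (phi_gen l x) = falg_eval (\<lambda>(i, j). point_gen l a i j) x"
proof -
  obtain k b where l: "l = (k, b)" by (cases l)
  have d: "a x x = 2" for x using assms by (simp add: gram_def)
  have gen: "falg_eval (\<lambda>(i, j). a i j) (phi_gen (k, True) (agen i j)) = point_gen (k, True) a i j \<and>
    falg_eval (\<lambda>(i, j). a i j) (phi_gen (k, False) (agen i j)) = point_gen (k, False) a i j"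
    if "(i, j) \<in> gens n" for i j
  proof -
    have "i = k \<or> i = Suc k \<or> (i \<noteq> k \<and> i \<noteq> Suc k)" "j = k \<or> j = Suc k \<or> (j \<noteq> k \<and> j \<noteq> Suc k)"
      by auto
    then show ?thesis
      using that by (elim disjE conjE) (simp_all add: phi_gen_agen point_gen_def row_gen_apply d algebra_simps)
  qed
  have "falg_eval (\<lambda>(i, j). a i j) (phi_gen l (agen i j)) = falg_eval (\<lambda>(i, j). point_gen l a i j) (agen i j)"
    if "(i, j) \<in> gens n" for i j
    using gen[OF that] by (cases b) (simp_all add: l)
  then show ?thesis
    by (intro falg_ext[of "\<lambda>x. falg_eval (\<lambda>(i, j). a i j) (phi_gen l x)"
          "falg_eval (\<lambda>(i, j). point_gen l a i j)", OF _ _ _ _ _ _ _ assms(2)]) simp_all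
qed

lemma falg_eval_phi_word:
  assumes "u \<in> braid_words n" "gram a" "x \<in> carrier (free_alg n)"
  shows "falg_eval (\<lambda>(i, j). a i j) (phi_word u x) = falg_eval (\<lambda>(i, j). point_word u a i j) x"
  using assms
proof (induction u arbitrary: a)
  case (Cons l u)
  then show ?case
    using falg_eval_phi_gen[OF Cons.prems(2) phi_word_closed[of u n x], of l]
    by (simp add: gram_point_gen)
qed simp

lemma row_word_PhiL:
  assumes u: "u \<in> braid_words n" and a: "gram a" and i: "i < n"
  shows "row_word u a v (i + 1) =
    (\<Sum>j<n. falg_eval (\<lambda>(i, j). a i j) (PhiL n (braid_class n u) $$ (i, j)) * v (j + 1))"
proof -
  \<comment> \<open>The arbitrary vector \<open>v\<close> is written into column
    \<open>n + 1\<close>, so that \<open>agen (j + 1) (n + 1)\<close> evaluates to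
    \<open>v (j + 1)\<close>. The corner entry is spared to keep the diagonal value 2.\<close>
  define a' where "a' = (\<lambda>i j. if j = n + 1 \<and> i \<noteq> n + 1 then v i else a i j)"
  let ?M = "PhiL n (braid_class n u)"
  have a': "gram a'" using a by (simp add: gram_def a'_def)
  have u': "u \<in> braid_words (n + 1)" using u braid_words_mono[of n "n + 1"] by auto
  have "row_word u a v (i + 1) = row_word u a' (\<lambda>j. a' j (n + 1)) (i + 1)"
    by (rule row_word_cong[OF u]) (use i in \<open>auto simp: a'_def\<close>)
  also have "\<dots> = point_word u a' (i + 1) (n + 1)"
    by (rule row_word_column[OF u, symmetric]) simp
  also have "\<dots> = falg_eval (\<lambda>(i, j). a' i j) (phi_word u (agen (i + 1) (n + 1)))"
    using i by (subst falg_eval_phi_word[OF u' a']) auto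
  also have "\<dots> = (\<Sum>j<n. falg_eval (\<lambda>(i, j). a' i j) (?M $$ (i, j)) * v (j + 1))"
    unfolding PhiL_class(3)[OF u i] by (simp add: falg_eval_sum a'_def)
  also have "\<dots> = (\<Sum>j<n. falg_eval (\<lambda>(i, j). a i j) (?M $$ (i, j)) * v (j + 1))"
  proof (intro sum.cong refl arg_cong2[where f = "(*)"] falg_eval_cong[of _ n])
    fix j assume "j \<in> {..<n}"
    then show "?M $$ (i, j) \<in> carrier (free_alg n)"
      using PhiL_class(1,2)[OF u] i by (force simp: elements_mat_def)
  qed (auto simp: a'_def gens_def)
  finally show ?thesis .
qed

lemma row_word_PhiR:
  assumes u: "u \<in> braid_words n" and a: "gram a" and i: "i < n"
  shows "row_word u (transposed a) v (i + 1) =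
    (\<Sum>j<n. v (j + 1) * falg_eval (\<lambda>(i, j). a i j) (PhiR n (braid_class n u) $$ (j, i)))"
proof -
  define a' where "a' = (\<lambda>i j. if i = n + 1 \<and> j \<noteq> n + 1 then v j else a i j)"
  let ?M = "PhiR n (braid_class n u)"
  have a': "gram a'" using a by (simp add: gram_def a'_def)
  have u': "u \<in> braid_words (n + 1)" using u braid_words_mono[of n "n + 1"] by auto
  have "row_word u (transposed a) v (i + 1) =
      row_word u (transposed a') (\<lambda>j. transposed a' j (n + 1)) (i + 1)"
    by (rule row_word_cong[OF u]) (use i in \<open>auto simp: a'_def\<close>)
  also have "\<dots> = point_word u (transposed a') (i + 1) (n + 1)"
    by (rule row_word_column[OF u, symmetric]) simp
  also have "\<dots> = falg_eval (\<lambda>(i, j). a' i j) (phi_word u (agen (n + 1) (i + 1)))"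
    using i by (subst falg_eval_phi_word[OF u' a']) (auto simp: point_word_transposed)
  also have "\<dots> = (\<Sum>j<n. v (j + 1) * falg_eval (\<lambda>(i, j). a' i j) (?M $$ (j, i)))"
    unfolding PhiR_class(3)[OF u i] by (simp add: falg_eval_sum a'_def)
  also have "\<dots> = (\<Sum>j<n. v (j + 1) * falg_eval (\<lambda>(i, j). a i j) (?M $$ (j, i)))"
  proof (intro sum.cong refl arg_cong2[where f = "(*)"] falg_eval_cong[of _ n])
    fix j assume "j \<in> {..<n}"
    then show "?M $$ (j, i) \<in> carrier (free_alg n)"
      using PhiR_class(1,2)[OF u] i by (force simp: elements_mat_def)
  qed (auto simp: a'_def gens_def)
  finally show ?thesis .
qed

subsection \<open>Rescaling\<close>

text \<open>Conjugation by a diagonal matrix; it keeps the diagonal entries and corresponds to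
  rescaling the basis vectors.\<close>

definition rescale :: "(nat \<Rightarrow> 'a::field) \<Rightarrow> (nat \<Rightarrow> nat \<Rightarrow> 'a) \<Rightarrow> nat \<Rightarrow> nat \<Rightarrow> 'a" where
  "rescale t a = (\<lambda>i j. t i * a i j / t j)"

fun word_perm :: "braid_word \<Rightarrow> nat \<Rightarrow> nat" where
  "word_perm [] = id"
| "word_perm (l # u) = Transposition.transpose (fst l) (Suc (fst l)) \<circ> word_perm u"

lemma row_gen_rescale:
  assumes "\<And>i. t i \<noteq> 0"
  shows "row_gen l (rescale t a) (\<lambda>i. t i * v i) =
    (\<lambda>i. t (Transposition.transpose (fst l) (Suc (fst l)) i) * row_gen l a v i)"
proof -
  obtain k b where l: "l = (k, b)" by (cases l)
  show ?thesis
    using assms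
    by (cases b) (auto simp: l fun_eq_iff row_gen_apply rescale_def Transposition.transpose_def field_simps)
qed

lemma point_gen_rescale:
  assumes "\<And>i. t i \<noteq> 0"
  shows "point_gen l (rescale t a) =
    rescale (t \<circ> Transposition.transpose (fst l) (Suc (fst l))) (point_gen l a)"
proof -
  let ?t = "t \<circ> Transposition.transpose (fst l) (Suc (fst l))"
  have col: "row_gen l (transposed (rescale t a)) (rescale t a i) =
      (\<lambda>j. t i * (row_gen l (transposed a) (a i) j / ?t j))" for i
  proof -
    have "transposed (rescale t a) = rescale (\<lambda>i. 1 / t i) (transposed a)"
      by (simp add: fun_eq_iff rescale_def)
    moreover have "rescale t a i = (\<lambda>j. 1 / t j * (t i * a i j))"
      by (simp add: fun_eq_iff rescale_def)
    moreover have "row_gen l (transposed a) (\<lambda>j. t i * a i j) = (\<lambda>j. t i * row_gen l (transposed a) (a i) j)"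
      by (cases l; cases "snd l") (auto simp: fun_eq_iff row_gen_apply algebra_simps)
    ultimately show ?thesis
      using row_gen_rescale[of "\<lambda>i. 1 / t i" l "transposed a" "\<lambda>j. t i * a i j"] assms by simp
  qed
  have "row_gen l (rescale t a) (\<lambda>i. t i * (row_gen l (transposed a) (a i) j / ?t j)) =
      (\<lambda>i. ?t i * (point_gen l a i j / ?t j))" for j
  proof -
    have "row_gen l a (\<lambda>i. row_gen l (transposed a) (a i) j / ?t j) = (\<lambda>i. point_gen l a i j / ?t j)"
      by (cases l; cases "snd l") (auto simp: fun_eq_iff point_gen_def row_gen_apply diff_divide_distrib add_divide_distrib algebra_simps)
    then show ?thesis using row_gen_rescale[OF assms, where v = "\<lambda>i. row_gen l (transposed a) (a i) j / ?t j"] by simp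
  qed
  then show ?thesis
    by (simp add: point_gen_def[of l "rescale t a"] col fun_eq_iff) (simp add: rescale_def)
qed

text \<open>The scaling factors travel with the strands through each crossing. At the right end
  \<open>i\<close> one finds the factor of the strand that started at
  \<open>word_perm u i\<close>.\<close>

lemma row_word_rescale:
  assumes "\<And>i. t i \<noteq> 0"
  shows "row_word u (rescale t a) (\<lambda>i. t i * v i) = (\<lambda>i. t (word_perm u i) * row_word u a v i)"
  using assms
proof (induction u arbitrary: t a v)
  case (Cons l u)
  let ?t = "t \<circ> Transposition.transpose (fst l) (Suc (fst l))"
  have "row_word u (rescale ?t (point_gen l a)) (\<lambda>i. ?t i * row_gen l a v i) =
      (\<lambda>i. ?t (word_perm u i) * row_word u (point_gen l a) (row_gen l a v) i)"
    by (rule Cons.IH) (simp add: Cons.prems)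
  then show ?case using Cons.prems by (simp add: row_gen_rescale point_gen_rescale)
qed simp

lemma transposed_rescale: "transposed (rescale t a) = rescale (\<lambda>i. 1 / t i) (transposed a)"
  by (simp add: fun_eq_iff rescale_def)

lemma gram_rescale: "gram a \<Longrightarrow> (\<And>i. t i \<noteq> 0) \<Longrightarrow> gram (rescale t a)"
  by (simp add: gram_def rescale_def)

lemma braid_perm_class:
  assumes "u \<in> braid_words n"
  shows "braid_perm n (braid_class n u) = word_perm u"
proof -
  let ?s = "\<lambda>i. Transposition.transpose i (Suc i) :: nat \<Rightarrow> nat"
  interpret group "sym_group n" by (rule sym_group_is_group)
  have closed: "?s i \<in> carrier (sym_group n)" if "i \<in> {1..<n}" for i
    using that by (auto simp: sym_group_carrier intro: permutes_swap_id)
  interpret braid_rep "sym_group n" n ?s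
    by standard (auto simp: closed sym_group_mult fun_eq_iff Transposition.transpose_def)
  have "inv\<^bsub>sym_group n\<^esub> (?s i) = ?s i" if "i \<in> {1..<n}" for i
    using that closed by (intro inv_equality) (auto simp: sym_group_mult sym_group_one)
  then have "word_val (sym_group n) ?s u = word_perm u"
    using assms by (induction u) (auto simp: sym_group_one sym_group_mult)
  then show ?thesis using braid_hom_class[OF assms] by (simp add: braid_perm_def)
qed

lemma word_perm_permutes: "u \<in> braid_words n \<Longrightarrow> word_perm u permutes {1..n}"
proof (induction u)
  case (Cons l u)
  then have "Transposition.transpose (fst l) (Suc (fst l)) permutes {1..n}"
    by (intro permutes_swap_id) auto
  with Cons show ?case unfolding word_perm.simps by (intro permutes_compose) auto
qed simp

section \<open>Points of satellites\<close>

text \<open>Separates strands from positions: a positive crossing leaves the vector of the over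
  strand alone, subtracts a multiple of it from that of the under strand, and then exchanges the two
  positions.\<close>

lemma row_gen_relabel:
  assumes "inj \<pi>"
  shows "row_gen (k, True) (\<lambda>i j. g (\<pi> i) (\<pi> j)) (\<lambda>i. v (\<pi> i)) =
    (\<lambda>i. (v(\<pi> (Suc k) := v (\<pi> (Suc k)) - g (\<pi> (Suc k)) (\<pi> k) * v (\<pi> k)))
      (\<pi> (Transposition.transpose k (Suc k) i)))"
  using assms by (auto simp: fun_eq_iff row_gen_apply Transposition.transpose_def inj_eq)

text \<open>The pairings of two cables about to cross: between under and over strands a multiple of
  the lower unitriangular part of \<open>B\<close>, between over and under strands a multiple of the
  upper one. Nothing is asked of the pairings with other strands.\<close>

locale block_crossing =
  fixes m p :: nat and g :: "nat \<Rightarrow> nat \<Rightarrow> 'a::comm_ring_1" and c c' :: 'a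
    and B :: "nat \<Rightarrow> nat \<Rightarrow> 'a"
  assumes lower: "\<And>r s. r < p \<Longrightarrow> s < p \<Longrightarrow>
      g (m + p + r) (m + s) = c * (if s < r then B r s else if r = s then 1 else 0)"
    and upper: "\<And>r s. r < p \<Longrightarrow> s < p \<Longrightarrow>
      g (m + s) (m + p + r) = c' * (if s < r then B s r else if r = s then 1 else 0)"
    and diag: "\<And>r s. r < p \<Longrightarrow> s < p \<Longrightarrow> g (m + r) (m + s) = B r s"
begin

text \<open>The over strands carry the labels \<open>m, \<dots>, m + p - 1\<close> and the under strands the labels
  \<open>m + p, \<dots>, m + 2p - 1\<close>. In the state \<open>(s, t)\<close> the over strands \<open>s + 1, \<dots>, p - 1\<close> have crossed
  all under strands, and the over strand \<open>s\<close> has crossed the first \<open>t\<close> of them.\<close>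

definition label :: "nat \<Rightarrow> nat \<Rightarrow> nat \<Rightarrow> nat" where
  "label s t i =
    (if i < m + s \<or> m + 2 * p \<le> i then i
     else if i < m + s + t then i + p - s
     else if i = m + s + t then m + s
     else if i \<le> m + s + p then i + p - Suc s
     else i - p)"

text \<open>Only a crossing of strands with equal index changes a basis vector: the pairing of the under
  strand \<open>r\<close> with the over strand \<open>s\<close> vanishes at the moment they cross unless \<open>r = s\<close>.\<close>

definition modified :: "nat \<Rightarrow> nat \<Rightarrow> 'a \<Rightarrow> (nat \<Rightarrow> 'a) \<Rightarrow> nat \<Rightarrow> 'a" where
  "modified s t x v = (\<lambda>l.
    if m + p + s < l \<and> l < m + 2 * p \<or> l = m + p + s \<and> s < t then v l - x * v (l - p) else v l)"

definition state :: "nat \<Rightarrow> nat \<Rightarrow> nat \<Rightarrow> nat \<Rightarrow> 'a" where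
  "state s t = (\<lambda>i j. modified s t c (\<lambda>i'. modified s t c' (g i') (label s t j)) (label s t i))"

definition row_state :: "nat \<Rightarrow> nat \<Rightarrow> (nat \<Rightarrow> 'a) \<Rightarrow> nat \<Rightarrow> 'a" where
  "row_state s t v = (\<lambda>i. modified s t c v (label s t i))"

lemma inj_label: "s < p \<Longrightarrow> t \<le> p \<Longrightarrow> inj (label s t)"
  by (rule injI) (auto simp: label_def split: if_splits)

lemma label_Suc:
  "s < p \<Longrightarrow> t < p \<Longrightarrow>
    label s t (Transposition.transpose (m + s + t) (Suc (m + s + t)) i) = label s (Suc t) i"
  by (auto simp: label_def Transposition.transpose_def)

lemma label_crossing:
  "s < p \<Longrightarrow> t < p \<Longrightarrow> label s t (m + s + t) = m + s"
  "s < p \<Longrightarrow> t < p \<Longrightarrow> label s t (Suc (m + s + t)) = m + p + t"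
  by (auto simp: label_def)

lemma modified_over: "s < p \<Longrightarrow> modified r t x v (m + s) = v (m + s)"
  by (simp add: modified_def)

lemma modified_under:
  "r < p \<Longrightarrow> modified s t x v (m + p + r) =
    (if s < r \<or> r = s \<and> s < t then v (m + p + r) - x * v (m + r) else v (m + p + r))"
  by (auto simp: modified_def)

text \<open>The over strands cross in decreasing order. When strand \<open>s\<close> meets the under
  strand \<open>t < s\<close>, the pairing is zero by triangularity. For \<open>t > s\<close>, the
  over strand \<open>t\<close> has crossed before, and the multiple of its vector subtracted then
  cancels \<open>c * B t s\<close>. Only \<open>t = s\<close> leaves the value
  \<open>c\<close>.\<close>

lemma state_crossing:
  assumes "s < p" "t < p"
  shows "modified s t c (\<lambda>i'. modified s t c' (g i') (m + s)) (m + p + t) = (if t = s then c else 0)"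
    and "modified s t c (\<lambda>i'. modified s t c' (g i') (m + p + t)) (m + s) = (if t = s then c' else 0)"
  using assms by (auto simp: modified_over modified_under lower upper diag)

lemma modified_Suc:
  assumes "s < p" "t < p"
  shows "(modified s t x v)(m + p + t := modified s t x v (m + p + t) -
      (if t = s then x else 0) * modified s t x v (m + s)) = modified s (Suc t) x v"
  using assms by (auto simp: fun_eq_iff modified_def)

lemma row_gen_state:
  assumes "s < p" "t < p"
  shows "row_gen (m + s + t, True) (state s t) (row_state s t v) = row_state s (Suc t) v"
  unfolding state_def row_state_def
  using assms
  by (subst row_gen_relabel[OF inj_label, of s t])
    (simp_all only: label_crossing state_crossing modified_Suc label_Suc less_imp_le)

end

text \<open>The hypotheses are symmetric under exchanging rows and columns, so the column half of
  \<open>point_gen\<close> is the row half of the transposed crossing.\<close>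

lemma (in block_crossing) block_crossing_transposed:
  "block_crossing m p (transposed g) c' c (\<lambda>r s. B s r)"
  by unfold_locales (auto simp: lower upper diag)

context block_crossing
begin

interpretation tr: block_crossing m p "transposed g" c' c "\<lambda>r s. B s r"
  by (rule block_crossing_transposed)

lemma modified_commute:
  "modified s t x (\<lambda>i. modified s' t' y (h i) j) i = modified s' t' y (\<lambda>j. modified s t x (\<lambda>i. h i j) i) j"
  by (auto simp: modified_def algebra_simps)

lemma tr_state: "tr.state s t = transposed (state s t)"
proof (intro ext)
  show "tr.state s t i j = transposed (state s t) i j" for i j
    unfolding state_def tr.state_def unfolding transposed_def by (rule modified_commute)
qed

lemma point_gen_state:
  assumes "s < p" "t < p"
  shows "point_gen (m + s + t, True) (state s t) = state s (Suc t)"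
proof (intro ext)
  fix i j
  have col: "row_gen (m + s + t, True) (transposed (state s t)) (state s t i') j =
      modified s t c (\<lambda>i'. modified s (Suc t) c' (g i') (label s (Suc t) j)) (label s t i')" for i'
  proof -
    \<comment> \<open>Row and column modifications commute, so a row of the current point is a
      \<open>row_state\<close> of the transposed crossing, with the row modification already
      absorbed in \<open>v\<close>.\<close>
    define v where "v = (\<lambda>j. modified s t c (\<lambda>i'. g i' j) (label s t i'))"
    have 1: "state s t i' = tr.row_state s t v"
      unfolding state_def tr.row_state_def v_def by (intro ext, rule modified_commute)
    have "row_gen (m + s + t, True) (transposed (state s t)) (state s t i') = tr.row_state s (Suc t) v"
      unfolding 1 tr_state[symmetric] by (rule tr.row_gen_state[OF assms])
    then show ?thesis
      by (simp only: tr.row_state_def v_def) (rule modified_commute[symmetric])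
  qed
  have "point_gen (m + s + t, True) (state s t) i j =
      row_gen (m + s + t, True) (state s t)
        (row_state s t (\<lambda>i'. modified s (Suc t) c' (g i') (label s (Suc t) j))) i"
    by (simp add: point_gen_def col row_state_def)
  then show "point_gen (m + s + t, True) (state s t) i j = state s (Suc t) i j"
    by (simp only: row_gen_state[OF assms]) (simp add: row_state_def state_def)
qed

lemma word_state:
  assumes "s < p" "t \<le> p"
  shows "point_word (pos_word [m + s..<m + s + t]) (state s 0) = state s t"
    and "row_word (pos_word [m + s..<m + s + t]) (state s 0) (row_state s 0 v) = row_state s t v"
proof -
  have "point_word (pos_word [m + s..<m + s + t]) (state s 0) = state s t \<and>
      row_word (pos_word [m + s..<m + s + t]) (state s 0) (row_state s 0 v) = row_state s t v"
    using assms(2)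
  proof (induction t)
    case (Suc t)
    then show ?case
      using assms(1) by (simp add: point_word_append row_word_append point_gen_state row_gen_state)
  qed simp
  then show "point_word (pos_word [m + s..<m + s + t]) (state s 0) = state s t"
    "row_word (pos_word [m + s..<m + s + t]) (state s 0) (row_state s 0 v) = row_state s t v" by auto
qed

lemma state_next:
  assumes "Suc s < p"
  shows "state (Suc s) p = state s 0" "row_state (Suc s) p v = row_state s 0 v"
proof -
  have "label (Suc s) p i = label s 0 i" for i using assms by (auto simp: label_def)
  moreover have "modified (Suc s) p x w = modified s 0 x w" for x w
    using assms by (auto simp: modified_def fun_eq_iff)
  ultimately show "state (Suc s) p = state s 0" "row_state (Suc s) p v = row_state s 0 v"
    by (simp_all add: state_def row_state_def)
qed

lemma word_crossing_state:
  assumes "a < p"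
  shows "point_word (pos_word (crossing_word (Suc a) p m)) (state a 0) = state 0 p"
    and "row_word (pos_word (crossing_word (Suc a) p m)) (state a 0) (row_state a 0 v) = row_state 0 p v"
proof -
  have "point_word (pos_word (crossing_word (Suc a) p m)) (state a 0) = state 0 p \<and>
      row_word (pos_word (crossing_word (Suc a) p m)) (state a 0) (row_state a 0 v) = row_state 0 p v"
    using assms
  proof (induction a)
    case 0
    then show ?case using word_state(1)[of 0 p] word_state(2)[of 0 p v] by (simp add: crossing_word_Suc)
  next
    case (Suc a)
    then show ?case
      using word_state(1)[of "Suc a" p] word_state(2)[of "Suc a" p v]
      by (simp add: crossing_word_Suc[of "Suc a"] point_word_append row_word_append state_next)
  qed
  then show "point_word (pos_word (crossing_word (Suc a) p m)) (state a 0) = state 0 p"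
    "row_word (pos_word (crossing_word (Suc a) p m)) (state a 0) (row_state a 0 v) = row_state 0 p v"
    by auto
qed

definition block_row :: "'a \<Rightarrow> (nat \<Rightarrow> 'a) \<Rightarrow> nat \<Rightarrow> 'a" where
  "block_row x v = (\<lambda>i. if m \<le> i \<and> i < m + p then v (i + p) - x * v i
    else if m + p \<le> i \<and> i < m + 2 * p then v (i - p) else v i)"

text \<open>Each under strand is changed exactly once, by its partner of equal index. The crossing
  of two cables is thus a single crossing with scalar coefficient, repeated for every index; no
  entry of \<open>B\<close> appears in the row operation.\<close>

lemma word_crossing:
  shows "point_word (pos_word (crossing_word p p m)) g = (\<lambda>i j. block_row c (\<lambda>i'. block_row c' (g i') j) i)"
    and "row_word (pos_word (crossing_word p p m)) g v = block_row c v"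
proof -
  have "point_word (pos_word (crossing_word p p m)) g = (\<lambda>i j. block_row c (\<lambda>i'. block_row c' (g i') j) i) \<and>
    row_word (pos_word (crossing_word p p m)) g v = block_row c v"
  proof (cases p)
    case 0
    then show ?thesis unfolding block_row_def by (auto simp: fun_eq_iff)
  next
    case (Suc a)
    then have a: "a < p" and p: "Suc a = p" by auto
    \<comment> \<open>With \<open>a = p - 1\<close> no strand has crossed yet, so the initial state
      is \<open>g\<close> itself.\<close>
    have 1: "label a 0 i = i" for i unfolding label_def using Suc by auto
    have 2: "modified a 0 x w = w" for x w unfolding modified_def using Suc by (auto simp: fun_eq_iff)
    have 3: "modified 0 p x w (label 0 p i) = block_row x w i" for x w i
    proof -
      consider "i < m" | "m \<le> i" "i < m + p" | "m + p \<le> i" "i < m + 2 * p" | "m + 2 * p \<le> i"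
        by linarith
      then show ?thesis
        unfolding modified_def label_def block_row_def using a by cases auto
    qed
    have "point_word (pos_word (crossing_word p p m)) (state a 0) = state 0 p"
      "row_word (pos_word (crossing_word p p m)) (state a 0) (row_state a 0 v) = row_state 0 p v"
      using word_crossing_state[OF a] by (simp_all only: p)
    then show ?thesis by (simp add: state_def row_state_def 1 2 3)
  qed
  then show "point_word (pos_word (crossing_word p p m)) g = (\<lambda>i j. block_row c (\<lambda>i'. block_row c' (g i') j) i)"
    "row_word (pos_word (crossing_word p p m)) g v = block_row c v" by auto
qed

end


section \<open>Coordinates of strands within cables\<close>

definition block :: "nat \<Rightarrow> nat \<Rightarrow> nat" where
  "block p i = (i + p - 1) div p"

definition offset :: "nat \<Rightarrow> nat \<Rightarrow> nat" where
  "offset p i = (i + p - 1) mod p"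

definition position :: "nat \<Rightarrow> nat \<Rightarrow> nat \<Rightarrow> nat" where
  "position p q r = q * p + r + 1 - p"

text \<open>Strands and blocks are counted from 1, offsets from 0, so block 1 is
  \<open>{1..p}\<close>. The index 0 is no strand, but points are functions on all naturals; it
  becomes the only member of block 0, with offset \<open>p - 1\<close>.\<close>

lemma block_position:
  assumes "r < p" "1 \<le> q \<or> q = 0 \<and> r = p - 1"
  shows "block p (position p q r) = q" "offset p (position p q r) = r"
proof -
  have "position p q r + p - 1 = q * p + r"
    using assms by (cases q) (auto simp: position_def)
  then show "block p (position p q r) = q" "offset p (position p q r) = r"
    using assms(1) by (simp_all add: block_def offset_def)
qed

lemma position_block:
  assumes "1 \<le> p"
  shows "position p (block p i) (offset p i) = i"
proof -
  have "block p i * p + offset p i = i + p - 1" by (simp add: block_def offset_def)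
  then show ?thesis using assms by (simp add: position_def)
qed

lemma offset_less: "1 \<le> p \<Longrightarrow> offset p i < p"
  by (simp add: offset_def)

lemma block_0: "1 \<le> p \<Longrightarrow> block p i = 0 \<Longrightarrow> i = 0 \<and> offset p i = p - 1"
  by (auto simp: block_def offset_def div_eq_0_iff)

text \<open>The strands of the \<open>q\<close>-th cable carry copies of the point \<open>b\<close> of the pattern. Between
  different cables the pairings of the companion are multiplied by the unitriangular parts of \<open>b\<close>.\<close>

definition satellite_point :: "nat \<Rightarrow> (nat \<Rightarrow> nat \<Rightarrow> 'a) \<Rightarrow> (nat \<Rightarrow> nat \<Rightarrow> 'a) \<Rightarrow> nat \<Rightarrow> nat \<Rightarrow> 'a::comm_ring_1"
  where
  "satellite_point p a b i j =
    (let q = block p i; q' = block p j; r = offset p i + 1; r' = offset p j + 1 in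
     if q = q' then b r r'
     else if q < q' then a q q' * (if r < r' then b r r' else if r = r' then 1 else 0)
     else a q q' * (if r' < r then b r r' else if r = r' then 1 else 0))"

lemma satellite_point_transposed:
  "transposed (satellite_point p a b) = satellite_point p (transposed a) (transposed b)"
  by (auto simp: fun_eq_iff satellite_point_def Let_def)

lemma gram_satellite_point: "gram b \<Longrightarrow> gram (satellite_point p a b)"
  by (simp add: gram_def satellite_point_def)

text \<open>The cable of a generator acts on block rows and block columns through the scalars of
  \<open>a\<close> alone. For fixed offsets the claim on points becomes the computation of
  \<open>point_gen\<close> on \<open>a\<close>, with the diagonal value 2 split into the entries of
  the two triangular parts.\<close>

lemma row_word_cable_gen:
  assumes i: "1 \<le> i" and p: "1 \<le> p" and a: "gram a" and b: "gram b"
  shows "point_word (pos_word (cable_gen p i)) (satellite_point p a b) =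
      satellite_point p (point_gen (i, True) a) b" (is ?point)
    and "row_word (pos_word (cable_gen p i)) (satellite_point p a b) v =
      (\<lambda>x. row_gen (i, True) a (\<lambda>q. v (position p q (offset p x))) (block p x))" (is "?row v")
proof -
  define m where "m = (i - 1) * p + 1"
  have pos: "m + r = position p i r" "m + p + r = position p (Suc i) r" for r
    using i by (cases i; auto simp: m_def position_def algebra_simps)+
  have bl: "block p (m + r) = i" "offset p (m + r) = r"
    "block p (m + p + r) = Suc i" "offset p (m + p + r) = r" if "r < p" for r
    using block_position[OF that disjI1[OF i]] block_position[OF that, of "Suc i"]
    unfolding pos(1)[symmetric] pos(2)[symmetric] by simp_all
  interpret block_crossing m p "satellite_point p a b" "a (Suc i) i" "a i (Suc i)"
    "\<lambda>r s. b (r + 1) (s + 1)"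
    using b by unfold_locales (auto simp: satellite_point_def Let_def bl gram_def)
  have br: "block_row x v y = (let q = block p y; r = offset p y in
      if q = i then v (position p (Suc i) r) - x * v (position p i r)
      else if q = Suc i then v (position p i r) else v y)" for x v y
  proof -
    define q where "q = block p y"
    define r where "r = offset p y"
    have r: "r < p" using offset_less[OF p] by (simp add: r_def)
    have y: "y = position p q r" using position_block[OF p] by (simp add: q_def r_def)
    show ?thesis
    proof (cases "q = 0")
      case True
      then have "y = 0" using block_0[OF p] by (simp add: q_def)
      then have "y < m" by (simp add: m_def)
      then show ?thesis
        unfolding block_row_def Let_def q_def[symmetric] using True i by simp
    next
      case False
      have ip: "i * p = (i - 1) * p + p" using i by (cases i) auto
      have y': "y + p = q * p + r + 1" using False by (cases q) (auto simp: y position_def)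
      consider "q < i" | "q = i" | "q = Suc i" | "Suc i < q" by linarith
      then show ?thesis
      proof cases
        case 1
        then have "q * p + p \<le> i * p" using mult_le_mono1[of "q + 1" i p] by simp
        then have "y < m" using y' r ip unfolding m_def by linarith
        then show ?thesis unfolding block_row_def Let_def q_def[symmetric] using 1 by simp
      next
        case 2
        then have "y = m + r" by (simp add: y pos)
        then show ?thesis
          unfolding block_row_def Let_def q_def[symmetric] r_def[symmetric] pos[symmetric]
          using 2 r by (simp add: ac_simps)
      next
        case 3
        then have "y = m + p + r" using y pos(2)[of r] by simp
        then show ?thesis
          unfolding block_row_def Let_def q_def[symmetric] r_def[symmetric] pos[symmetric]
          using 3 r by simp
      next
        case 4
        then have "i * p + 2 * p \<le> q * p" using mult_le_mono1[of "i + 2" q p] by (simp add: distrib_right)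
        then have "m + 2 * p \<le> y" using y' ip unfolding m_def by linarith
        then show ?thesis unfolding block_row_def Let_def q_def[symmetric] using 4 p by simp
      qed
    qed
  qed
  have row: "block_row (a' (Suc i) i) v y =
      row_gen (i, True) a' (\<lambda>q. v (position p q (offset p y))) (block p y)" for a' v y
    using position_block[OF p, of y] by (auto simp: br row_gen_apply Let_def)
  show "?row v" for v
    using word_crossing(2)[of v] row[of a] unfolding cable_gen_def m_def[symmetric] by auto
  have "block_row (a (Suc i) i) (\<lambda>x. block_row (a i (Suc i)) (satellite_point p a b x) y) x =
      satellite_point p (point_gen (i, True) a) b x y" for x y
  proof -
    define q q' r r' where "q = block p x" and "q' = block p y" and "r = offset p x" and "r' = offset p y"
    note d = this
    define U where "U = (if r + 1 < r' + 1 then b (r + 1) (r' + 1) else if r + 1 = r' + 1 then 1 else 0)"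
    define L where "L = (if r' + 1 < r + 1 then b (r + 1) (r' + 1) else if r + 1 = r' + 1 then 1 else 0)"
    have b2: "b z z = 2" "a z z = 2" for z using a b by (simp_all add: gram_def)
    \<comment> \<open>For equal offsets both parts contribute 1, matching the diagonal value 2 of
      \<open>b\<close>; otherwise exactly one of them is the entry of \<open>b\<close> and the other
      is 0.\<close>
    have UL: "b (r + 1) (r' + 1) = U + L" by (auto simp: U_def L_def b2)
    define F where "F = (\<lambda>a (q :: nat) q'. if q = q' then U + L else if q < q' then a q q' * U else a q q' * L)"
    have F: "satellite_point p a b z w = F a (block p z) (block p w)"
      if "offset p z = r" "offset p w = r'" for a z w
      unfolding satellite_point_def Let_def that
      unfolding U_def[symmetric] L_def[symmetric] unfolding UL F_def by simp
    have ofs: "r < p" "r' < p" using offset_less[OF p] by (simp_all add: d)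
    note bp = block_position[OF ofs(1), of i] block_position[OF ofs(1), of "Suc i"]
      block_position[OF ofs(2), of i] block_position[OF ofs(2), of "Suc i"]
    have "block_row (a i (Suc i)) (satellite_point p a b z) y =
      (if q' = i then F a (block p z) (Suc i) - a i (Suc i) * F a (block p z) i
       else if q' = Suc i then F a (block p z) i else F a (block p z) q')" if "offset p z = r" for z
      using that bp i by (simp add: br F d[symmetric])
    then have "block_row (a (Suc i) i) (\<lambda>x. block_row (a i (Suc i)) (satellite_point p a b x) y) x =
      (let G = \<lambda>q. if q' = i then F a q (Suc i) - a i (Suc i) * F a q i
       else if q' = Suc i then F a q i else F a q q' in
       if q = i then G (Suc i) - a (Suc i) i * G i else if q = Suc i then G i else G q)"
      using bp i by (simp add: br d[symmetric])
    also have "\<dots> = satellite_point p (point_gen (i, True) a) b x y"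
    proof -
      have "q < i \<or> q = i \<or> q = Suc i \<or> Suc i < q" "q' < i \<or> q' = i \<or> q' = Suc i \<or> Suc i < q'"
        by auto
      then show ?thesis
        unfolding F[OF d(3)[symmetric] d(4)[symmetric]] d(1,2)[symmetric] F_def Let_def
        by (elim disjE) (simp_all add: point_gen_def row_gen_apply b2 algebra_simps)
    qed
    finally show ?thesis .
  qed
  then show ?point
    using word_crossing(1) unfolding cable_gen_def m_def[symmetric] by auto
qed

lemma row_gen_cong:
  assumes "v i = v' i" "v (fst l) = v' (fst l)" "v (Suc (fst l)) = v' (Suc (fst l))"
  shows "row_gen l a v i = row_gen l a v' i"
  using assms by (cases l; cases "snd l") (auto simp: row_gen_apply)

text \<open>Negative letters follow from positive ones: the positive cable carries the candidate
  point and vector to the given ones, and the inverse word brings them back.\<close>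

lemma row_word_cable_letter:
  assumes i: "1 \<le> fst l" and p: "1 \<le> p" and a: "gram a" and b: "gram b"
  shows "point_word (cable_letter p l) (satellite_point p a b) = satellite_point p (point_gen l a) b"
    and "row_word (cable_letter p l) (satellite_point p a b) v =
      (\<lambda>x. row_gen l a (\<lambda>q. v (position p q (offset p x))) (block p x))"
proof -
  obtain i s where l: "l = (i, s)" by (cases l)
  have i: "1 \<le> i" using assms(1) l by simp
  let ?w = "pos_word (cable_gen p i)"
  define a' where "a' = point_gen (i, False) a"
  have a': "point_gen (i, True) a' = a"
    using point_gen_cancel[OF a, of i False] by (simp add: a'_def)
  have ga': "gram a'" using gram_point_gen[OF a] by (simp add: a'_def)
  have w: "point_word ?w (satellite_point p a' b) = satellite_point p a b"
    using row_word_cable_gen(1)[OF i p ga' b] a' by simp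
  have inv: "point_word (inv_word ?w) (satellite_point p a b) = satellite_point p a' b"
    using word_inv_word(1)[OF gram_satellite_point[OF b], of ?w p a'] w by (simp add: point_word_append)
  define V where "V = (\<lambda>x. row_gen (i, False) a (\<lambda>q. v (position p q (offset p x))) (block p x))"
  have "row_word ?w (satellite_point p a' b) V = v"
  proof
    fix x
    let ?r = "offset p x" and ?q = "block p x"
    have r: "?r < p" by (rule offset_less[OF p])
    \<comment> \<open>Block 0 contains only offset \<open>p - 1\<close>, hence the restriction on
      \<open>q\<close>. It suffices, since a row operation reads only the entry at its own index and
      those at \<open>i\<close> and \<open>i + 1\<close>.\<close>
    have V: "V (position p q ?r) = row_gen (i, False) a (\<lambda>q. v (position p q ?r)) q"
      if "1 \<le> q \<or> q = ?q" for q
    proof -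
      have "1 \<le> q \<or> q = 0 \<and> ?r = p - 1" using that block_0[OF p, of x] by auto
      then show ?thesis using block_position[OF r] by (simp add: V_def)
    qed
    have "row_word ?w (satellite_point p a' b) V x =
        row_gen (i, True) a' (\<lambda>q. V (position p q ?r)) ?q"
      using row_word_cable_gen(2)[OF i p ga' b, of V] by simp
    also have "\<dots> = row_gen (i, True) a' (row_gen (i, False) a (\<lambda>q. v (position p q ?r))) ?q"
      using i by (intro row_gen_cong V) auto
    also have "\<dots> = v (position p ?q ?r)"
      using row_gen_cancel[OF a, of i False "\<lambda>q. v (position p q ?r)"] by (simp add: a'_def)
    finally show "row_word ?w (satellite_point p a' b) V x = v x" by (simp add: position_block[OF p])
  qed
  then have inv_row: "row_word (inv_word ?w) (satellite_point p a b) v = V"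
    using word_inv_word(2)[OF gram_satellite_point[OF b], of ?w p a' V] w
    by (simp add: row_word_append)
  show "point_word (cable_letter p l) (satellite_point p a b) = satellite_point p (point_gen l a) b"
    using row_word_cable_gen(1)[OF i p a b] inv by (simp add: l cable_letter_def a'_def)
  show "row_word (cable_letter p l) (satellite_point p a b) v =
      (\<lambda>x. row_gen l a (\<lambda>q. v (position p q (offset p x))) (block p x))"
    using row_word_cable_gen(2)[OF i p a b, of v] inv_row by (simp add: l cable_letter_def V_def)
qed

lemma row_word_cable_word:
  assumes "u \<in> braid_words k" "1 \<le> p" "gram a" "gram b"
  shows "point_word (cable_word p u) (satellite_point p a b) = satellite_point p (point_word u a) b"
    and "1 \<le> x \<Longrightarrow> row_word (cable_word p u) (satellite_point p a b) v x =
      row_word u a (\<lambda>q. v (position p q (offset p x))) (block p x)"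
proof -
  have "point_word (cable_word p u) (satellite_point p a b) = satellite_point p (point_word u a) b \<and>
    (1 \<le> x \<longrightarrow> row_word (cable_word p u) (satellite_point p a b) v x =
      row_word u a (\<lambda>q. v (position p q (offset p x))) (block p x))"
    using assms(1,3)
  proof (induction u arbitrary: a v)
    case Nil
    then show ?case by (simp add: position_block[OF assms(2)])
  next
    case (Cons l u)
    have l: "1 \<le> fst l" and u: "u \<in> braid_words k" using Cons.prems by auto
    note step = row_word_cable_letter[OF l assms(2) Cons.prems(2) assms(4)]
    note IH = Cons.IH[OF u gram_point_gen[OF Cons.prems(2), of l]]
    show ?case
    proof (intro conjI impI)
      show "point_word (cable_word p (l # u)) (satellite_point p a b) =
          satellite_point p (point_word (l # u) a) b"
        using IH by (simp add: point_word_append step(1))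
    next
      assume x: "1 \<le> x"
      let ?r = "offset p x" and ?q = "block p x"
      let ?V = "\<lambda>x. row_gen l a (\<lambda>q. v (position p q (offset p x))) (block p x)"
      have r: "?r < p" by (rule offset_less[OF assms(2)])
      have q: "1 \<le> ?q" using block_0[OF assms(2), of x] x by (cases "?q = 0") auto
      have "row_word (cable_word p (l # u)) (satellite_point p a b) v x =
          row_word u (point_gen l a) (\<lambda>q. ?V (position p q ?r)) ?q"
        using IH x by (simp add: row_word_append step)
      also have "\<dots> = row_word u (point_gen l a) (row_gen l a (\<lambda>q. v (position p q ?r))) ?q"
      \<comment> \<open>The two vectors agree on positive blocks, which is all that rows up to
        \<open>k\<close> can see; later rows are untouched by \<open>u\<close>.\<close>
      proof (cases "?q \<le> k")
        case True
        show ?thesis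
          by (rule row_word_cong[OF u]) (use block_position[OF r] True q in auto)
      next
        case False
        then show ?thesis
          using q by (simp add: row_word_outside[OF u] block_position[OF r])
      qed
      finally show "row_word (cable_word p (l # u)) (satellite_point p a b) v x =
          row_word (l # u) a (\<lambda>q. v (position p q ?r)) ?q" by simp
    qed
  qed
  then show "point_word (cable_word p u) (satellite_point p a b) = satellite_point p (point_word u a) b"
    "1 \<le> x \<Longrightarrow> row_word (cable_word p u) (satellite_point p a b) v x =
      row_word u a (\<lambda>q. v (position p q (offset p x))) (block p x)" by auto
qed

section \<open>Augmentations of maximal rank\<close>

definition monomial_val :: "complex \<Rightarrow> complex \<Rightarrow> int \<times> int \<Rightarrow> complex" where
  "monomial_val l m = (\<lambda>(d, e). l powi d * m powi e)"

text \<open>Evaluation is nested: Laurent polynomials at \<open>l\<close> and \<open>m\<close>, then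
  words in the letters at \<open>g\<close>. Nonzero \<open>l\<close> and \<open>m\<close> are what
  make integer powers additive in the exponent.\<close>

locale aug_data =
  fixes l m :: complex and g :: "nat \<times> nat \<Rightarrow> complex"
  assumes l: "l \<noteq> 0" and m: "m \<noteq> 0"
begin

sublocale laurent: pm_evaluation "of_int :: int \<Rightarrow> complex" "monomial_val l m"
  by unfold_locales
    (auto simp: monomial_val_def zero_prod_def power_int_add l m split: prod.splits)

sublocale aug: pm_evaluation "pm_eval of_int (monomial_val l m)" "word_chi g"
  by unfold_locales (simp_all add: laurent.eval_add laurent.eval_mult laurent.eval_one word_chi_simps)

definition aug_hom :: "laurent falg \<Rightarrow> complex" where
  "aug_hom = pm_eval (pm_eval of_int (monomial_val l m)) (word_chi g)"

lemma aug_hom_hom: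
  "aug_hom (x + y) = aug_hom x + aug_hom y" "aug_hom (x * y) = aug_hom x * aug_hom y"
  "aug_hom 1 = 1" "aug_hom 0 = 0" "aug_hom (- x) = - aug_hom x" "aug_hom (x - y) = aug_hom x - aug_hom y"
  by (simp_all add: aug_hom_def aug.eval_add aug.eval_mult aug.eval_one aug.eval_uminus aug.eval_diff)

lemma aug_hom_agen: "aug_hom (agen i j) = g (i, j)"
  by (simp add: aug_hom_def agen_def aug.eval_single laurent.eval_one word_chi_simps)

lemma aug_hom_lambda_mu: "aug_hom (lambda_mu d e) = l powi d * m powi e"
  using aug.eval_single[of 0 "Poly_Mapping.single (d, e) 1"] laurent.eval_single[of "(d, e)" 1]
  by (simp add: aug_hom_def lambda_mu_def word_chi_simps monomial_val_def)

lemma aug_hom_ring_hom: "aug_hom \<in> Ring.ring_hom (free_alg n) class_ring"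
  by (simp add: Ring.ring_hom_def aug_hom_hom)

end

text \<open>Seen as a substitution of letters, the base change inherits the ring homomorphism
  laws.\<close>

lemma base_change_eq: "base_change = falg_eval (\<lambda>(i, j). agen i j)"
proof
  fix x
  have "falg_eval (\<lambda>(i, j). agen i j) x =
      (\<Sum>w\<in>Poly_Mapping.keys x. Poly_Mapping.single w (of_int (Poly_Mapping.lookup x w) :: laurent))"
    by (simp add: falg_eval_def single_Fmon)
  then show "base_change x = falg_eval (\<lambda>(i, j). agen i j) x"
    by (intro poly_mapping_eqI)
      (auto simp: base_change_def Poly_Mapping.map.rep_eq lookup_sum lookup_single when_def in_keys_iff)
qed

lemma base_change_closed: "x \<in> carrier (free_alg n) \<Longrightarrow> base_change x \<in> carrier (free_alg n)"
  unfolding base_change_eq by (erule falg_eval_closed) (auto simp: gens_def)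

lemma lambda_mu_closed [simp]: "lambda_mu d e \<in> carrier (free_alg n)"
  by (simp add: lambda_mu_def free_alg_carrier zero_fmon_def)

lemma lambda_mu_mult: "lambda_mu d e * lambda_mu d' e' = lambda_mu (d + d') (e + e')"
  by (simp add: lambda_mu_def mult_single)

lemma lambda_mu_0: "lambda_mu 0 0 = 1"
  by (simp add: lambda_mu_def zero_prod_def[symmetric])

lemma A_mat_carrier [simp]: "A_mat n \<in> carrier_mat n n"
  by (simp add: A_mat_def)

lemma A_mat_closed: "i < n \<Longrightarrow> j < n \<Longrightarrow> A_mat n $$ (i, j) \<in> carrier (free_alg n)"
  by (auto simp: A_mat_def intro!: free_alg_mult free_alg_uminus free_alg_diff free_alg_agen)

lemma entry_left:
  assumes u: "u \<in> braid_words n" and ij: "i < n" "j < n"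
  defines "\<beta> \<equiv> braid_class n u"
  shows "(A_mat n - Lambda_mat n \<beta> * map_mat base_change (PhiL n \<beta>) * A_mat n) $$ (i, j) =
      A_mat n $$ (i, j) - (\<Sum>k<n. (if i = 0 then lambda_mu 1 (writhe n \<beta>) else 1) *
        base_change (PhiL n \<beta> $$ (i, k)) * A_mat n $$ (k, j))" (is ?eq)
    and "k < n \<Longrightarrow> PhiL n \<beta> $$ (i, k) \<in> carrier (free_alg n)"
    and "(A_mat n - Lambda_mat n \<beta> * map_mat base_change (PhiL n \<beta>) * A_mat n) $$ (i, j)
      \<in> carrier (free_alg n)"
proof -
  let ?M = "PhiL n \<beta>"
  have M: "?M \<in> carrier_mat n n" using PhiL_class(1)[OF u] by (simp add: \<beta>_def)
  show eq: ?eq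
    using M ij carrier_matD[OF A_mat_carrier[of n]] unfolding Lambda_mat_def
    by (subst mat_diag_mult_left[of _ n n]) (auto simp: scalar_prod_def atLeast0LessThan)
  show Mc: "?M $$ (i, k) \<in> carrier (free_alg n)" if "k < n" for k
    using PhiL_class(2)[OF u] M ij that by (auto simp: \<beta>_def)
  show "(A_mat n - Lambda_mat n \<beta> * map_mat base_change ?M * A_mat n) $$ (i, j) \<in> carrier (free_alg n)"
    unfolding eq using ij Mc
    by (intro free_alg_diff free_alg_sum free_alg_mult A_mat_closed base_change_closed) auto
qed

lemma entry_right:
  assumes u: "u \<in> braid_words n" and ij: "i < n" "j < n"
  defines "\<beta> \<equiv> braid_class n u"
  shows "(A_mat n - A_mat n * map_mat base_change (PhiR n \<beta>) * Lambda_inv_mat n \<beta>) $$ (i, j) =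
      A_mat n $$ (i, j) - (\<Sum>k<n. A_mat n $$ (i, k) * base_change (PhiR n \<beta> $$ (k, j))) *
        (if j = 0 then lambda_mu (- 1) (- writhe n \<beta>) else 1)" (is ?eq)
    and "k < n \<Longrightarrow> PhiR n \<beta> $$ (k, j) \<in> carrier (free_alg n)"
    and "(A_mat n - A_mat n * map_mat base_change (PhiR n \<beta>) * Lambda_inv_mat n \<beta>) $$ (i, j)
      \<in> carrier (free_alg n)"
proof -
  let ?M = "PhiR n \<beta>"
  have M: "?M \<in> carrier_mat n n" using PhiR_class(1)[OF u] by (simp add: \<beta>_def)
  show eq: ?eq
    using M ij carrier_matD[OF A_mat_carrier[of n]] unfolding Lambda_inv_mat_def
    by (subst mat_diag_mult_right[of _ n n]) (auto simp: scalar_prod_def atLeast0LessThan)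
  show Mc: "?M $$ (k, j) \<in> carrier (free_alg n)" if "k < n" for k
    using PhiR_class(2)[OF u] M ij that by (auto simp: \<beta>_def)
  show "(A_mat n - A_mat n * map_mat base_change ?M * Lambda_inv_mat n \<beta>) $$ (i, j) \<in> carrier (free_alg n)"
    unfolding eq using ij Mc
    by (intro free_alg_diff free_alg_sum free_alg_mult A_mat_closed base_change_closed) auto
qed

locale falg_hom =
  fixes n :: nat and \<epsilon> :: "laurent falg \<Rightarrow> complex"
  assumes hom: "\<epsilon> \<in> Ring.ring_hom (free_alg n) class_ring"
begin

lemma add: "x \<in> carrier (free_alg n) \<Longrightarrow> y \<in> carrier (free_alg n) \<Longrightarrow> \<epsilon> (x + y) = \<epsilon> x + \<epsilon> y"
  and mult: "x \<in> carrier (free_alg n) \<Longrightarrow> y \<in> carrier (free_alg n) \<Longrightarrow> \<epsilon> (x * y) = \<epsilon> x * \<epsilon> y"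
  and one: "\<epsilon> 1 = 1"
  using hom by (auto simp: Ring.ring_hom_def)

lemma zero: "\<epsilon> 0 = 0"
  using add[of 0 0] by simp

lemma uminus: "x \<in> carrier (free_alg n) \<Longrightarrow> \<epsilon> (- x) = - \<epsilon> x"
  using add[of x "- x"] zero by (simp add: free_alg_uminus eq_neg_iff_add_eq_0 add.commute)

lemma diff: "x \<in> carrier (free_alg n) \<Longrightarrow> y \<in> carrier (free_alg n) \<Longrightarrow> \<epsilon> (x - y) = \<epsilon> x - \<epsilon> y"
  using add[of x "- y"] uminus[of y] by (simp add: free_alg_uminus)

lemma sum:
  "(\<And>i. i \<in> I \<Longrightarrow> f i \<in> carrier (free_alg n)) \<Longrightarrow> \<epsilon> (sum f I) = (\<Sum>i\<in>I. \<epsilon> (f i))"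
  by (induction I rule: infinite_finite_induct) (auto simp: zero add free_alg_sum)

lemma lambda_mu_inverse: "\<epsilon> (lambda_mu d e) * \<epsilon> (lambda_mu (- d) (- e)) = 1"
  using mult[of "lambda_mu d e" "lambda_mu (- d) (- e)"] one
  by (simp add: lambda_mu_mult lambda_mu_0)

definition point :: "nat \<Rightarrow> nat \<Rightarrow> complex" where
  "point i j = (if i = j then 2 else \<epsilon> (agen i j))"

lemma gram_point: "gram point"
  by (simp add: gram_def point_def)

lemma base_change:
  assumes "x \<in> carrier (free_alg n)"
  shows "\<epsilon> (base_change x) = falg_eval (\<lambda>(i, j). point i j) x"
proof (rule falg_ext[of "\<lambda>x. \<epsilon> (base_change x)" "falg_eval (\<lambda>(i, j). point i j)", OF _ _ _ _ _ _ _ assms])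
  fix x y :: "int falg" assume "x \<in> carrier (free_alg n)" "y \<in> carrier (free_alg n)"
  note xy = this[THEN base_change_closed]
  show "\<epsilon> (base_change (x + y)) = \<epsilon> (base_change x) + \<epsilon> (base_change y)"
    using add[OF xy] by (simp add: base_change_eq)
  show "\<epsilon> (base_change (x * y)) = \<epsilon> (base_change x) * \<epsilon> (base_change y)"
    using mult[OF xy] by (simp add: base_change_eq)
qed (auto simp: base_change_eq zero one point_def)

definition lam :: "braid \<Rightarrow> complex" where
  "lam \<beta> = \<epsilon> (lambda_mu 1 (writhe n \<beta>))"

lemma lam_inverse: "lam \<beta> \<noteq> 0" "\<epsilon> (lambda_mu (- 1) (- writhe n \<beta>)) = 1 / lam \<beta>"
proof -
  have inv: "lam \<beta> * \<epsilon> (lambda_mu (- 1) (- writhe n \<beta>)) = 1"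
    using lambda_mu_inverse[of 1 "writhe n \<beta>"] by (simp add: lam_def)
  then show "lam \<beta> \<noteq> 0" by auto
  with inv show "\<epsilon> (lambda_mu (- 1) (- writhe n \<beta>)) = 1 / lam \<beta>"
    by (simp add: nonzero_eq_divide_eq mult.commute)
qed

text \<open>The value of an ideal generator in terms of the point of \<open>\<epsilon>\<close>. As
  \<open>\<epsilon>\<close> is a homomorphism on the carrier only, each factor is placed there
  before \<open>\<epsilon>\<close> passes through it.\<close>

lemma relation_left:
  assumes u: "u \<in> braid_words n" and ij: "i < n" "j < n"
  defines "\<beta> \<equiv> braid_class n u"
  shows "\<epsilon> ((A_mat n - Lambda_mat n \<beta> * map_mat base_change (PhiL n \<beta>) * A_mat n) $$ (i, j)) =
    \<epsilon> (A_mat n $$ (i, j)) - (\<Sum>k<n. (if i = 0 then lam \<beta> else 1) *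
      falg_eval (\<lambda>(i, j). point i j) (PhiL n \<beta> $$ (i, k)) * \<epsilon> (A_mat n $$ (k, j)))"
proof -
  let ?M = "PhiL n \<beta>" and ?l = "if i = 0 then lambda_mu 1 (writhe n \<beta>) else 1 :: laurent falg"
  note entry = entry_left[OF u ij, folded \<beta>_def]
  have lc: "?l \<in> carrier (free_alg n)" by simp
  have le: "\<epsilon> ?l = (if i = 0 then lam \<beta> else 1)" by (simp add: lam_def one)
  note closed = lc A_mat_closed base_change_closed entry(2) ij
  have "\<epsilon> ((A_mat n - Lambda_mat n \<beta> * map_mat base_change ?M * A_mat n) $$ (i, j)) =
      \<epsilon> (A_mat n $$ (i, j)) - \<epsilon> (\<Sum>k<n. ?l * base_change (?M $$ (i, k)) * A_mat n $$ (k, j))"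
    unfolding entry(1) by (intro diff free_alg_sum free_alg_mult closed) auto
  also have "\<epsilon> (\<Sum>k<n. ?l * base_change (?M $$ (i, k)) * A_mat n $$ (k, j)) =
      (\<Sum>k<n. \<epsilon> (?l * base_change (?M $$ (i, k)) * A_mat n $$ (k, j)))"
    by (intro sum free_alg_mult closed) auto
  also have "\<dots> = (\<Sum>k<n. \<epsilon> ?l * \<epsilon> (base_change (?M $$ (i, k))) * \<epsilon> (A_mat n $$ (k, j)))"
  proof (intro sum.cong HOL.refl)
    fix k assume "k \<in> {..<n}"
    then have k: "k < n" by simp
    note M = base_change_closed[OF entry(2)[OF k]]
    show "\<epsilon> (?l * base_change (?M $$ (i, k)) * A_mat n $$ (k, j)) =
        \<epsilon> ?l * \<epsilon> (base_change (?M $$ (i, k))) * \<epsilon> (A_mat n $$ (k, j))"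
      unfolding mult[OF free_alg_mult[OF lc M] A_mat_closed[OF k ij(2)]] mult[OF lc M] ..
  qed
  finally show ?thesis using entry(2) by (simp only: le) (simp add: base_change)
qed

lemma relation_right:
  assumes u: "u \<in> braid_words n" and ij: "i < n" "j < n"
  defines "\<beta> \<equiv> braid_class n u"
  shows "\<epsilon> ((A_mat n - A_mat n * map_mat base_change (PhiR n \<beta>) * Lambda_inv_mat n \<beta>) $$ (i, j)) =
    \<epsilon> (A_mat n $$ (i, j)) - (\<Sum>k<n. \<epsilon> (A_mat n $$ (i, k)) *
      (falg_eval (\<lambda>(i, j). point i j) (PhiR n \<beta> $$ (k, j)) * (if j = 0 then 1 / lam \<beta> else 1)))"
proof -
  let ?M = "PhiR n \<beta>" and ?l = "if j = 0 then lambda_mu (- 1) (- writhe n \<beta>) else 1 :: laurent falg"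
  note entry = entry_right[OF u ij, folded \<beta>_def]
  have lc: "?l \<in> carrier (free_alg n)" by simp
  have le: "\<epsilon> ?l = (if j = 0 then 1 / lam \<beta> else 1)" by (simp add: lam_inverse one)
  note closed = lc A_mat_closed base_change_closed entry(2) ij
  let ?S = "\<Sum>k<n. A_mat n $$ (i, k) * base_change (?M $$ (k, j))"
  have "\<epsilon> ((A_mat n - A_mat n * map_mat base_change ?M * Lambda_inv_mat n \<beta>) $$ (i, j)) =
      \<epsilon> (A_mat n $$ (i, j)) - \<epsilon> (?S * ?l)"
    unfolding entry(1) by (intro diff free_alg_sum free_alg_mult closed) auto
  also have "\<epsilon> (?S * ?l) = \<epsilon> ?S * \<epsilon> ?l"
    by (intro mult free_alg_sum free_alg_mult closed) auto
  also have "\<epsilon> ?S = (\<Sum>k<n. \<epsilon> (A_mat n $$ (i, k) * base_change (?M $$ (k, j))))"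
    by (intro sum free_alg_mult closed) auto
  also have "\<dots> = (\<Sum>k<n. \<epsilon> (A_mat n $$ (i, k)) * \<epsilon> (base_change (?M $$ (k, j))))"
  proof (intro sum.cong HOL.refl)
    fix k assume "k \<in> {..<n}"
    then have k: "k < n" by simp
    show "\<epsilon> (A_mat n $$ (i, k) * base_change (?M $$ (k, j))) =
        \<epsilon> (A_mat n $$ (i, k)) * \<epsilon> (base_change (?M $$ (k, j)))"
      by (rule mult[OF A_mat_closed[OF ij(1) k] base_change_closed[OF entry(2)[OF k]]])
  qed
  finally show ?thesis
    using entry(2) by (simp only: le) (simp add: base_change sum_distrib_right mult.assoc)
qed

end

text \<open>A point satisfying this condition extends to augmentations for which \<open>\<epsilon>(\<^bold>A)\<close> is invertible, and
  these are the only such augmentations; here \<open>c = \<epsilon>(\<lambda>\<mu>\<^sup>w)\<^sup>-\<^sup>1\<close>.\<close>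

definition full_point :: "nat \<Rightarrow> braid_word \<Rightarrow> complex \<Rightarrow> (nat \<Rightarrow> nat \<Rightarrow> complex) \<Rightarrow> bool" where
  "full_point n u c a \<longleftrightarrow> gram a \<and>
    (\<forall>v. \<forall>i\<in>{1..n}. row_word u a v i = (if i = 1 then c else 1) * v i) \<and>
    (\<forall>v. \<forall>i\<in>{1..n}. row_word u (transposed a) v i = (if i = 1 then 1 / c else 1) * v i)"

lemma sum_delta_mult:
  fixes f :: "nat \<Rightarrow> 'a::comm_ring_1"
  assumes "i < n"
  shows "(\<Sum>j<n. (if j = i then x else 0) * f j) = x * f i"
  using assms by (simp add: if_distrib[of "\<lambda>x. x * _"] cong: if_cong)

lemma full_point_iff:
  assumes u: "u \<in> braid_words n" and a: "gram a"
  shows "full_point n u c a \<longleftrightarrow>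
    (\<forall>i<n. \<forall>j<n. falg_eval (\<lambda>(i, j). a i j) (PhiL n (braid_class n u) $$ (i, j)) =
      (if j = i then if i = 0 then c else 1 else 0)) \<and>
    (\<forall>i<n. \<forall>j<n. falg_eval (\<lambda>(i, j). a i j) (PhiR n (braid_class n u) $$ (j, i)) =
      (if j = i then if i = 0 then 1 / c else 1 else 0))"
    (is "_ \<longleftrightarrow> (\<forall>i<n. \<forall>j<n. ?L i j = _) \<and> (\<forall>i<n. \<forall>j<n. ?R j i = _)")
proof (intro iffI conjI allI impI)
  fix i j assume full: "full_point n u c a" and ij: "i < n" "j < n"
  \<comment> \<open>A unit vector: the row operation applied to it reads off column \<open>j\<close>
    of the matrix.\<close>
  let ?v = "\<lambda>k. if k = j + 1 then 1 else 0 :: complex"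
  have "?L i j = row_word u a ?v (i + 1)"
    unfolding row_word_PhiL[OF u a ij(1)] using ij
    by (simp add: if_distrib[of "\<lambda>x. _ * x"] cong: if_cong)
  also have "\<dots> = (if i = 0 then c else 1) * ?v (i + 1)"
    using full ij by (simp add: full_point_def)
  finally show "?L i j = (if j = i then if i = 0 then c else 1 else 0)" by auto
  have "?R j i = row_word u (transposed a) ?v (i + 1)"
    unfolding row_word_PhiR[OF u a ij(1)] using ij
    by (simp add: if_distrib[of "\<lambda>x. x * _"] cong: if_cong)
  also have "\<dots> = (if i = 0 then 1 / c else 1) * ?v (i + 1)"
    using full ij by (simp add: full_point_def)
  finally show "?R j i = (if j = i then if i = 0 then 1 / c else 1 else 0)" by auto
next
  assume LR: "(\<forall>i<n. \<forall>j<n. ?L i j = (if j = i then if i = 0 then c else 1 else 0)) \<and>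
    (\<forall>i<n. \<forall>j<n. ?R j i = (if j = i then if i = 0 then 1 / c else 1 else 0))"
  have L: "row_word u a v (i + 1) = (if i = 0 then c else 1) * v (i + 1)" if "i < n" for i v
    unfolding row_word_PhiL[OF u a that]
    using that LR sum_delta_mult[OF that, of "if i = 0 then c else 1" "\<lambda>j. v (j + 1)"] by simp
  have R: "row_word u (transposed a) v (i + 1) = (if i = 0 then 1 / c else 1) * v (i + 1)"
    if "i < n" for i v
    unfolding row_word_PhiR[OF u a that]
    using that LR sum_delta_mult[OF that, of "if i = 0 then 1 / c else 1" "\<lambda>j. v (j + 1)"]
    by (simp add: mult.commute)
  have "row_word u a v i = (if i = 1 then c else 1) * v i"
    "row_word u (transposed a) v i = (if i = 1 then 1 / c else 1) * v i" if "i \<in> {1..n}" for i v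
    using L[of "i - 1" v] R[of "i - 1" v] that by (cases i; simp)+
  then show "full_point n u c a" unfolding full_point_def using a by blast
qed

lemma mat_left_fixed:
  fixes A N :: "complex mat"
  assumes A: "A \<in> carrier_mat n n" "det A \<noteq> 0" and N: "N \<in> carrier_mat n n" and eq: "A = N * A"
  shows "N = 1\<^sub>m n"
proof -
  obtain B where B: "B \<in> carrier_mat n n" "A * B = 1\<^sub>m n"
    using det_non_zero_imp_unit[OF A(1,2)] by (auto simp: Units_def ring_mat_def)
  have "N = N * (A * B)" using N B by simp
  also have "\<dots> = (N * A) * B" by (rule assoc_mult_mat[OF N A(1) B(1), symmetric])
  also have "\<dots> = 1\<^sub>m n" using eq B by simp
  finally show ?thesis .
qed

lemma mat_right_fixed:
  fixes A N :: "complex mat"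
  assumes A: "A \<in> carrier_mat n n" "det A \<noteq> 0" and N: "N \<in> carrier_mat n n" and eq: "A = A * N"
  shows "N = 1\<^sub>m n"
proof -
  obtain B where B: "B \<in> carrier_mat n n" "B * A = 1\<^sub>m n"
    using det_non_zero_imp_unit[OF A(1,2)] by (auto simp: Units_def ring_mat_def)
  have "N = (B * A) * N" using N B by simp
  also have "\<dots> = B * (A * N)" by (rule assoc_mult_mat[OF B(1) A(1) N])
  also have "\<dots> = 1\<^sub>m n" using eq B by simp
  finally show ?thesis .
qed

section \<open>Maximal rank and full points\<close>

definition aug_ranks :: "nat \<Rightarrow> braid \<Rightarrow> nat set" where
  "aug_ranks n \<beta> = {vec_space.rank n (map_mat \<epsilon> (A_mat n)) |\<epsilon>. \<epsilon> \<in> augmentations n \<beta> \<and> \<epsilon> mu \<noteq> 1}"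

lemma aug_rank_eq_iff:
  assumes "1 \<le> n"
  shows "aug_rank n \<beta> = n \<longleftrightarrow> n \<in> aug_ranks n \<beta>"
proof -
  have le: "r \<le> n" if "r \<in> aug_ranks n \<beta>" for r
    using that by (auto simp: aug_ranks_def intro!: vec_space.rank_le_nc)
  have sup: "aug_rank n \<beta> = Sup (aug_ranks n \<beta>)" by (simp add: aug_rank_def aug_ranks_def)
  have fin: "finite (aug_ranks n \<beta>)" using le by (meson finite_nat_set_iff_bounded_le)
  show ?thesis
  proof
    assume eq: "aug_rank n \<beta> = n"
    \<comment> \<open>The supremum of the empty set of naturals is 0, so a supremum of at least 1 is
      attained.\<close>
    then have "aug_ranks n \<beta> \<noteq> {}" using assms sup by (auto simp: Sup_nat_def)
    then show "n \<in> aug_ranks n \<beta>"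
      using eq sup fin Max_in[of "aug_ranks n \<beta>"] by (simp add: Sup_nat_def)
  next
    assume "n \<in> aug_ranks n \<beta>"
    then show "aug_rank n \<beta> = n" unfolding sup by (rule cSup_eq_maximum) (rule le)
  qed
qed

lemma aug_rank_imp_full_point:
  assumes u: "u \<in> braid_words n" and n: "1 \<le> n" and rank: "aug_rank n (braid_class n u) = n"
  shows "\<exists>c a. c \<noteq> 0 \<and> full_point n u c a"
proof -
  let ?\<beta> = "braid_class n u"
  obtain \<epsilon> where \<epsilon>: "\<epsilon> \<in> augmentations n ?\<beta>" and r: "vec_space.rank n (map_mat \<epsilon> (A_mat n)) = n"
    using rank n by (auto simp: aug_rank_eq_iff aug_ranks_def)
  interpret falg_hom n \<epsilon> using \<epsilon> by unfold_locales (simp add: augmentations_def)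
  define A where "A = map_mat \<epsilon> (A_mat n)"
  have A: "A \<in> carrier_mat n n" by (simp add: A_def)
  have det: "det A \<noteq> 0" using vec_space.det_rank_iff[OF A] r by (simp add: A_def)
  have Aij: "A $$ (i, j) = \<epsilon> (A_mat n $$ (i, j))" if "i < n" "j < n" for i j
    using that carrier_matD[OF A_mat_carrier[of n]] by (simp add: A_def)
  let ?SL = "elements_mat (A_mat n - Lambda_mat n ?\<beta> * map_mat base_change (PhiL n ?\<beta>) * A_mat n)"
  let ?SR = "elements_mat (A_mat n - A_mat n * map_mat base_change (PhiR n ?\<beta>) * Lambda_inv_mat n ?\<beta>)"
  have "?SL \<union> ?SR \<subseteq> aug_ideal n ?\<beta>" by (auto simp: aug_ideal_def genideal_def)
  then have vanish: "\<epsilon> x = 0" if "x \<in> ?SL \<union> ?SR" for x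
    using \<epsilon> that by (auto simp: augmentations_def)
  let ?L = "\<lambda>i k. falg_eval (\<lambda>(i, j). point i j) (PhiL n ?\<beta> $$ (i, k))"
  let ?R = "\<lambda>i k. falg_eval (\<lambda>(i, j). point i j) (PhiR n ?\<beta> $$ (i, k))"
  \<comment> \<open>These are the values of \<open>\<Lambda>\<Phi>\<^sup>L\<close> and
    \<open>\<Phi>\<^sup>R\<Lambda>\<^sup>-\<^sup>1\<close>; the relations say that they fix the
    invertible matrix \<open>A\<close> from the left and from the right.\<close>
  define N where "N = mat n n (\<lambda>(i, k). (if i = 0 then lam ?\<beta> else 1) * ?L i k)"
  define N' where "N' = mat n n (\<lambda>(k, j). ?R k j * (if j = 0 then 1 / lam ?\<beta> else 1))"
  have "A $$ (i, j) = (N * A) $$ (i, j)" if ij: "i < n" "j < n" for i j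
  proof -
    have "\<epsilon> ((A_mat n - Lambda_mat n ?\<beta> * map_mat base_change (PhiL n ?\<beta>) * A_mat n) $$ (i, j)) = 0"
      using ij PhiL_class(1)[OF u]
      by (intro vanish UnI1 elements_matI[of _ n n i j]) (auto simp: Lambda_mat_def intro!: minus_carrier_mat mult_carrier_mat[of _ n n])
    then show ?thesis
      using ij A unfolding relation_left[OF u ij] by (simp add: N_def Aij scalar_prod_def atLeast0LessThan)
  qed
  then have "A = N * A" using A by (intro eq_matI) (auto simp: N_def)
  then have N: "N = 1\<^sub>m n" by (intro mat_left_fixed[OF A det]) (simp_all add: N_def)
  have "A $$ (i, j) = (A * N') $$ (i, j)" if ij: "i < n" "j < n" for i j
  proof -
    have "\<epsilon> ((A_mat n - A_mat n * map_mat base_change (PhiR n ?\<beta>) * Lambda_inv_mat n ?\<beta>) $$ (i, j)) = 0"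
      using ij PhiR_class(1)[OF u]
      by (intro vanish UnI2 elements_matI[of _ n n i j]) (auto simp: Lambda_inv_mat_def intro!: minus_carrier_mat mult_carrier_mat[of _ n n])
    then show ?thesis
      using ij A unfolding relation_right[OF u ij] by (simp add: N'_def Aij scalar_prod_def atLeast0LessThan)
  qed
  then have "A = A * N'" using A by (intro eq_matI) (auto simp: N'_def)
  then have N': "N' = 1\<^sub>m n" by (intro mat_right_fixed[OF A det]) (simp_all add: N'_def)
  let ?c = "1 / lam ?\<beta>"
  have L: "?L i j = (if j = i then if i = 0 then ?c else 1 else 0)" if "i < n" "j < n" for i j
  proof -
    have "(if i = 0 then lam ?\<beta> else 1) * ?L i j = (if i = j then 1 else 0)"
      using arg_cong[OF N, of "\<lambda>M. M $$ (i, j)"] that by (simp add: N_def)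
    then show ?thesis using lam_inverse(1)[of ?\<beta>] by (auto simp: field_simps split: if_splits)
  qed
  have R: "?R j i = (if j = i then if i = 0 then 1 / ?c else 1 else 0)" if "i < n" "j < n" for i j
  proof -
    have "?R j i * (if i = 0 then 1 / lam ?\<beta> else 1) = (if j = i then 1 else 0)"
      using arg_cong[OF N', of "\<lambda>M. M $$ (j, i)"] that by (simp add: N'_def)
    then show ?thesis using lam_inverse(1)[of ?\<beta>] by (auto simp: field_simps split: if_splits)
  qed
  have "full_point n u ?c point"
    using L R by (subst full_point_iff[OF u gram_point]) blast
  moreover have "?c \<noteq> 0" using lam_inverse(1) by simp
  ultimately show ?thesis by blast
qed

lemma exists_invertible_parameter:
  fixes a :: "nat \<Rightarrow> nat \<Rightarrow> complex"
  shows "\<exists>x. x \<noteq> 0 \<and> x \<noteq> 1 \<and>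
    det (mat n n (\<lambda>(i, j). if i < j then a i j else if i > j then - x * a i j else 1 - x)) \<noteq> 0"
proof -
  define M where "M = mat n n (\<lambda>(i, j). if i < j then [:a i j:] else if i > j then [:0, - a i j:] else [:1, -1:])"
  have M: "poly (det M) x = det (mat n n (\<lambda>(i, j). if i < j then a i j else if i > j then - x * a i j else 1 - x))"
    for x
  proof -
    interpret comm_ring_hom "\<lambda>p. poly p x" by unfold_locales auto
    have "poly (det M) x = det (map_mat (\<lambda>p. poly p x) M)" by simp
    also have "map_mat (\<lambda>p. poly p x) M =
        mat n n (\<lambda>(i, j). if i < j then a i j else if i > j then - x * a i j else 1 - x)"
      by (rule eq_matI) (auto simp: M_def)
    finally show ?thesis .
  qed
  have "det (mat n n (\<lambda>(i, j). if i < j then a i j else if i > j then - 0 * a i j else 1 - 0)) = 1"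
    by (subst det_upper_triangular[of _ n]) (auto simp: prod_list_diag_prod intro!: upper_triangularI)
  then have "poly (det M) 0 = 1" by (simp only: M)
  then have "det M \<noteq> 0" by auto
  \<comment> \<open>Besides the roots, 0 is excluded because \<mu> is a unit, and 1 because the rank
    is taken over augmentations with \<mu> different from 1.\<close>
  then have "finite ({x. poly (det M) x = 0} \<union> {0, 1})" by (simp add: poly_roots_finite)
  then obtain x where "x \<notin> {x. poly (det M) x = 0} \<union> {0, 1}"
    using ex_new_if_finite[OF infinite_UNIV_char_0] by blast
  then show ?thesis by (auto simp: M)
qed

lemma full_point_imp_aug_rank:
  assumes u: "u \<in> braid_words n" and n: "1 \<le> n" and c: "c \<noteq> 0" and full: "full_point n u c a"
  shows "aug_rank n (braid_class n u) = n"
proof -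
  let ?\<beta> = "braid_class n u"
  have a: "gram a" using full by (simp add: full_point_def)
  obtain x where x: "x \<noteq> 0" "x \<noteq> 1"
    and det: "det (mat n n (\<lambda>(i, j). if i < j then a (i + 1) (j + 1)
      else if i > j then - x * a (i + 1) (j + 1) else 1 - x)) \<noteq> 0"
    using exists_invertible_parameter[of n "\<lambda>i j. a (i + 1) (j + 1)"] by auto
  \<comment> \<open>The value of \<lambda> is chosen to give
    \<open>lambda_mu 1 (writhe n ?\<beta>)\<close> the value \<open>1 / c\<close>, so the power of
    \<mu> is absorbed.\<close>
  define l where "l = 1 / (c * x powi (writhe n ?\<beta>))"
  interpret aug_data l x "\<lambda>(i, j). a i j" by unfold_locales (auto simp: l_def c x)
  interpret falg_hom n aug_hom by unfold_locales (rule aug_hom_ring_hom)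
  have point: "falg_eval (\<lambda>(i, j). point i j) y = falg_eval (\<lambda>(i, j). a i j) y"
    if "y \<in> carrier (free_alg n)" for y
    using that by (rule falg_eval_cong) (auto simp: point_def aug_hom_agen)
  have "lam ?\<beta> = l * x powi (writhe n ?\<beta>)" by (simp add: lam_def aug_hom_lambda_mu)
  then have lam: "lam ?\<beta> = 1 / c" by (simp add: l_def x)
  let ?SL = "elements_mat (A_mat n - Lambda_mat n ?\<beta> * map_mat base_change (PhiL n ?\<beta>) * A_mat n)"
  let ?SR = "elements_mat (A_mat n - A_mat n * map_mat base_change (PhiR n ?\<beta>) * Lambda_inv_mat n ?\<beta>)"
  have L: "falg_eval (\<lambda>(i, j). point i j) (PhiL n ?\<beta> $$ (i, j)) = (if j = i then if i = 0 then c else 1 else 0)"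
    if "i < n" "j < n" for i j
    using full[unfolded full_point_iff[OF u a]] that
    unfolding point[OF entry_left(2)[OF u that(1) that(1) that(2)]] by blast
  have R: "falg_eval (\<lambda>(i, j). point i j) (PhiR n ?\<beta> $$ (j, i)) = (if j = i then if i = 0 then 1 / c else 1 else 0)"
    if "i < n" "j < n" for i j
    using full[unfolded full_point_iff[OF u a]] that
    unfolding point[OF entry_right(2)[OF u that(1) that(1) that(2)]] by blast
  have SL: "y \<in> carrier (free_alg n) \<and> aug_hom y = 0" if y_in: "y \<in> ?SL" for y
  proof -
    obtain i j where ij: "i < n" "j < n"
      and y: "y = (A_mat n - Lambda_mat n ?\<beta> * map_mat base_change (PhiL n ?\<beta>) * A_mat n) $$ (i, j)"
      using elements_matD[OF y_in] carrier_matD[OF A_mat_carrier[of n]] by (auto simp: Lambda_mat_def mat_diag_def)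
    have "(\<Sum>k<n. (if i = 0 then lam ?\<beta> else 1) *
        falg_eval (\<lambda>(i, j). point i j) (PhiL n ?\<beta> $$ (i, k)) * aug_hom (A_mat n $$ (k, j))) =
      (\<Sum>k<n. (if k = i then 1 else 0) * aug_hom (A_mat n $$ (k, j)))"
      using ij c by (intro sum.cong HOL.refl) (simp add: L lam)
    also have "\<dots> = aug_hom (A_mat n $$ (i, j))" using sum_delta_mult[OF ij(1), of 1] by simp
    finally show ?thesis
      using relation_left[OF u ij] entry_left(3)[OF u ij] by (simp add: y)
  qed
  have SR: "y \<in> carrier (free_alg n) \<and> aug_hom y = 0" if y_in: "y \<in> ?SR" for y
  proof -
    obtain i j where ij: "i < n" "j < n"
      and y: "y = (A_mat n - A_mat n * map_mat base_change (PhiR n ?\<beta>) * Lambda_inv_mat n ?\<beta>) $$ (i, j)"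
      using elements_matD[OF y_in] carrier_matD[OF A_mat_carrier[of n]] by (auto simp: Lambda_inv_mat_def mat_diag_def)
    have "(\<Sum>k<n. aug_hom (A_mat n $$ (i, k)) *
        (falg_eval (\<lambda>(i, j). point i j) (PhiR n ?\<beta> $$ (k, j)) * (if j = 0 then 1 / lam ?\<beta> else 1))) =
      (\<Sum>k<n. (if k = j then 1 else 0) * aug_hom (A_mat n $$ (i, k)))"
      using ij c by (intro sum.cong HOL.refl) (simp add: R lam)
    also have "\<dots> = aug_hom (A_mat n $$ (i, j))" using sum_delta_mult[OF ij(2), of 1] by simp
    finally show ?thesis
      using relation_right[OF u ij] entry_right(3)[OF u ij] by (simp add: y)
  qed
  \<comment> \<open>The kernel is an ideal containing the generators, hence it contains the ideal
    they generate.\<close>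
  let ?I = "{y \<in> carrier (free_alg n). aug_hom y = 0}"
  interpret R: ring "free_alg n :: laurent falg ring" by (rule ring_free_alg)
  have "ideal ?I (free_alg n)"
  proof (rule idealI[OF ring_free_alg])
    show "subgroup ?I (add_monoid (free_alg n))"
    proof
      fix y assume y: "y \<in> ?I"
      have "\<ominus>\<^bsub>free_alg n\<^esub> y = - y" using y by (intro R.minus_equality) (auto simp: free_alg_uminus)
      then have "inv\<^bsub>add_monoid (free_alg n)\<^esub> y = - y" by (simp add: a_inv_def)
      then show "inv\<^bsub>add_monoid (free_alg n)\<^esub> y \<in> ?I" using y by (simp add: free_alg_uminus uminus)
    qed (auto simp: aug_hom_hom free_alg_add)
  qed (auto simp: aug_hom_hom free_alg_mult)
  then have "aug_ideal n ?\<beta> \<subseteq> ?I"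
    unfolding aug_ideal_def by (rule R.genideal_minimal) (use SL SR in blast)
  then have aug: "aug_hom \<in> augmentations n ?\<beta>"
    by (auto simp: augmentations_def aug_hom_ring_hom)
  have "map_mat aug_hom (A_mat n) = mat n n (\<lambda>(i, j). if i < j then a (i + 1) (j + 1)
      else if i > j then - x * a (i + 1) (j + 1) else 1 - x)"
  proof (rule eq_matI)
    fix i j assume "i < dim_row (mat n n (\<lambda>(i, j). if i < j then a (i + 1) (j + 1)
      else if i > j then - x * a (i + 1) (j + 1) else 1 - x))"
      "j < dim_col (mat n n (\<lambda>(i, j). if i < j then a (i + 1) (j + 1)
      else if i > j then - x * a (i + 1) (j + 1) else 1 - x))"
    then show "map_mat aug_hom (A_mat n) $$ (i, j) = mat n n (\<lambda>(i, j). if i < j then a (i + 1) (j + 1)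
      else if i > j then - x * a (i + 1) (j + 1) else 1 - x) $$ (i, j)"
      by (simp add: A_mat_def aug_hom_hom aug_hom_agen aug_hom_lambda_mu)
  qed (simp_all add: A_mat_def)
  then have "vec_space.rank n (map_mat aug_hom (A_mat n)) = n"
    using det vec_space.det_rank_iff[of "map_mat aug_hom (A_mat n)" n] by simp
  moreover have "aug_hom mu \<noteq> 1" using x by (simp add: aug_hom_lambda_mu)
  ultimately have "n \<in> aug_ranks n ?\<beta>" using aug unfolding aug_ranks_def by force
  then show ?thesis using aug_rank_eq_iff[OF n] by simp
qed

section \<open>The satellite theorem\<close>

text \<open>The cable multiplies the first \<open>p\<close> rows by \<open>c\<close> and fixes the
  others. The pattern acts on those \<open>p\<close> rows alone, where its entries
  \<open>1 / c\<close> restore the identity except in the first row.\<close>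

lemma satellite_row:
  fixes c s :: complex
  assumes u: "u \<in> braid_words k" and w: "w \<in> braid_words p" and p: "1 \<le> p"
    and a: "gram a" and b: "gram b" and c: "c \<noteq> 0"
    and row_u: "\<And>v i. i \<in> {1..k} \<Longrightarrow> row_word u a v i = (if i = 1 then c else 1) * v i"
    and row_w: "\<And>v i. i \<in> {1..p} \<Longrightarrow> row_word w b v i = (if i = 1 then s else 1 / c) * v i"
    and x: "x \<in> {1..k * p}"
  shows "row_word (cable_word p u @ w) (satellite_point p a b) v x = (if x = 1 then c * s else 1) * v x"
proof -
  define V where "V = row_word (cable_word p u) (satellite_point p a b) v"
  define S where "S = satellite_point p (point_word u a) b"
  have row: "row_word (cable_word p u @ w) (satellite_point p a b) v x = row_word w S V x"
    using row_word_cable_word(1)[OF u p a b] by (simp add: row_word_append V_def S_def)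
  have V: "V y = (if y \<le> p then c else 1) * v y" if "y \<in> {1..k * p}" for y
  proof -
    have pos: "1 \<le> block p y" using block_0[OF p, of y] that by (cases "block p y = 0") auto
    have "y + p - 1 < (k + 1) * p" using that p by auto
    then have "block p y \<le> k" unfolding block_def using less_mult_imp_div_less[of "y + p - 1" "k + 1" p] by simp
    moreover have "block p y = 1 \<longleftrightarrow> y \<le> p"
    proof
      assume "block p y = 1"
      then show "y \<le> p" using position_block[OF p, of y] offset_less[OF p, of y] by (simp add: position_def)
    next
      assume "y \<le> p"
      then have "y + p - 1 < 2 * p" using p by auto
      then have "block p y < 2" unfolding block_def by (rule less_mult_imp_div_less)
      then show "block p y = 1" using pos by simp
    qed
    ultimately show ?thesis
      using row_word_cable_word(2)[OF u p a b, of y v] row_u[of "block p y"] pos that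
      by (simp add: V_def position_block[OF p])
  qed
  show ?thesis
  proof (cases "x \<le> p")
    case True
    have small: "block p i = 1" "offset p i + 1 = i" if "i \<in> {1..p}" for i
    proof -
      have "i - 1 < p" using that by auto
      then show "block p i = 1" "offset p i + 1 = i"
        using block_position[of "i - 1" p 1] that by (simp_all add: position_def)
    qed
    \<comment> \<open>The cable moves only the companion point \<open>a\<close>, and the diagonal
      blocks do not involve it: the pattern meets \<open>b\<close> unchanged.\<close>
    have "S i j = b i j" if "i \<in> {1..p}" "j \<in> {1..p}" for i j
      using small[OF that(1)] small[OF that(2)] by (simp add: S_def satellite_point_def Let_def)
    then have "row_word w S V x = row_word w b V x"
      using True x by (intro row_word_cong[OF w]) auto
    then show ?thesis using row row_w[of x V] V[OF x] True x c by simp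
  next
    case False
    then show ?thesis using row row_word_outside[OF w, of x S V] V[OF x] p by simp
  qed
qed

lemma knot_orbit:
  assumes "closure_is_knot n \<beta>" "permutation (braid_perm n \<beta>)" "i \<in> {1..n}" "j \<in> {1..n}"
  shows "j \<in> orbit (braid_perm n \<beta>) i"
proof -
  have "card (orbit (braid_perm n \<beta>) ` {1..n}) = 1"
    using assms(1) by (simp add: closure_is_knot_def closure_components_def)
  then obtain S where "orbit (braid_perm n \<beta>) ` {1..n} = {S}" by (rule card_1_singletonE)
  then have "orbit (braid_perm n \<beta>) i = orbit (braid_perm n \<beta>) j"
    using assms(3,4) by (metis imageI singletonD)
  then show ?thesis using permutation_self_in_orbit[OF assms(2), of j] by simp
qed

text \<open>For a knot the permutation of the strands is a single cycle, so rescaling the basis vectors along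
  the cycle moves all but one of the diagonal entries to an arbitrary common value.\<close>

lemma rescaled_pattern:
  fixes c :: complex
  assumes w: "w \<in> braid_words p" and knot: "closure_is_knot p (braid_class p w)"
    and full: "full_point p w d b" and d: "d \<noteq> 0" and c: "c \<noteq> 0"
  shows "\<exists>b s. gram b \<and> s \<noteq> 0 \<and>
    (\<forall>v. \<forall>i\<in>{1..p}. row_word w b v i = (if i = 1 then s else 1 / c) * v i) \<and>
    (\<forall>v. \<forall>i\<in>{1..p}. row_word w (transposed b) v i = (if i = 1 then 1 / s else c) * v i)"
proof -
  define \<pi> where "\<pi> = word_perm w"
  \<comment> \<open>The exponent counts the steps from \<open>i\<close> to 1 along the cycle, so
    \<open>t\<close> drops by a factor \<open>c\<close> at each step and every ratio
    \<open>t (\<pi> i) / t i\<close> with \<open>i \<noteq> 1\<close> is \<open>1 / c\<close>. The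
    value 1 elsewhere keeps \<open>t\<close> nonzero.\<close>
  define t where "t = (\<lambda>i. if i \<in> {1..p} then c ^ funpow_dist \<pi> i 1 else 1)"
  have perm: "\<pi> permutes {1..p}" unfolding \<pi>_def by (rule word_perm_permutes[OF w])
  then have "permutation \<pi>" by (auto simp: permutation_permutes)
  then have orbit: "1 \<in> orbit \<pi> i" if "i \<in> {1..p}" for i
    using knot_orbit[OF knot, of i 1] that by (simp add: braid_perm_class[OF w] \<pi>_def)
  have t0: "t i \<noteq> 0" for i using power_not_zero[OF c] by (simp add: t_def)
  have t_step: "t i = c * t (\<pi> i)" if "i \<in> {1..p}" "i \<noteq> 1" for i
    using funpow_dist_step[OF that(2) orbit[OF that(1)]] that permutes_in_image[OF perm, of i]
    by (simp add: t_def)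
  \<comment> \<open>At 1 the distance starts anew, so this diagonal entry collects the jump of
    \<open>t\<close> together with the old entry \<open>d\<close>.\<close>
  define s where "s = t (\<pi> 1) * d / t 1"
  have scaled: "row_word w (rescale t' a) v i = t' (\<pi> i) * row_word w a (\<lambda>i. v i / t' i) i"
    if "\<And>i. t' i \<noteq> 0" for t' :: "nat \<Rightarrow> complex" and a v i
    using row_word_rescale[where t = t' and u = w and a = a and v = "\<lambda>i. v i / t' i", OF that] that by (simp add: \<pi>_def)
  have b: "gram b" and
    row: "\<And>v i. i \<in> {1..p} \<Longrightarrow> row_word w b v i = (if i = 1 then d else 1) * v i" and
    col: "\<And>v i. i \<in> {1..p} \<Longrightarrow> row_word w (transposed b) v i = (if i = 1 then 1 / d else 1) * v i"
    using full by (auto simp: full_point_def)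
  have "row_word w (rescale t b) v i = (if i = 1 then s else 1 / c) * v i" if "i \<in> {1..p}" for v i
    using that t_step[OF that] t0 c by (simp add: scaled row s_def field_simps)
  moreover have "row_word w (transposed (rescale t b)) v i = (if i = 1 then 1 / s else c) * v i"
    if "i \<in> {1..p}" for v i
    using that t_step[OF that] t0 c d
    by (simp add: transposed_rescale scaled col s_def field_simps)
  moreover have "gram (rescale t b)" using gram_rescale[OF b] t0 by blast
  moreover have "s \<noteq> 0" by (simp add: s_def t0 d)
  ultimately show ?thesis by blast
qed

lemma knot_strands: "closure_is_knot n \<beta> \<Longrightarrow> 1 \<le> n"
  by (cases n) (auto simp: closure_is_knot_def closure_components_def)

lemma braid_satellite_class:
  assumes "u \<in> braid_words k" "w \<in> braid_words p" "1 \<le> k"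
  shows "cable_word p u @ w \<in> braid_words (k * p)"
    and "braid_satellite k p (braid_class k u) (braid_class p w) = braid_class (k * p) (cable_word p u @ w)"
proof -
  have le: "p \<le> k * p" using assms(3) by (cases k) auto
  then have w: "w \<in> braid_words (k * p)" using braid_words_mono assms(2) by blast
  show "cable_word p u @ w \<in> braid_words (k * p)"
    using w cable_word_words[OF assms(1)] by simp
  show "braid_satellite k p (braid_class k u) (braid_class p w) = braid_class (k * p) (cable_word p u @ w)"
    using w cable_word_words[OF assms(1)] le assms
    by (simp add: braid_satellite_def braid_cable_class braid_incl_class braid_class_mult)
qed

theorem theorem1p2:
  fixes k p :: nat and \<alpha> \<gamma> :: braid
  assumes "\<alpha> \<in> carrier (braid_group k)"
    and "\<gamma> \<in> carrier (braid_group p)"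
    and "closure_is_knot k \<alpha>"
    and "closure_is_knot p \<gamma>"
    and "aug_rank k \<alpha> = k"
    and "aug_rank p \<gamma> = p"
  shows "aug_rank (k * p) (braid_satellite k p \<alpha> \<gamma>) = k * p"
proof -
  obtain u where u: "u \<in> braid_words k" "\<alpha> = braid_class k u"
    using assms(1) by (auto simp: braid_group_simps)
  obtain w where w: "w \<in> braid_words p" "\<gamma> = braid_class p w"
    using assms(2) by (auto simp: braid_group_simps)
  have k: "1 \<le> k" and p: "1 \<le> p" using assms(3,4) knot_strands by auto
  obtain c a where c: "c \<noteq> 0" and full_a: "full_point k u c a"
    using aug_rank_imp_full_point[OF u(1) k] assms(5) u(2) by auto
  obtain d b' where d: "d \<noteq> 0" and full_b: "full_point p w d b'"
    using aug_rank_imp_full_point[OF w(1) p] assms(6) w(2) by auto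
  obtain b s where b: "gram b" and s: "s \<noteq> 0"
    and row_b: "\<And>v i. i \<in> {1..p} \<Longrightarrow> row_word w b v i = (if i = 1 then s else 1 / c) * v i"
    and col_b: "\<And>v i. i \<in> {1..p} \<Longrightarrow> row_word w (transposed b) v i = (if i = 1 then 1 / s else c) * v i"
    using rescaled_pattern[OF w(1) _ full_b d c] assms(4) w(2) by blast
  have a: "gram a"
    and row_a: "\<And>v i. i \<in> {1..k} \<Longrightarrow> row_word u a v i = (if i = 1 then c else 1) * v i"
    and col_a: "\<And>v i. i \<in> {1..k} \<Longrightarrow> row_word u (transposed a) v i = (if i = 1 then 1 / c else 1) * v i"
    using full_a by (auto simp: full_point_def)
  have "row_word (cable_word p u @ w) (satellite_point p a b) v x = (if x = 1 then c * s else 1) * v x"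
    if "x \<in> {1..k * p}" for v x
    by (rule satellite_row[OF u(1) w(1) p a b c row_a row_b that])
  \<comment> \<open>The column relations are the row relations of the transposed points with
    \<open>c\<close> and \<open>s\<close> inverted; the entry \<open>c\<close> in
    \<open>col_b\<close> is \<open>1 / (1 / c)\<close>.\<close>
  moreover have "row_word (cable_word p u @ w) (satellite_point p (transposed a) (transposed b)) v x =
      (if x = 1 then 1 / c * (1 / s) else 1) * v x" if "x \<in> {1..k * p}" for v x
    using satellite_row[OF u(1) w(1) p _ _ _ col_a _ that, of "transposed b" "1 / s"] a b c col_b by simp
  ultimately have "full_point (k * p) (cable_word p u @ w) (c * s) (satellite_point p a b)"
    using gram_satellite_point[OF b] by (simp add: full_point_def satellite_point_transposed)
  then have "aug_rank (k * p) (braid_class (k * p) (cable_word p u @ w)) = k * p"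
    using k p c s
    by (intro full_point_imp_aug_rank[OF braid_satellite_class(1)[OF u(1) w(1) k]]) auto
  then show ?thesis using braid_satellite_class(2)[OF u(1) w(1) k] u(2) w(2) by simp
qed

end
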